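(* Let $C$ be a regular cell decomposition of a surface $M$ and let $H=\mathrm{Sk}_1(C)$. (a) If $\chi(M)>0$, then $\delta(H)\leq 5$. (b) If $\chi(M)\leq 0$, then $\delta(H)\leq \left\lfloor\tfrac{1}{2}\left(5+\sqrt{49-24\chi(M)}\right)\right\rfloor$.
   Context: Surfaces are closed; $\chi(M)$ is the Euler characteristic of $M$. A cell decomposition of a surface is regular if there are no identifications on the boundary of any cell. $\mathrm{Sk}_1(C)$ denotes the $1$-skeleton (the graph of vertices and edges) of $C$, and $\delta(H)$ denotes the minimum vertex degree of the graph $H$. *)

theory Defs
  imports "HOL-Homology.Homology" "HOL-Library.Disjoint_Sets"
begin

subsection \<open>Closed surfaces\<close>

text \<open>Second countability is automatic for compact locally Euclidean spaces. Connectedness is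
  not required.\<close>

definition closed_surface :: "'a topology \<Rightarrow> bool" where
  "closed_surface M \<longleftrightarrow>
     topspace M \<noteq> {} \<and> compact_space M \<and> Hausdorff_space M \<and>
     (\<forall>x\<in>topspace M. \<exists>U. openin M U \<and> x \<in> U \<and>
        subtopology M U homeomorphic_space Euclidean_space 2)"

subsection \<open>Euler characteristic\<close>

text \<open>Homology groups are multiplicatively written abelian groups, so an integer linear
  combination is a finite product of integer powers.\<close>

definition int_independent :: "('a, 'b) monoid_scheme \<Rightarrow> 'a set \<Rightarrow> bool" where
  "int_independent G S \<longleftrightarrow>
     finite S \<and> S \<subseteq> carrier G \<and>
     (\<forall>c :: 'a \<Rightarrow> int. finprod G (\<lambda>x. x [^]\<^bsub>G\<^esub> c x) S = \<one>\<^bsub>G\<^esub> \<longrightarrow> (\<forall>x\<in>S. c x = 0))"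

text \<open>The (torsion-free) rank of an abelian group; meaningful for groups of finite rank, such as
  finitely generated ones.\<close>

definition abelian_rank :: "('a, 'b) monoid_scheme \<Rightarrow> nat" where
  "abelian_rank G = (SUP S \<in> {S. int_independent G S}. card S)"

definition betti :: "nat \<Rightarrow> 'a topology \<Rightarrow> nat" where
  "betti p X = abelian_rank (homology_group (int p) X)"

text \<open>The sum is finite for compact manifolds.\<close>

definition euler_characteristic :: "'a topology \<Rightarrow> int" where
  "euler_characteristic X = (\<Sum>p | betti p X \<noteq> 0. (- 1) ^ p * int (betti p X))"

subsection \<open>Cell decompositions\<close>

text \<open>For \<open>n = 0\<close> both the closed and the open unit ball are a single point and the unit sphere
  is empty.\<close>

definition unit_cball :: "nat \<Rightarrow> (nat \<Rightarrow> real) set" where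
  "unit_cball n = {x \<in> topspace (Euclidean_space n). (\<Sum>i<n. (x i)\<^sup>2) \<le> 1}"

definition unit_ball :: "nat \<Rightarrow> (nat \<Rightarrow> real) set" where
  "unit_ball n = {x \<in> topspace (Euclidean_space n). (\<Sum>i<n. (x i)\<^sup>2) < 1}"

definition unit_sphere :: "nat \<Rightarrow> (nat \<Rightarrow> real) set" where
  "unit_sphere n = {x \<in> topspace (Euclidean_space n). (\<Sum>i<n. (x i)\<^sup>2) = 1}"

text \<open>Cells are open cells, as subsets of the space; \<open>cells M C n\<close> are those of dimension \<open>n\<close>.\<close>

definition cells :: "'a topology \<Rightarrow> 'a set set \<Rightarrow> nat \<Rightarrow> 'a set set" where
  "cells M C n =
     {e \<in> C. subtopology (Euclidean_space n) (unit_ball n) homeomorphic_space subtopology M e}"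

definition characteristic_map ::
    "'a topology \<Rightarrow> 'a set set \<Rightarrow> nat \<Rightarrow> 'a set \<Rightarrow> ((nat \<Rightarrow> real) \<Rightarrow> 'a) \<Rightarrow> bool" where
  "characteristic_map M C n e \<phi> \<longleftrightarrow>
     continuous_map (subtopology (Euclidean_space n) (unit_cball n)) M \<phi> \<and>
     homeomorphic_map (subtopology (Euclidean_space n) (unit_ball n)) (subtopology M e) \<phi> \<and>
     \<phi> ` unit_sphere n \<subseteq> (\<Union>k<n. \<Union>(cells M C k))"

definition cell_decomposition :: "'a topology \<Rightarrow> 'a set set \<Rightarrow> bool" where
  "cell_decomposition M C \<longleftrightarrow>
     finite C \<and> partition_on (topspace M) C \<and>
     (\<forall>e\<in>C. \<exists>n \<phi>. characteristic_map M C n e \<phi>)"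

text \<open>Regularity: the attaching map of every cell makes no identifications on the boundary
  sphere.\<close>

definition regular_cell_decomposition :: "'a topology \<Rightarrow> 'a set set \<Rightarrow> bool" where
  "regular_cell_decomposition M C \<longleftrightarrow>
     cell_decomposition M C \<and>
     (\<forall>e\<in>C. \<exists>n \<phi>. characteristic_map M C n e \<phi> \<and> inj_on \<phi> (unit_sphere n))"

subsection \<open>The 1-skeleton as a graph\<close>

text \<open>A simple graph is a vertex set together with a set of two-element sets of vertices.\<close>

type_synonym 'v graph = "'v set \<times> 'v set set"

definition vertex_degree :: "'v graph \<Rightarrow> 'v \<Rightarrow> nat" where
  "vertex_degree H v = card {e \<in> snd H. v \<in> e}"

definition min_degree :: "'v graph \<Rightarrow> nat" where
  "min_degree H = Min (vertex_degree H ` fst H)"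

text \<open>The vertices are the 0-cells (singleton sets of points). Two of them are adjacent when they
  are the ends of a common 1-cell. Distinct 1-cells with the same two ends give a single edge of
  the graph, so the degree of a vertex is the number of its neighbours. Counting parallel 1-cells
  separately would be wrong for the intended bound: gluing digons in a cycle gives regular
  decompositions of the sphere with two 0-cells and arbitrarily many 1-cells.\<close>

definition Sk1 :: "'a topology \<Rightarrow> 'a set set \<Rightarrow> 'a set graph" where
  "Sk1 M C =
     (cells M C 0,
      {{u, v} | u v. u \<in> cells M C 0 \<and> v \<in> cells M C 0 \<and> u \<noteq> v \<and>
         (\<exists>e\<in>cells M C 1. M closure_of e = e \<union> u \<union> v)})"

end

theory Submission
  imports Defs
begin

text \<open>Singular homology gives \<open>\<chi>(M) = V - E + F\<close>: deleting the centre of a top-dimensional cell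
  changes the homology by that of a ball modulo its punctured ball (excision), and the remainder retracts
  onto the complement of the cell. By invariance of domain every edge lies on at most two faces, and every
  face has at least two sides; a face with exactly two sides is a digon between parallel edges.
  If some class of parallel edges has as many digons as edges, it closes up around its end points, which
  then have a single neighbour. Otherwise the digons of each class can be discarded together with all but one
  of its edges, and \<open>3 F \<le> 2 E\<close> for what is left bounds the number of edges of the
  graph by \<open>3 V - 3 \<chi>(M)\<close>. The bounds follow by comparison with \<open>\<delta> V\<close> and
  \<open>\<delta> + 1 \<le> V\<close>.\<close>

subsection \<open>Ranks of abelian groups\<close>

text \<open>The obstacle is that degrees are those of a simple graph, while \<chi> counts every
  1-cell. Write \<open>D\<close> for the number of digons and \<open>m\<close> for the number of
  edges of the simple graph. In the count the digons appear as a correction term: a face that is not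
  a digon has at least three sides, so \<open>3 F \<le> 2 E + D\<close>, and a parallel class that
  does not close up has fewer digons than edges, so \<open>D + m \<le> E\<close>. Together these
  give \<open>3 \<chi> \<le> 3 V - (E - D) \<le> 3 V - m\<close>. Since
  \<open>\<delta> V \<le> 2 m\<close>, this becomes
  \<open>(\<delta> - 6) V \<le> - 6 \<chi>\<close>. For \<delta> above 6, \<open>V\<close> may be
  replaced by \<delta> + 1; completing the square in
  \<open>(\<delta> - 6) (\<delta> + 1) \<le> - 6 \<chi>\<close> yields
  \<open>(2 \<delta> - 5)^2 \<le> 49 - 24 \<chi>\<close>, the origin of 5, 49 and 24. On the
  homological side, Betti numbers are torsion-free ranks because these add up along exact sequences
  of abelian groups without any splitting.\<close>

definition (in comm_group) int_comb :: "('i \<Rightarrow> 'a) \<Rightarrow> 'i set \<Rightarrow> ('i \<Rightarrow> int) \<Rightarrow> 'a" where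
  "int_comb g I c = (\<Otimes>i\<in>I. g i [^] c i)"

lemma (in comm_group) int_comb_closed [simp]:
  "g \<in> I \<rightarrow> carrier G \<Longrightarrow> int_comb g I c \<in> carrier G"
  unfolding int_comb_def by (rule finprod_closed) auto

lemma (in comm_group) int_comb_add:
  assumes "g \<in> I \<rightarrow> carrier G"
  shows "int_comb g I (\<lambda>i. c i + d i) = int_comb g I c \<otimes> int_comb g I d"
proof -
  have "int_comb g I (\<lambda>i. c i + d i) = (\<Otimes>i\<in>I. g i [^] c i \<otimes> g i [^] d i)"
    unfolding int_comb_def using assms by (intro finprod_cong') (auto simp: int_pow_mult Pi_iff)
  also have "\<dots> = int_comb g I c \<otimes> int_comb g I d"
    unfolding int_comb_def using assms by (intro finprod_multf) auto
  finally show ?thesis .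
qed

lemma (in comm_group) int_comb_pow:
  assumes "g \<in> I \<rightarrow> carrier G"
  shows "int_comb g I c [^] (a::int) = int_comb g I (\<lambda>i. c i * a)"
  using assms
proof (induction I rule: infinite_finite_induct)
  case (insert x F)
  have "int_comb g (insert x F) c = g x [^] c x \<otimes> int_comb g F c"
    unfolding int_comb_def using insert by (intro finprod_insert) auto
  moreover have "int_comb g (insert x F) (\<lambda>i. c i * a) = g x [^] (c x * a) \<otimes> int_comb g F (\<lambda>i. c i * a)"
    unfolding int_comb_def using insert by (intro finprod_insert) auto
  ultimately show ?case
    using insert by (simp add: int_pow_distrib int_pow_pow Pi_iff)
qed (auto simp: int_comb_def)

text \<open>Substituting combinations into a combination multiplies a coefficient matrix by a
  vector. In \<open>card_independent_le\<close> this turns a relation among constructed kernel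
  elements into a relation on the original set.\<close>

lemma (in comm_group) int_comb_int_comb:
  assumes "g \<in> S \<rightarrow> carrier G" "finite J"
  shows "int_comb (\<lambda>j. int_comb g S (d j)) J a = int_comb g S (\<lambda>x. \<Sum>j\<in>J. d j x * a j)"
  using assms(2)
proof (induction J)
  case empty
  then show ?case by (simp add: int_comb_def)
next
  case (insert j J)
  have "int_comb (\<lambda>j. int_comb g S (d j)) (insert j J) a
      = int_comb g S (d j) [^] a j \<otimes> int_comb (\<lambda>j. int_comb g S (d j)) J a"
    unfolding int_comb_def[of "\<lambda>j. int_comb g S (d j)"] using insert assms(1)
    by (intro finprod_insert) auto
  then show ?case
    using insert assms(1) by (simp add: int_comb_pow int_comb_add)
qed

lemma (in comm_group) int_comb_mono_neutral:
  assumes "finite S" "T \<subseteq> S" "g \<in> S \<rightarrow> carrier G" "\<And>x. x \<in> S - T \<Longrightarrow> c x = 0"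
  shows "int_comb g S c = int_comb g T c"
  unfolding int_comb_def
  by (rule finprod_mono_neutral_cong_right) (use assms in auto)

lemma hom_int_comb:
  assumes "comm_group G" "comm_group H" "f \<in> hom G H" "g \<in> I \<rightarrow> carrier G"
  shows "f (comm_group.int_comb G g I c) = comm_group.int_comb H (\<lambda>i. f (g i)) I c"
proof -
  interpret G: comm_group G by fact
  interpret H: comm_group H by fact
  have c: "f x \<in> carrier H" if "x \<in> carrier G" for x
    using assms(3) that by (auto simp: hom_def)
  have p: "f (x [^]\<^bsub>G\<^esub> (n::int)) = f x [^]\<^bsub>H\<^esub> n" if "x \<in> carrier G" for x n
    using that assms(3) by (metis G.group_axioms H.group_axioms hom_int_pow)
  show ?thesis
    using assms(4)
  proof (induction I rule: infinite_finite_induct)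
    case (insert x F)
    have "G.int_comb g (insert x F) c = g x [^]\<^bsub>G\<^esub> c x \<otimes>\<^bsub>G\<^esub> G.int_comb g F c"
      unfolding G.int_comb_def using insert by (intro G.finprod_insert) auto
    moreover have "H.int_comb (\<lambda>i. f (g i)) (insert x F) c
        = f (g x) [^]\<^bsub>H\<^esub> c x \<otimes>\<^bsub>H\<^esub> H.int_comb (\<lambda>i. f (g i)) F c"
      unfolding H.int_comb_def using insert c by (intro H.finprod_insert) auto
    ultimately show ?case
      using insert assms(3) by (simp add: hom_mult p)
  qed (use assms(3) in \<open>auto simp: G.int_comb_def H.int_comb_def hom_one\<close>)
qed

text \<open>Families instead of sets: a homomorphism may identify two elements of a set, and the
  resulting family has to count as dependent.\<close>

definition (in comm_group) indep_family :: "('i \<Rightarrow> 'a) \<Rightarrow> 'i set \<Rightarrow> bool" where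
  "indep_family g I \<longleftrightarrow> finite I \<and> g \<in> I \<rightarrow> carrier G \<and>
     (\<forall>c. int_comb g I c = \<one> \<longrightarrow> (\<forall>i\<in>I. c i = 0))"

lemma (in comm_group) int_independent_iff:
  "int_independent G S \<longleftrightarrow> indep_family (\<lambda>x. x) S"
  unfolding int_independent_def indep_family_def int_comb_def by auto

lemma (in comm_group) indep_family_image:
  assumes "indep_family g I"
  shows "int_independent G (g ` I)" "inj_on g I"
proof -
  have fin: "finite I" and g: "g \<in> I \<rightarrow> carrier G"
    and ind: "\<And>c. int_comb g I c = \<one> \<Longrightarrow> \<forall>i\<in>I. c i = 0"
    using assms by (auto simp: indep_family_def)
  show inj: "inj_on g I"
  proof (rule inj_onI, rule ccontr)
    fix i j assume ij: "i \<in> I" "j \<in> I" "g i = g j" "i \<noteq> j"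
    \<comment> \<open>Two indices with the same value satisfy the relation with coefficients 1 and
      -1.\<close>
    define c :: "_ \<Rightarrow> int" where "c = (\<lambda>x. if x = i then 1 else if x = j then -1 else 0)"
    have "int_comb g I c = int_comb g {i, j} c"
      using ij fin g by (intro int_comb_mono_neutral) (auto simp: c_def)
    also have "\<dots> = g i [^] (1::int) \<otimes> g j [^] (-1::int)"
      using ij g by (simp add: int_comb_def c_def Pi_iff)
    also have "\<dots> = \<one>"
      using ij g int_pow_mult[of "g j" 1 "-1"] by (auto simp: Pi_iff)
    finally show False
      using ind[of c] ij by (auto simp: c_def)
  qed
  show "int_independent G (g ` I)"
    unfolding int_independent_iff indep_family_def
  proof (intro conjI allI impI)
    fix c assume "int_comb (\<lambda>x. x) (g ` I) c = \<one>"
    moreover have "int_comb (\<lambda>x. x) (g ` I) c = int_comb g I (\<lambda>i. c (g i))"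
      unfolding int_comb_def using g by (intro finprod_reindex inj) auto
    ultimately show "\<forall>i\<in>g ` I. c i = 0"
      using ind by auto
  qed (use fin g in auto)
qed

text \<open>Rank of a subset measured inside the ambient group, so that kernels and images can be
  ranked without being turned into groups of their own.\<close>

definition set_rank :: "('a, 'b) monoid_scheme \<Rightarrow> 'a set \<Rightarrow> nat" where
  "set_rank G K = (SUP S \<in> {S. int_independent G S \<and> S \<subseteq> K}. card S)"

text \<open>Boundedness has to be recorded separately, because the supremum of an unbounded set of
  naturals carries no meaning.\<close>

definition finite_rank :: "('a, 'b) monoid_scheme \<Rightarrow> 'a set \<Rightarrow> bool" where
  "finite_rank G K \<longleftrightarrow> (\<exists>n. \<forall>S. int_independent G S \<longrightarrow> S \<subseteq> K \<longrightarrow> card S \<le> n)"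

lemma abelian_rank_eq_set_rank: "abelian_rank G = set_rank G (carrier G)"
proof -
  have "{S. int_independent G S} = {S. int_independent G S \<and> S \<subseteq> carrier G}"
    by (auto simp: int_independent_def)
  then show ?thesis
    by (simp add: abelian_rank_def set_rank_def)
qed

lemma finite_rank_mono: "finite_rank G K \<Longrightarrow> L \<subseteq> K \<Longrightarrow> finite_rank G L"
  unfolding finite_rank_def by blast

lemma int_independent_empty: "int_independent G {}"
  by (simp add: int_independent_def)

lemma card_le_set_rank:
  assumes "finite_rank G K" "int_independent G S" "S \<subseteq> K"
  shows "card S \<le> set_rank G K"
  unfolding set_rank_def
  using assms by (intro cSUP_upper) (auto simp: finite_rank_def bdd_above_def)

lemma set_rank_le:
  assumes "\<And>S. int_independent G S \<Longrightarrow> S \<subseteq> K \<Longrightarrow> card S \<le> n"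
  shows "finite_rank G K" "set_rank G K \<le> n"
  unfolding finite_rank_def set_rank_def
  using assms int_independent_empty[of G] by (auto intro!: cSUP_least)

lemma set_rank_attained:
  assumes "finite_rank G K"
  obtains S where "int_independent G S" "S \<subseteq> K" "card S = set_rank G K"
proof -
  let ?A = "card ` {S. int_independent G S \<and> S \<subseteq> K}"
  have ne: "?A \<noteq> {}"
    using int_independent_empty[of G] by blast
  have "finite ?A"
    using assms unfolding finite_rank_def bdd_above_nat[symmetric] bdd_above_def by auto
  then have "Sup ?A \<in> ?A"
    using ne by (simp add: cSup_eq_Max)
  then show thesis
    using that by (auto simp: set_rank_def)
qed

lemma set_rank_trivial:
  assumes "comm_group G" "K \<subseteq> {\<one>\<^bsub>G\<^esub>}"
  shows "finite_rank G K" "set_rank G K = 0"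
proof -
  interpret comm_group G by fact
  have "card S \<le> 0" if S: "int_independent G S" "S \<subseteq> K" for S
  proof (rule ccontr)
    assume "\<not> card S \<le> 0"
    then have "S = {\<one>\<^bsub>G\<^esub>}"
      using S assms(2) by (metis card.empty le0 subset_singletonD subset_trans)
    then have "(1::int) = 0"
      using S(1) unfolding int_independent_iff indep_family_def int_comb_def
      by (auto dest!: spec[of _ "\<lambda>_. 1"])
    then show False by simp
  qed
  then show "finite_rank G K" "set_rank G K = 0"
    using set_rank_le[of G K 0] by auto
qed

text \<open>Applying \<open>f\<close> to a relation kills the part on \<open>S\<close>, so
  independence of \<open>T\<close> removes the coefficients on the lifts; what remains is a relation
  on \<open>S\<close> alone. This is the half of rank-nullity that bounds the rank of
  \<open>G\<close> from below.\<close>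

lemma lift_independent:
  assumes "comm_group G" "comm_group H" and f: "f \<in> hom G H"
    and S: "int_independent G S" "S \<subseteq> kernel G H f"
    and T: "int_independent H T" and l: "\<And>y. y \<in> T \<Longrightarrow> l y \<in> carrier G \<and> f (l y) = y"
  shows "int_independent G (S \<union> l ` T)" "card (S \<union> l ` T) = card S + card T"
proof -
  interpret G: comm_group G by fact
  interpret H: comm_group H by fact
  have finS: "finite S" and SG: "S \<subseteq> carrier G" and finT: "finite T" and TH: "T \<subseteq> carrier H"
    using S T by (auto simp: int_independent_def)
  have inj: "inj_on l T"
    by (metis inj_onI l)
  \<comment> \<open>A lift lying in the kernel would come from the identity, which no independent
    set contains; hence \<open>S\<close> and the lifts are disjoint.\<close>
  have nT: "\<one>\<^bsub>H\<^esub> \<notin> T"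
  proof
    assume one: "\<one>\<^bsub>H\<^esub> \<in> T"
    define c :: "_ \<Rightarrow> int" where "c = (\<lambda>x. if x = \<one>\<^bsub>H\<^esub> then 1 else 0)"
    have "H.int_comb (\<lambda>x. x) T c = H.int_comb (\<lambda>x. x) {\<one>\<^bsub>H\<^esub>} c"
      using finT TH one by (intro H.int_comb_mono_neutral) (auto simp: c_def)
    also have "\<dots> = \<one>\<^bsub>H\<^esub>"
      by (simp add: H.int_comb_def)
    finally show False
      using T one unfolding H.int_independent_iff H.indep_family_def c_def by fastforce
  qed
  have disj: "S \<inter> l ` T = {}"
    using S(2) l nT by (fastforce simp: kernel_def)
  show "card (S \<union> l ` T) = card S + card T"
    using disj finS finT inj by (simp add: card_Un_disjoint card_image)
  show "int_independent G (S \<union> l ` T)"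
    unfolding G.int_independent_iff G.indep_family_def
  proof (intro conjI allI impI)
    fix c assume c: "G.int_comb (\<lambda>x. x) (S \<union> l ` T) c = \<one>\<^bsub>G\<^esub>"
    have split: "G.int_comb (\<lambda>x. x) (S \<union> l ` T) c
        = G.int_comb (\<lambda>x. x) S c \<otimes>\<^bsub>G\<^esub> G.int_comb (\<lambda>x. x) (l ` T) c"
      unfolding G.int_comb_def using finS finT disj SG l
      by (intro G.finprod_Un_disjoint) auto
    have lT: "G.int_comb (\<lambda>x. x) (l ` T) c = G.int_comb l T (\<lambda>y. c (l y))"
      unfolding G.int_comb_def using l by (intro G.finprod_reindex inj) auto
    have "f (G.int_comb (\<lambda>x. x) S c) = H.int_comb (\<lambda>x. f x) S c"
      using SG by (intro hom_int_comb assms(1,2) f) auto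
    also have "\<dots> = \<one>\<^bsub>H\<^esub>"
      unfolding H.int_comb_def using S(2) by (intro H.finprod_one_eqI) (auto simp: kernel_def)
    finally have fS: "f (G.int_comb (\<lambda>x. x) S c) = \<one>\<^bsub>H\<^esub>" .
    have "f (G.int_comb l T (\<lambda>y. c (l y))) = H.int_comb (\<lambda>y. f (l y)) T (\<lambda>y. c (l y))"
      using l by (intro hom_int_comb assms(1,2) f) auto
    also have "\<dots> = H.int_comb (\<lambda>y. y) T (\<lambda>y. c (l y))"
      unfolding H.int_comb_def using l TH by (intro H.finprod_cong') auto
    finally have flT: "f (G.int_comb l T (\<lambda>y. c (l y))) = H.int_comb (\<lambda>y. y) T (\<lambda>y. c (l y))" .
    have "f (G.int_comb (\<lambda>x. x) S c \<otimes>\<^bsub>G\<^esub> G.int_comb l T (\<lambda>y. c (l y))) = \<one>\<^bsub>H\<^esub>"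
      using c split lT hom_one[OF f] by simp
    moreover have "G.int_comb (\<lambda>x. x) S c \<in> carrier G" "G.int_comb l T (\<lambda>y. c (l y)) \<in> carrier G"
      using SG l by (auto intro!: G.int_comb_closed)
    moreover have "H.int_comb (\<lambda>y. y) T (\<lambda>y. c (l y)) \<in> carrier H"
      using TH by (auto intro!: H.int_comb_closed)
    ultimately have "H.int_comb (\<lambda>y. y) T (\<lambda>y. c (l y)) = \<one>\<^bsub>H\<^esub>"
      using flT fS by (simp add: hom_mult[OF f])
    then have T0: "\<forall>y\<in>T. c (l y) = 0"
      using T unfolding H.int_independent_iff H.indep_family_def by fast
    then have "G.int_comb l T (\<lambda>y. c (l y)) = \<one>\<^bsub>G\<^esub>"
      unfolding G.int_comb_def by (intro G.finprod_one_eqI) auto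
    then have "G.int_comb (\<lambda>x. x) S c = \<one>\<^bsub>G\<^esub>"
      using c split lT SG by (simp add: subset_iff Pi_iff)
    then have "\<forall>x\<in>S. c x = 0"
      using S unfolding G.int_independent_iff G.indep_family_def by blast
    then show "\<forall>x\<in>S \<union> l ` T. c x = 0"
      using T0 by auto
  qed (use finS finT SG l in auto)
qed

text \<open>An independent set \<open>S\<close> splits into a maximal part \<open>T\<close> with independent image and, for each of
  the remaining elements, a combination with \<open>T\<close> in the kernel.\<close>

lemma card_independent_le:
  assumes "comm_group G" "comm_group H" and f: "f \<in> hom G H"
    and fin: "finite_rank G (kernel G H f)" "finite_rank H (f ` carrier G)"
    and S: "int_independent G S"
  shows "card S \<le> set_rank G (kernel G H f) + set_rank H (f ` carrier G)"
proof -
  interpret G: comm_group G by fact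
  interpret H: comm_group H by fact
  have finS: "finite S" and SG: "S \<subseteq> carrier G"
    using S by (auto simp: int_independent_def)
  have fc: "f x \<in> carrier H" if "x \<in> carrier G" for x
    using f that by (auto simp: hom_def)
  have "\<exists>T. (T \<subseteq> S \<and> H.indep_family f T) \<and> (\<forall>U. U \<subseteq> S \<and> H.indep_family f U \<longrightarrow> card U \<le> card T)"
  proof (rule ex_has_greatest_nat[where b = "Suc (card S)"])
    show "{} \<subseteq> S \<and> H.indep_family f {}"
      by (simp add: H.indep_family_def)
    show "\<forall>U. U \<subseteq> S \<and> H.indep_family f U \<longrightarrow> card U < Suc (card S)"
      using finS card_mono by (auto simp: less_Suc_eq_le)
  qed
  then obtain T where T: "T \<subseteq> S" "H.indep_family f T"
    and max: "\<And>U. U \<subseteq> S \<Longrightarrow> H.indep_family f U \<Longrightarrow> card U \<le> card T"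
    by blast
  have finT: "finite T"
    using T finS finite_subset by blast
  have cardT: "card T \<le> set_rank H (f ` carrier G)"
  proof -
    have "card T = card (f ` T)"
      using H.indep_family_image[OF T(2)] by (simp add: card_image)
    also have "\<dots> \<le> set_rank H (f ` carrier G)"
      using H.indep_family_image[OF T(2)] T(1) SG fin(2) by (intro card_le_set_rank) auto
    finally show ?thesis .
  qed
  \<comment> \<open>By maximality of \<open>T\<close>, adding \<open>s\<close> creates a relation
    among the images; \<open>s\<close> occurs in it because \<open>T\<close> alone is independent.
    The coefficients are extended by zero to all of \<open>S\<close>.\<close>
  have "\<exists>c. H.int_comb f S c = \<one>\<^bsub>H\<^esub> \<and> c s \<noteq> (0::int) \<and> (\<forall>x\<in>S - insert s T. c x = 0)" if s: "s \<in> S - T" for s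
  proof -
    have "\<not> H.indep_family f (insert s T)"
      using max[of "insert s T"] s T(1) finT by auto
    moreover have fsT: "f \<in> insert s T \<rightarrow> carrier H"
      using T(1) SG s fc by auto
    ultimately obtain c where c: "H.int_comb f (insert s T) c = \<one>\<^bsub>H\<^esub>" and nz: "\<exists>i\<in>insert s T. c i \<noteq> (0::int)"
      using finT fsT unfolding H.indep_family_def by auto
    have cs: "c s \<noteq> 0"
    proof
      assume "c s = 0"
      then have "H.int_comb f (insert s T) c = H.int_comb f T c"
        using finT s SG fc T(1) by (intro H.int_comb_mono_neutral) auto
      then show False
        using T(2) c nz \<open>c s = 0\<close> unfolding H.indep_family_def by (metis insert_iff)
    qed
    define d where "d = (\<lambda>x. if x \<in> insert s T then c x else 0)"
    have "H.int_comb f S d = H.int_comb f (insert s T) d"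
      using finS s SG fc T(1) by (intro H.int_comb_mono_neutral) (auto simp: d_def)
    also have "\<dots> = H.int_comb f (insert s T) c"
      unfolding H.int_comb_def d_def using s SG fc T(1) by (intro H.finprod_cong') auto
    finally show ?thesis
      using c cs by (intro exI[of _ d]) (auto simp: d_def)
  qed
  then obtain d where d: "\<And>s. s \<in> S - T \<Longrightarrow> H.int_comb f S (d s) = \<one>\<^bsub>H\<^esub>"
    "\<And>s. s \<in> S - T \<Longrightarrow> d s s \<noteq> (0::int)" "\<And>s x. s \<in> S - T \<Longrightarrow> x \<in> S - insert s T \<Longrightarrow> d s x = 0"
    by metis
  define k where "k = (\<lambda>s. G.int_comb (\<lambda>x. x) S (d s))"
  have id: "(\<lambda>x. x) \<in> S \<rightarrow> carrier G"
    using SG by auto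
  have kK: "k s \<in> kernel G H f" if "s \<in> S - T" for s
    using d(1)[OF that] hom_int_comb[OF assms(1,2) f id] id unfolding kernel_def k_def by simp
  \<comment> \<open>Restricted to \<open>S - T\<close> the coefficient matrix \<open>d\<close> is
    diagonal with nonzero entries, so a relation among the \<open>k s\<close> can be tested one
    coordinate at a time.\<close>
  have "G.indep_family k (S - T)"
    unfolding G.indep_family_def
  proof (intro conjI allI impI)
    show "finite (S - T)" using finS by simp
    show "k \<in> S - T \<rightarrow> carrier G" using kK by (auto simp: kernel_def)
    fix a assume "G.int_comb k (S - T) a = \<one>\<^bsub>G\<^esub>"
    then have "G.int_comb (\<lambda>x. x) S (\<lambda>x. \<Sum>j\<in>S - T. d j x * a j) = \<one>\<^bsub>G\<^esub>"
      unfolding k_def using G.int_comb_int_comb[OF id, of "S - T"] finS by simp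
    then have z: "(\<Sum>j\<in>S - T. d j x * a j) = 0" if "x \<in> S" for x
      using S that unfolding G.int_independent_iff G.indep_family_def by blast
    show "\<forall>s\<in>S - T. a s = 0"
    proof
      fix s assume s: "s \<in> S - T"
      have "d j s = 0" if "j \<in> S - T - {s}" for j
        using d(3)[of j s] s that by blast
      then have "(\<Sum>j\<in>S - T. d j s * a j) = d s s * a s"
        using s finS by (subst sum.remove[of _ s]) (auto intro!: sum.neutral)
      then show "a s = 0"
        using z[of s] s d(2) by simp
    qed
  qed
  note k = G.indep_family_image[OF this]
  have "card (S - T) = card (k ` (S - T))"
    using k by (simp add: card_image)
  also have "\<dots> \<le> set_rank G (kernel G H f)"
    using k kK fin(1) by (intro card_le_set_rank) auto
  finally show ?thesis
    using cardT T(1) finT finS by (simp add: card_Diff_subset)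
qed

text \<open>Finiteness is stated as an equivalence because in a long exact sequence it first passes
  down from the outer groups to kernels and images, and then up to the middle group.\<close>

lemma rank_nullity:
  assumes "comm_group G" "comm_group H" and f: "f \<in> hom G H"
  shows "finite_rank G (carrier G) \<longleftrightarrow> finite_rank G (kernel G H f) \<and> finite_rank H (f ` carrier G)"
    and "finite_rank G (carrier G) \<Longrightarrow>
      set_rank G (carrier G) = set_rank G (kernel G H f) + set_rank H (f ` carrier G)"
proof -
  have lift: "\<exists>U. int_independent G U \<and> U \<subseteq> carrier G \<and> card U = card S + card T"
    if S: "int_independent G S" "S \<subseteq> kernel G H f" and T: "int_independent H T" "T \<subseteq> f ` carrier G" for S T
  proof -
    obtain l where l: "\<And>y. y \<in> T \<Longrightarrow> l y \<in> carrier G \<and> f (l y) = y"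
      using T(2) by (metis image_iff subsetD)
    show ?thesis
      using lift_independent[OF assms S T(1) l] l S(1)
      by (intro exI[of _ "S \<union> l ` T"]) (auto simp: int_independent_def)
  qed
  have fin: "finite_rank G (kernel G H f)" "finite_rank H (f ` carrier G)" if G: "finite_rank G (carrier G)"
  proof -
    show "finite_rank G (kernel G H f)"
      using G by (rule finite_rank_mono) (auto simp: kernel_def)
    have "card T \<le> set_rank G (carrier G)" if "int_independent H T" "T \<subseteq> f ` carrier G" for T
      using lift[OF int_independent_empty[of G] empty_subsetI that] card_le_set_rank[OF G] by fastforce
    then show "finite_rank H (f ` carrier G)"
      by (rule set_rank_le)
  qed
  show "finite_rank G (carrier G) \<longleftrightarrow> finite_rank G (kernel G H f) \<and> finite_rank H (f ` carrier G)"
  proof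
    assume "finite_rank G (kernel G H f) \<and> finite_rank H (f ` carrier G)"
    then have "card S \<le> set_rank G (kernel G H f) + set_rank H (f ` carrier G)"
      if "int_independent G S" for S
      using card_independent_le[OF assms _ _ that] by blast
    then show "finite_rank G (carrier G)"
      by (rule set_rank_le(1))
  qed (use fin in blast)
  show "set_rank G (carrier G) = set_rank G (kernel G H f) + set_rank H (f ` carrier G)"
    if G: "finite_rank G (carrier G)"
  proof (rule antisym)
    show "set_rank G (carrier G) \<le> set_rank G (kernel G H f) + set_rank H (f ` carrier G)"
      by (rule set_rank_le(2), rule card_independent_le[OF assms fin[OF G]])
    obtain S where S: "int_independent G S" "S \<subseteq> kernel G H f" "card S = set_rank G (kernel G H f)"
      using set_rank_attained[OF fin(1)[OF G]] .
    obtain T where T: "int_independent H T" "T \<subseteq> f ` carrier G" "card T = set_rank H (f ` carrier G)"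
      using set_rank_attained[OF fin(2)[OF G]] .
    show "set_rank G (kernel G H f) + set_rank H (f ` carrier G) \<le> set_rank G (carrier G)"
      using lift[OF S(1,2) T(1,2)] S(3) T(3) card_le_set_rank[OF G] by metis
  qed
qed

lemma rank_iso:
  assumes "comm_group G" "comm_group H" "G \<cong> H"
  shows "finite_rank G (carrier G) \<longleftrightarrow> finite_rank H (carrier H)"
    and "finite_rank G (carrier G) \<Longrightarrow> set_rank G (carrier G) = set_rank H (carrier H)"
proof -
  interpret G: comm_group G by fact
  interpret H: comm_group H by fact
  obtain f where f: "f \<in> hom G H" "bij_betw f (carrier G) (carrier H)"
    using assms(3) by (auto simp: is_iso_def iso_def)
  have im: "f ` carrier G = carrier H"
    using f(2) by (simp add: bij_betw_def)
  have "f \<one>\<^bsub>G\<^esub> = \<one>\<^bsub>H\<^esub>"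
    using hom_one[OF f(1)] by simp
  then have "x = \<one>\<^bsub>G\<^esub>" if "x \<in> carrier G" "f x = \<one>\<^bsub>H\<^esub>" for x
    using that inj_onD[OF bij_betw_imp_inj_on[OF f(2)], of x "\<one>\<^bsub>G\<^esub>"] by simp
  then have ker: "kernel G H f \<subseteq> {\<one>\<^bsub>G\<^esub>}"
    unfolding kernel_def by (intro subsetI) simp
  show "finite_rank G (carrier G) \<longleftrightarrow> finite_rank H (carrier H)"
    "finite_rank G (carrier G) \<Longrightarrow> set_rank G (carrier G) = set_rank H (carrier H)"
    using rank_nullity[OF assms(1,2) f(1)] set_rank_trivial[OF assms(1) ker] im by auto
qed

lemma rank_integer_group:
  "finite_rank integer_group (carrier integer_group)"
  "set_rank integer_group (carrier integer_group) = 1"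
proof -
  interpret comm_group integer_group
    by (rule abelian_integer_group)
  have le: "card S \<le> 1" if S: "int_independent integer_group S" for S :: "int set"
  proof (rule ccontr)
    assume "\<not> card S \<le> 1"
    then obtain x y where xy: "x \<in> S" "y \<in> S" "x \<noteq> y"
      using S card_le_Suc0_iff_eq[of S] by (auto simp: int_independent_def)
    have fin: "finite S" using S by (simp add: int_independent_def)
    have ind: "\<And>c. int_comb (\<lambda>x. x) S c = 0 \<Longrightarrow> \<forall>x\<in>S. c x = 0"
      using S unfolding int_independent_iff indep_family_def by simp
    \<comment> \<open>Powers in \<open>integer_group\<close> are multiples, so this is the relation
      \<open>y * x - x * y = 0\<close>: two distinct integers are always dependent.\<close>
    define c where "c = (\<lambda>z. if z = x then y else if z = y then - x else 0)"
    have "int_comb (\<lambda>x. x) S c = int_comb (\<lambda>x. x) {x, y} c"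
      using xy fin by (intro int_comb_mono_neutral) (auto simp: c_def)
    also have "\<dots> = 0"
      using xy by (simp add: int_comb_def c_def)
    finally have "y = 0" "x = 0"
      using ind[of c] xy by (auto simp: c_def split: if_splits)
    then show False using xy by simp
  qed
  show fin: "finite_rank integer_group (carrier integer_group)"
    by (rule set_rank_le(1)) (rule le)
  have "int_independent integer_group {1::int}"
    unfolding int_independent_iff indep_family_def int_comb_def by simp
  then have "1 \<le> set_rank integer_group (carrier integer_group)"
    using card_le_set_rank[OF fin, of "{1}"] by simp
  moreover have "set_rank integer_group (carrier integer_group) \<le> 1"
    by (rule set_rank_le(2)) (rule le)
  ultimately show "set_rank integer_group (carrier integer_group) = 1"
    by simp
qed

subsection \<open>Euler characteristics of pairs\<close>

definition rel_rank :: "nat \<Rightarrow> 'a topology \<Rightarrow> 'a set \<Rightarrow> nat" where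
  "rel_rank p X S =
     set_rank (relative_homology_group (int p) X S) (carrier (relative_homology_group (int p) X S))"

text \<open>A relation instead of a function: it certifies finite rank in every degree and vanishing
  in high degrees, so the alternating sum is meaningful. Any larger \<open>N\<close> gives the same
  sum, which lets the sums of several pairs be cut off at a common degree.\<close>

definition has_euler :: "'a topology \<Rightarrow> 'a set \<Rightarrow> int \<Rightarrow> bool" where
  "has_euler X S c \<longleftrightarrow>
     (\<forall>p. finite_rank (relative_homology_group (int p) X S)
            (carrier (relative_homology_group (int p) X S))) \<and>
     (\<exists>N. (\<forall>p>N. rel_rank p X S = 0) \<and> c = (\<Sum>p\<le>N. (- 1) ^ p * int (rel_rank p X S)))"

lemma has_euler_sum:
  assumes "has_euler X S c"
  obtains N where "\<And>K p. N \<le> K \<Longrightarrow> K < p \<Longrightarrow> rel_rank p X S = 0"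
    "\<And>K. N \<le> K \<Longrightarrow> c = (\<Sum>p\<le>K. (- 1) ^ p * int (rel_rank p X S))"
proof -
  obtain N where N: "\<forall>p>N. rel_rank p X S = 0" "c = (\<Sum>p\<le>N. (- 1) ^ p * int (rel_rank p X S))"
    using assms by (auto simp: has_euler_def)
  have "c = (\<Sum>p\<le>K. (- 1) ^ p * int (rel_rank p X S))" if "N \<le> K" for K
    unfolding N(2) using N(1) that by (intro sum.mono_neutral_left) auto
  then show thesis
    using N(1) by (intro that[of N]) auto
qed

lemma euler_characteristic_eqI:
  assumes "has_euler X {} c"
  shows "euler_characteristic X = c"
proof -
  obtain N where N: "\<And>K p. N \<le> K \<Longrightarrow> K < p \<Longrightarrow> rel_rank p X {} = 0"
    "\<And>K. N \<le> K \<Longrightarrow> c = (\<Sum>p\<le>K. (- 1) ^ p * int (rel_rank p X {}))"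
    using has_euler_sum[OF assms] by blast
  have b: "betti p X = rel_rank p X {}" for p
    by (simp add: betti_def rel_rank_def abelian_rank_eq_set_rank)
  have "euler_characteristic X = (\<Sum>p\<le>N. (- 1) ^ p * int (rel_rank p X {}))"
    unfolding euler_characteristic_def b
  proof (rule sum.mono_neutral_left)
    show "{p. rel_rank p X {} \<noteq> 0} \<subseteq> {..N}"
      using N(1)[of N] by (auto simp: not_less[symmetric])
  qed auto
  then show ?thesis
    using N(2)[of N] by simp
qed

lemma has_euler_iso:
  assumes "has_euler X S c"
    and iso: "\<And>p. relative_homology_group (int p) X S \<cong> relative_homology_group (int p) Y T"
  shows "has_euler Y T c"
proof -
  have "rel_rank p X S = rel_rank p Y T" for p
    unfolding rel_rank_def using assms(1)
    by (intro rank_iso(2)[OF _ _ iso]) (auto simp: has_euler_def)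
  moreover have "finite_rank (relative_homology_group (int p) Y T)
     (carrier (relative_homology_group (int p) Y T))" for p
    using assms(1) rank_iso(1)[OF _ _ iso[of p]] by (simp add: has_euler_def)
  ultimately show ?thesis
    using assms(1) by (simp add: has_euler_def)
qed

lemma has_euler_concentrated:
  assumes Z: "relative_homology_group (int n) X S \<cong> integer_group"
    and triv: "\<And>p. p \<noteq> n \<Longrightarrow> trivial_group (relative_homology_group (int p) X S)"
  shows "has_euler X S ((- 1) ^ n)"
proof -
  have n: "finite_rank (relative_homology_group (int n) X S) (carrier (relative_homology_group (int n) X S))"
    "rel_rank n X S = 1"
    using rank_iso[OF _ _ Z] rank_integer_group abelian_integer_group by (auto simp: rel_rank_def)
  have p: "finite_rank (relative_homology_group (int p) X S) (carrier (relative_homology_group (int p) X S))"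
    "rel_rank p X S = 0" if "p \<noteq> n" for p
    using triv[OF that] set_rank_trivial[of "relative_homology_group (int p) X S" "carrier (relative_homology_group (int p) X S)"]
    by (auto simp: rel_rank_def trivial_group_def)
  have "(\<Sum>p\<le>n. (- 1) ^ p * int (rel_rank p X S)) = (\<Sum>p\<le>n. if p = n then (- 1) ^ n else 0)"
    using p n by (intro sum.cong) auto
  also have "\<dots> = (- 1) ^ n" by simp
  finally show ?thesis
    unfolding has_euler_def using n p
    by (intro conjI allI exI[of _ n]) (metis, auto)
qed

lemma has_euler_empty: "topspace X = {} \<Longrightarrow> has_euler X {} 0"
proof -
  assume X: "topspace X = {}"
  have p: "finite_rank (relative_homology_group (int p) X {}) (carrier (relative_homology_group (int p) X {}))"
    "rel_rank p X {} = 0" for p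
    using trivial_homology_group_empty[OF X, of p]
      set_rank_trivial[of "relative_homology_group (int p) X {}" "carrier (relative_homology_group (int p) X {})"]
    by (auto simp: rel_rank_def trivial_group_def)
  then show "has_euler X {} 0"
    unfolding has_euler_def by auto
qed

lemma alternating_sum_telescope:
  fixes d :: "nat \<Rightarrow> int"
  shows "(\<Sum>p\<le>N. (- 1) ^ p * (d p + d (Suc p))) = d 0 + (- 1) ^ N * d (Suc N)"
  by (induction N) (auto simp: algebra_simps)

text \<open>Let \<open>d p\<close> be the rank of the connecting map out of degree \<open>p\<close>.
  By exactness the rank for \<open>X\<close> falls short of the sum of the ranks for the subspace
  and the pair by \<open>d p + d (Suc p)\<close>, and the alternating sum of these defects
  telescopes to its two end terms.\<close>

lemma has_euler_pair:
  assumes A: "has_euler (subtopology X S) {} a" and R: "has_euler X S r"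
  shows "has_euler X {} (a + r)"
proof -
  let ?A = "\<lambda>p::nat. homology_group (int p) (subtopology X S)"
  let ?X = "\<lambda>p::nat. homology_group (int p) X"
  let ?R = "\<lambda>p::nat. relative_homology_group (int p) X S"
  let ?B = "\<lambda>p::nat. homology_group (int p - 1) (subtopology X S)"
  let ?i = "\<lambda>p::nat. hom_induced (int p) (subtopology X S) {} X {} id"
  let ?j = "\<lambda>p::nat. hom_induced (int p) X {} X S id"
  let ?d = "\<lambda>p::nat. hom_boundary (int p) X S"
  have kj: "kernel (?X p) (?R p) (?j p) = ?i p ` carrier (?A p)" for p
    using homology_exactness_axiom_3[of "int p" X S] by simp
  have kd: "kernel (?R p) (?B p) (?d p) = ?j p ` carrier (?X p)" for p
    using homology_exactness_axiom_1[of "int p" X S] by simp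
  have ki: "kernel (?A p) (?X p) (?i p) = ?d (Suc p) ` carrier (?R (Suc p))" for p
    using homology_exactness_axiom_2[of "int (Suc p)" X S] by simp
  have hi: "?i p \<in> hom (?A p) (?X p)" and hj: "?j p \<in> hom (?X p) (?R p)" and hd: "?d p \<in> hom (?R p) (?B p)" for p
    by (simp_all add: hom_induced_hom hom_boundary_hom)
  have finA: "finite_rank (?A p) (carrier (?A p))" and finR: "finite_rank (?R p) (carrier (?R p))" for p
    using A R by (auto simp: has_euler_def)
  have finX: "finite_rank (?X p) (carrier (?X p))" for p
    using rank_nullity(1)[OF _ _ hj[of p]] rank_nullity(1)[OF _ _ hi[of p]] rank_nullity(1)[OF _ _ hd[of p]]
      finA[of p] finR[of p] by (simp add: kj kd)
  define d where "d = (\<lambda>p. set_rank (?B p) (?d p ` carrier (?R p)))"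
  have eqs: "rel_rank p (subtopology X S) {} = d (Suc p) + set_rank (?X p) (?i p ` carrier (?A p))"
    "rel_rank p X {} = set_rank (?X p) (?i p ` carrier (?A p)) + set_rank (?R p) (?j p ` carrier (?X p))"
    "rel_rank p X S = set_rank (?R p) (?j p ` carrier (?X p)) + d p" for p
    using rank_nullity(2)[OF _ _ hi[of p] finA] rank_nullity(2)[OF _ _ hj[of p] finX]
      rank_nullity(2)[OF _ _ hd[of p] finR]
    by (simp_all add: rel_rank_def d_def ki kj kd)
  \<comment> \<open>The lower end of the telescope: the connecting map from degree 0 lands in degree
    -1, where homology is trivial.\<close>
  have d0: "d 0 = 0"
  proof -
    have "carrier (?B 0) = {\<one>\<^bsub>?B 0\<^esub>}"
      using trivial_homology_group[of "int 0 - 1" "subtopology X S"] by (simp add: trivial_group_def)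
    moreover have "?d 0 ` carrier (?R 0) \<subseteq> carrier (?B 0)"
      using hd[of 0] by (auto simp: hom_def)
    ultimately have "?d 0 ` carrier (?R 0) \<subseteq> {\<one>\<^bsub>?B 0\<^esub>}"
      by simp
    then show ?thesis
      unfolding d_def by (intro set_rank_trivial(2)) auto
  qed
  obtain NA where NA: "\<And>K p. NA \<le> K \<Longrightarrow> K < p \<Longrightarrow> rel_rank p (subtopology X S) {} = 0"
    "\<And>K. NA \<le> K \<Longrightarrow> a = (\<Sum>p\<le>K. (- 1) ^ p * int (rel_rank p (subtopology X S) {}))"
    using has_euler_sum[OF A] by blast
  obtain NR where NR: "\<And>K p. NR \<le> K \<Longrightarrow> K < p \<Longrightarrow> rel_rank p X S = 0"
    "\<And>K. NR \<le> K \<Longrightarrow> r = (\<Sum>p\<le>K. (- 1) ^ p * int (rel_rank p X S))"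
    using has_euler_sum[OF R] by blast
  define N where "N = max NA NR"
  have x: "int (rel_rank p X {})
      = int (rel_rank p (subtopology X S) {}) + int (rel_rank p X S) - (int (d p) + int (d (Suc p)))" for p
    using eqs[of p] by linarith
  \<comment> \<open>The upper end: beyond \<open>N\<close> the relative groups have rank 0.\<close>
  have "d (Suc N) = 0"
    using eqs(3)[of "Suc N"] NR(1)[of N "Suc N"] by (simp add: N_def)
  then have "(\<Sum>p\<le>N. (- 1) ^ p * (int (d p) + int (d (Suc p)))) = 0"
    using d0 by (simp add: alternating_sum_telescope[of "\<lambda>p. int (d p)"])
  moreover have "(\<Sum>p\<le>N. (- 1) ^ p * int (rel_rank p X {}))
    = (\<Sum>p\<le>N. (- 1) ^ p * int (rel_rank p (subtopology X S) {}))
    + (\<Sum>p\<le>N. (- 1) ^ p * int (rel_rank p X S))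
    - (\<Sum>p\<le>N. (- 1) ^ p * (int (d p) + int (d (Suc p))))"
    unfolding x sum.distrib[symmetric] sum_subtractf[symmetric] by (simp add: algebra_simps)
  ultimately have "a + r = (\<Sum>p\<le>N. (- 1) ^ p * int (rel_rank p X {}))"
    using NA(2)[of N] NR(2)[of N] by (simp add: N_def)
  moreover have "rel_rank p X {} = 0" if "p > N" for p
    using eqs[of p] NA(1)[of N p] NR(1)[of N p] that by (simp add: N_def)
  ultimately show ?thesis
    unfolding has_euler_def using finX by blast
qed

subsection \<open>Balls and spheres\<close>

definition enorm :: "nat \<Rightarrow> (nat \<Rightarrow> real) \<Rightarrow> real" where
  "enorm n x = sqrt (\<Sum>i<n. (x i)\<^sup>2)"

lemma enorm_nonneg [simp]: "0 \<le> enorm n x"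
  by (simp add: enorm_def sum_nonneg)

lemma enorm_scale: "enorm n (\<lambda>i. c * x i) = \<bar>c\<bar> * enorm n x"
  by (simp add: enorm_def power_mult_distrib sum_distrib_left[symmetric] real_sqrt_mult)

lemma enorm_eq_0: "x \<in> topspace (Euclidean_space n) \<Longrightarrow> enorm n x = 0 \<longleftrightarrow> x = (\<lambda>_. 0)"
  by (auto simp: enorm_def sum_nonneg_eq_0_iff topspace_Euclidean_space fun_eq_iff)
     (metis lessThan_iff not_le)

lemma enorm_zero [simp]: "enorm n (\<lambda>_. 0) = 0"
  by (simp add: enorm_def)

lemma unit_cball_iff: "x \<in> unit_cball n \<longleftrightarrow> x \<in> topspace (Euclidean_space n) \<and> enorm n x \<le> 1"
  by (simp add: unit_cball_def enorm_def)

lemma unit_ball_iff: "x \<in> unit_ball n \<longleftrightarrow> x \<in> topspace (Euclidean_space n) \<and> enorm n x < 1"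
  by (simp add: unit_ball_def enorm_def)

lemma unit_sphere_iff: "x \<in> unit_sphere n \<longleftrightarrow> x \<in> topspace (Euclidean_space n) \<and> enorm n x = 1"
  by (simp add: unit_sphere_def enorm_def)

lemma scale_in_Euclidean_space:
  "x \<in> topspace (Euclidean_space n) \<Longrightarrow> (\<lambda>i. c * x i) \<in> topspace (Euclidean_space n)"
  by (simp add: topspace_Euclidean_space)

lemma zero_in_Euclidean_space [simp]: "(\<lambda>_. 0) \<in> topspace (Euclidean_space n)"
  by (simp add: topspace_Euclidean_space)

lemma zero_in_unit_ball [simp]: "(\<lambda>_. 0) \<in> unit_ball n"
  by (simp add: unit_ball_iff)

lemma unit_cball_eq_Un: "unit_cball n = unit_ball n \<union> unit_sphere n"
  by (auto simp: unit_cball_iff unit_ball_iff unit_sphere_iff)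

lemma unit_ball_sphere_disjoint: "unit_ball n \<inter> unit_sphere n = {}"
  by (auto simp: unit_ball_iff unit_sphere_iff)

lemma unit_cball_subset: "unit_cball n \<subseteq> topspace (Euclidean_space n)"
  and unit_ball_subset: "unit_ball n \<subseteq> topspace (Euclidean_space n)"
  and unit_sphere_subset: "unit_sphere n \<subseteq> topspace (Euclidean_space n)"
  by (auto simp: unit_cball_iff unit_ball_iff unit_sphere_iff)

lemma continuous_map_Euclidean_space_componentwise:
  "continuous_map X (Euclidean_space n) f \<longleftrightarrow>
     f \<in> topspace X \<rightarrow> topspace (Euclidean_space n) \<and> (\<forall>i. continuous_map X euclideanreal (\<lambda>x. f x i))"
  unfolding Euclidean_space_def continuous_map_in_subtopology continuous_map_componentwise_UNIV
  by auto

lemma continuous_map_Euclidean_space_proj: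
  "continuous_map X (Euclidean_space n) f \<Longrightarrow> continuous_map X euclideanreal (\<lambda>x. f x i)"
  by (simp add: continuous_map_Euclidean_space_componentwise)

lemma continuous_map_enorm:
  assumes "continuous_map X (Euclidean_space n) f"
  shows "continuous_map X euclideanreal (\<lambda>x. enorm m (f x))"
  unfolding enorm_def
  by (intro continuous_intros continuous_map_Euclidean_space_proj[OF assms]) auto

lemma continuous_map_scale:
  assumes "continuous_map X (Euclidean_space n) f" "continuous_map X euclideanreal s"
  shows "continuous_map X (Euclidean_space n) (\<lambda>x i. s x * f x i)"
  unfolding continuous_map_Euclidean_space_componentwise
proof (intro conjI allI)
  show "(\<lambda>x i. s x * f x i) \<in> topspace X \<rightarrow> topspace (Euclidean_space n)"
    using continuous_map_funspace[OF assms(1)] by (auto intro!: scale_in_Euclidean_space)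
  show "continuous_map X euclideanreal (\<lambda>x. s x * f x i)" for i
    by (intro continuous_intros continuous_map_Euclidean_space_proj[OF assms(1)] assms(2))
qed

lemma openin_unit_ball: "openin (Euclidean_space n) (unit_ball n)"
proof -
  have "openin (Euclidean_space n) {x \<in> topspace (Euclidean_space n). enorm n x \<in> {..<1}}"
    by (rule openin_continuous_map_preimage[OF continuous_map_enorm[OF continuous_map_id[unfolded id_def]]]) simp
  moreover have "{x \<in> topspace (Euclidean_space n). enorm n x \<in> {..<1}} = unit_ball n"
    by (auto simp: unit_ball_iff)
  ultimately show ?thesis by simp
qed

lemma closedin_unit_cball: "closedin (Euclidean_space n) (unit_cball n)"
proof -
  have "closedin (Euclidean_space n) {x \<in> topspace (Euclidean_space n). enorm n x \<in> {..1}}"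
    by (rule closedin_continuous_map_preimage[OF continuous_map_enorm[OF continuous_map_id[unfolded id_def]]]) simp
  moreover have "{x \<in> topspace (Euclidean_space n). enorm n x \<in> {..1}} = unit_cball n"
    by (auto simp: unit_cball_iff)
  ultimately show ?thesis by simp
qed

lemma closedin_unit_sphere: "closedin (Euclidean_space n) (unit_sphere n)"
proof -
  have "closedin (Euclidean_space n) {x \<in> topspace (Euclidean_space n). enorm n x \<in> {1}}"
    by (rule closedin_continuous_map_preimage[OF continuous_map_enorm[OF continuous_map_id[unfolded id_def]]]) simp
  moreover have "{x \<in> topspace (Euclidean_space n). enorm n x \<in> {1}} = unit_sphere n"
    by (auto simp: unit_sphere_iff)
  ultimately show ?thesis by simp
qed

text \<open>The ball is closed in a product of compact sets, intervals in the first \<open>n\<close>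
  coordinates and a point in all others, so Tychonoff's theorem applies.\<close>

lemma compactin_unit_cball: "compactin (Euclidean_space n) (unit_cball n)"
proof -
  let ?P = "\<Pi>\<^sub>E i\<in>UNIV. if i < n then {- 1..1} else {0::real}"
  have "compactin (powertop_real UNIV) ?P"
    unfolding compactin_PiE by auto
  moreover have "closedin (powertop_real UNIV) (unit_cball n)"
    using closedin_unit_cball[of n] closedin_Euclidean_space[of n]
    by (metis Euclidean_space_def closedin_trans_full topspace_Euclidean_space)
  moreover have "unit_cball n \<subseteq> ?P"
  proof
    fix x assume x: "x \<in> unit_cball n"
    have "x i \<in> {- 1..1}" if "i < n" for i
    proof -
      have "(x i)\<^sup>2 \<le> (\<Sum>i<n. (x i)\<^sup>2)"
        using that by (intro member_le_sum) auto
      also have "\<dots> \<le> 1"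
        using x by (simp add: unit_cball_def)
      finally show ?thesis
        using abs_square_le_1[of "x i"] by (simp add: abs_le_iff)
    qed
    moreover have "x i = 0" if "\<not> i < n" for i
      using x that by (auto simp: unit_cball_def topspace_Euclidean_space)
    ultimately show "x \<in> ?P"
      by auto
  qed
  ultimately have "compactin (powertop_real UNIV) (unit_cball n)"
    using closed_compactin by blast
  then show ?thesis
    using unit_cball_subset[of n] by (simp add: Euclidean_space_def compactin_subtopology topspace_Euclidean_space)
qed

lemma contractible_unit_ball: "contractible_space (subtopology (Euclidean_space n) (unit_ball n))"
proof -
  let ?B = "subtopology (Euclidean_space n) (unit_ball n)"
  have id: "continuous_map ?B (Euclidean_space n) (\<lambda>x. x)"
    by (simp add: continuous_map_from_subtopology)
  have "homotopic_with (\<lambda>x. True) ?B ?B (\<lambda>x. x) (\<lambda>x. (\<lambda>_. 0))"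
    unfolding homotopic_with_def
  proof (intro exI conjI ballI allI)
    let ?h = "\<lambda>z::real \<times> (nat \<Rightarrow> real). \<lambda>i. (1 - fst z) * snd z i"
    have "continuous_map (prod_topology (top_of_set {0..1}) ?B) (Euclidean_space n) ?h"
    proof (rule continuous_map_scale)
      show "continuous_map (prod_topology (top_of_set {0..1}) ?B) (Euclidean_space n) snd"
        using continuous_map_compose[OF continuous_map_snd id] by (simp add: o_def)
      have "continuous_map (prod_topology (top_of_set {0..1}) ?B) euclideanreal fst"
        using continuous_map_into_fulltopology[OF continuous_map_fst] .
      then show "continuous_map (prod_topology (top_of_set {0..1}) ?B) euclideanreal (\<lambda>z. 1 - fst z)"
        by (intro continuous_intros)
    qed
    moreover have "?h z \<in> unit_ball n" if "z \<in> {0..1} \<times> unit_ball n" for z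
    proof -
      have "(1 - fst z) * enorm n (snd z) \<le> 1 * enorm n (snd z)"
        using that by (intro mult_right_mono) auto
      then show ?thesis
        using that by (auto simp: unit_ball_iff enorm_scale scale_in_Euclidean_space)
    qed
    ultimately show "continuous_map (prod_topology (top_of_set {0..1}) ?B) ?B ?h"
      by (auto simp: continuous_map_in_subtopology unit_ball_iff)
  qed auto
  then show ?thesis
    unfolding contractible_space_def by (auto simp: id_def)
qed

lemma nsphere_eq_unit_sphere: "nsphere m = subtopology (Euclidean_space (Suc m)) (unit_sphere (Suc m))"
proof -
  have "{x. (\<Sum>i\<le>m. (x i)\<^sup>2) = 1} \<inter> topspace (Euclidean_space (Suc m)) = unit_sphere (Suc m)"
    by (auto simp: unit_sphere_def lessThan_Suc_atMost)
  then show ?thesis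
    unfolding nsphere_def by (metis Int_commute subtopology_restrict)
qed

lemma nsphere_homotopy_equivalent_punctured_ball:
  "nsphere m homotopy_equivalent_space
     subtopology (Euclidean_space (Suc m)) (unit_ball (Suc m) - {\<lambda>_. 0})"
proof -
  let ?n = "Suc m"
  let ?B = "subtopology (Euclidean_space ?n) (unit_ball ?n - {\<lambda>_. 0})"
  let ?S = "subtopology (Euclidean_space ?n) (unit_sphere ?n)"
  \<comment> \<open>The unit sphere is not contained in the open ball, so it enters at radius one
    half; \<open>?g\<close> is the radial projection back.\<close>
  let ?f = "\<lambda>x i. (1/2) * x i :: real"
  let ?g = "\<lambda>x i. (1 / enorm ?n x) * x i"
  have idB: "continuous_map ?B (Euclidean_space ?n) (\<lambda>x. x)" and idS: "continuous_map ?S (Euclidean_space ?n) (\<lambda>x. x)"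
    by (simp_all add: continuous_map_from_subtopology)
  have tB: "topspace ?B = unit_ball ?n - {\<lambda>_. 0}" and tS: "topspace ?S = unit_sphere ?n"
    using unit_ball_subset unit_sphere_subset by (auto simp: topspace_subtopology)
  have nz: "enorm ?n x \<noteq> 0" if "x \<in> topspace ?B" for x
    using that unfolding tB by (auto simp: unit_ball_iff enorm_eq_0)
  have f: "continuous_map ?S ?B ?f"
    unfolding continuous_map_in_subtopology
  proof
    show "continuous_map ?S (Euclidean_space ?n) ?f"
      by (intro continuous_map_scale idS) auto
    show "?f \<in> topspace ?S \<rightarrow> unit_ball ?n - {\<lambda>_. 0}"
      unfolding tS
    proof (intro Pi_I DiffI)
      fix x assume x: "x \<in> unit_sphere ?n"
      then have e: "enorm ?n (?f x) = 1/2"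
        using enorm_scale[of ?n "1/2" x] by (simp add: unit_sphere_iff)
      then show "?f x \<in> unit_ball ?n"
        using x scale_in_Euclidean_space[of x ?n "1/2"] by (simp add: unit_ball_iff unit_sphere_iff)
      show "?f x \<notin> {\<lambda>_. 0}"
        using e enorm_zero[of ?n] by force
    qed
  qed
  have g: "continuous_map ?B ?S ?g"
    unfolding continuous_map_in_subtopology
  proof
    show "continuous_map ?B (Euclidean_space ?n) ?g"
      by (intro continuous_map_scale idB continuous_intros continuous_map_enorm[OF idB] nz) auto
    show "?g \<in> topspace ?B \<rightarrow> unit_sphere ?n"
    proof
      fix x assume x: "x \<in> topspace ?B"
      show "?g x \<in> unit_sphere ?n"
        using nz[OF x] x scale_in_Euclidean_space[of x ?n "1 / enorm ?n x"] enorm_scale[of ?n "1 / enorm ?n x" x] enorm_nonneg[of ?n x]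
        unfolding tB by (auto simp: unit_sphere_iff unit_ball_iff)
    qed
  qed
  have gf: "homotopic_with (\<lambda>x. True) ?S ?S (?g \<circ> ?f) id"
  proof (rule homotopic_with_equal)
    show "continuous_map ?S ?S (?g \<circ> ?f)" using f g by (rule continuous_map_compose)
    fix x assume "x \<in> topspace ?S"
    then have "enorm ?n (?f x) = 1/2"
      unfolding tS using enorm_scale[of ?n "1/2" x] by (simp add: unit_sphere_iff)
    then show "(?g \<circ> ?f) x = id x"
      unfolding o_def by simp
  qed auto
  have "homotopic_with (\<lambda>x. True) ?B ?B (?f \<circ> ?g) (\<lambda>x. x)"
    unfolding homotopic_with_def
  proof (intro exI conjI ballI allI)
    let ?P = "prod_topology (top_of_set {0..1::real}) ?B"
    \<comment> \<open>Interpolates the radial factor from that of \<open>?f \<circ> ?g\<close> at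
      time 0 to 1 at time 1; the norm then runs linearly from one half to that of the point, staying
      positive and below 1.\<close>
    let ?s = "\<lambda>z::real \<times> (nat \<Rightarrow> real). (1 - fst z) * (1 / 2 * (1 / enorm ?n (snd z))) + fst z"
    let ?h = "\<lambda>z i. ?s z * snd z i"
    have fst: "continuous_map ?P euclideanreal fst"
      using continuous_map_into_fulltopology[OF continuous_map_fst] .
    have snd: "continuous_map ?P (Euclidean_space ?n) snd"
      using continuous_map_compose[OF continuous_map_snd idB] by (simp add: o_def)
    have "continuous_map ?P (Euclidean_space ?n) ?h"
      by (intro continuous_map_scale snd continuous_intros continuous_map_enorm[OF snd] fst)
        (use nz in auto)
    moreover have "?h z \<in> unit_ball ?n - {\<lambda>_. 0}" if z: "z \<in> {0..1} \<times> topspace ?B" for z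
    proof -
      obtain t x where zt: "z = (t, x)" by force
      have e: "enorm ?n x \<noteq> 0" "enorm ?n x < 1" "0 \<le> t" "t \<le> 1" "x \<in> topspace (Euclidean_space ?n)"
        using z nz[of x] by (auto simp: zt tB unit_ball_iff)
      then have pos: "0 < enorm ?n x" using enorm_nonneg[of ?n x] by linarith
      have sp: "0 < ?s z"
      proof (cases "t = 0")
        case False
        then show ?thesis using e pos unfolding zt by (simp add: add_nonneg_pos)
      qed (use pos zt in auto)
      have hz: "enorm ?n (?h z) = ?s z * enorm ?n x"
        unfolding enorm_scale using sp by (simp add: zt)
      also have "\<dots> = (1 - t) * (1/2) + t * enorm ?n x"
        using e by (simp add: zt field_simps)
      also have "\<dots> < 1"
      proof (cases "t = 0")
        case False
        then have "t * enorm ?n x < t * 1" using e by (intro mult_strict_left_mono) auto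
        then show ?thesis using e by argo
      qed auto
      finally have "?h z \<in> unit_ball ?n"
        using e scale_in_Euclidean_space[of x ?n "?s z"] by (simp add: unit_ball_iff zt)
      moreover have "?h z \<noteq> (\<lambda>_. 0)"
        using hz sp pos enorm_zero[of ?n] by force
      ultimately show ?thesis by simp
    qed
    ultimately show "continuous_map ?P ?B ?h"
      by (auto simp: continuous_map_in_subtopology)
  qed (auto simp: o_def)
  then have fg: "homotopic_with (\<lambda>x. True) ?B ?B (?f \<circ> ?g) id"
    by (simp add: id_def)
  show ?thesis
    unfolding nsphere_eq_unit_sphere homotopy_equivalent_space_def using f g gf fg by blast
qed

text \<open>The ball is contractible, so the relative group in degree \<open>p\<close> is the
  reduced homology of the punctured ball in degree \<open>p - 1\<close>. The punctured ball is a
  sphere up to homotopy, which leaves one infinite cyclic group in degree \<open>n\<close>. For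
  \<open>n = 0\<close> the punctured ball is empty, and the homology of a point is used
  instead.\<close>

lemma has_euler_ball_punctured:
  "has_euler (subtopology (Euclidean_space n) (unit_ball n)) (unit_ball n - {\<lambda>_. 0}) ((- 1) ^ n)"
proof (cases n)
  case 0
  have tE: "topspace (Euclidean_space 0) = {\<lambda>_. 0}"
    by (auto simp: topspace_Euclidean_space)
  then have top: "topspace (subtopology (Euclidean_space n) (unit_ball n)) = {\<lambda>_. 0}" and e: "unit_ball n - {\<lambda>_. 0} = {}"
    using unit_ball_subset[of 0] zero_in_unit_ball[of 0] 0 by (auto simp: topspace_subtopology)
  show ?thesis
    unfolding e using 0 homology_coefficients[OF top] homology_dimension_axiom[OF top]
    by (intro has_euler_concentrated) auto
next
  case (Suc m)
  let ?B = "subtopology (Euclidean_space n) (unit_ball n)"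
  let ?S = "unit_ball n - {\<lambda>_. 0}"
  have sub: "subtopology ?B ?S = subtopology (Euclidean_space (Suc m)) (unit_ball (Suc m) - {\<lambda>_. 0})"
    by (simp add: subtopology_subtopology Suc Int_absorb1)
  \<comment> \<open>Any point off the centre will do: it shows that the punctured ball is
    nonempty.\<close>
  define x where "x = (\<lambda>i. if i = (0::nat) then 1/2 else 0 :: real)"
  have "(\<Sum>i<Suc m. (x i)\<^sup>2) = (\<Sum>i<Suc m. if i = 0 then 1/4 else 0)"
    by (intro sum.cong) (auto simp: x_def power2_eq_square)
  moreover have "x \<noteq> (\<lambda>_. 0)"
    by (auto simp: x_def fun_eq_iff)
  ultimately have "x \<in> ?S"
    by (auto simp: unit_ball_def topspace_Euclidean_space Suc x_def)
  then have ne: "topspace ?B \<inter> ?S \<noteq> {}"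
    using unit_ball_subset[of n] by (auto simp: topspace_subtopology)
  have iso: "relative_homology_group (int p) ?B ?S \<cong> reduced_homology_group (int p - 1) (nsphere m)" for p
    using isomorphic_group_relative_homology_of_contractible[OF contractible_unit_ball ne, of "int p"]
      homotopy_equivalent_space_imp_isomorphic_reduced_homology_groups[OF nsphere_homotopy_equivalent_punctured_ball[of m]]
    unfolding sub by (meson group.iso_sym group_reduced_homology_group iso_trans)
  show ?thesis
  proof (rule has_euler_concentrated)
    show "relative_homology_group (int n) ?B ?S \<cong> integer_group"
      using iso[of n] reduced_homology_group_nsphere(1)[of m] Suc by (auto intro: iso_trans)
    show "trivial_group (relative_homology_group (int p) ?B ?S)" if "p \<noteq> n" for p
      using iso[of p] reduced_homology_group_nsphere(2)[of "int p - 1" m] Suc that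
        isomorphic_group_triviality[OF iso[of p]] by auto
  qed
qed

subsection \<open>Attaching a cell\<close>

text \<open>A continuous map from a compact space to a Hausdorff space is closed. Injectivity on the
  whole closed ball is what regularity provides.\<close>

lemma closed_cell_embedding:
  assumes "Hausdorff_space X"
    and "continuous_map (subtopology (Euclidean_space n) (unit_cball n)) X \<phi>" "inj_on \<phi> (unit_cball n)"
  shows "embedding_map (subtopology (Euclidean_space n) (unit_cball n)) X \<phi>"
    and "closedin X (\<phi> ` unit_cball n)"
proof -
  let ?D = "subtopology (Euclidean_space n) (unit_cball n)"
  have top: "topspace ?D = unit_cball n"
    using unit_cball_subset[of n] by (auto simp: topspace_subtopology)
  have "compact_space ?D"
    using compactin_unit_cball compact_space_subtopology by blast
  then have cl: "closed_map ?D X \<phi>"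
    using assms by (intro T1_Spaces.continuous_imp_closed_map)
  then show "embedding_map ?D X \<phi>"
    using assms top by (intro injective_closed_imp_embedding_map) auto
  show "closedin X (\<phi> ` unit_cball n)"
    using cl top by (metis closed_map_def closedin_topspace)
qed

text \<open>Points of the closed cell are pushed radially away from the missing centre onto the
  boundary, while all other points stay put. The inverse of the embedded closed ball makes the push
  continuous on the cell.\<close>

lemma punctured_cell_homotopy_equivalent:
  assumes X: "Hausdorff_space X"
    and cont: "continuous_map (subtopology (Euclidean_space n) (unit_cball n)) X \<phi>"
    and inj: "inj_on \<phi> (unit_cball n)"
    and op: "openin X (\<phi> ` unit_ball n)"
  shows "subtopology X (topspace X - {\<phi> (\<lambda>_. 0)}) homotopy_equivalent_space
         subtopology X (topspace X - \<phi> ` unit_ball n)"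
proof -
  define e c K where "e = \<phi> ` unit_ball n" and "c = \<phi> (\<lambda>_. 0)" and "K = \<phi> ` unit_cball n"
  let ?D = "subtopology (Euclidean_space n) (unit_cball n)"
  define Y where "Y = subtopology X (topspace X - {c})"
  have topD: "topspace ?D = unit_cball n"
    using unit_cball_subset[of n] by (auto simp: topspace_subtopology)
  have clK: "closedin X K"
    unfolding K_def by (rule closed_cell_embedding(2)[OF X cont inj])
  have KX: "K \<subseteq> topspace X" using clK closedin_subset by blast
  have "homeomorphic_map ?D (subtopology X K) \<phi>"
    using closed_cell_embedding(1)[OF X cont inj] unfolding embedding_map_def topD K_def .
  then obtain \<psi> where \<psi>: "homeomorphic_maps ?D (subtopology X K) \<phi> \<psi>"
    using homeomorphic_map_maps by blast
  have \<psi>c: "continuous_map (subtopology X K) ?D \<psi>"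
    and \<psi>\<phi>: "\<And>z. z \<in> unit_cball n \<Longrightarrow> \<psi> (\<phi> z) = z" and \<phi>\<psi>: "\<And>y. y \<in> K \<Longrightarrow> \<phi> (\<psi> y) = y"
    using \<psi> KX topD by (auto simp: homeomorphic_maps_def)
  have \<psi>in: "\<psi> y \<in> unit_cball n" if "y \<in> K" for y
    using that \<psi>\<phi> by (auto simp: K_def)
  have \<psi>E: "continuous_map (subtopology X K) (Euclidean_space n) \<psi>"
    using \<psi>c continuous_map_into_fulltopology by blast
  have zero: "(\<lambda>_. 0) \<in> unit_cball n"
    by (simp add: unit_cball_iff)
  have nz: "enorm n (\<psi> y) \<noteq> 0" if "y \<in> K" "y \<noteq> c" for y
    using \<psi>in[OF that(1)] \<phi>\<psi>[OF that(1)] that(2) by (auto simp: unit_cball_iff enorm_eq_0 c_def)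
  have sph: "enorm n (\<psi> y) = 1" if "y \<in> K" "y \<notin> e" for y
    using \<psi>in[OF that(1)] \<phi>\<psi>[OF that(1)] that(2)
    by (force simp: e_def unit_cball_iff unit_ball_iff image_iff)
  have eX: "e \<subseteq> topspace X" and ce: "c \<in> e" and eK: "e \<subseteq> K"
    using openin_subset[OF op] by (auto simp: e_def c_def K_def unit_cball_eq_Un)
  have topY: "topspace Y = topspace X - {c}"
    by (auto simp: Y_def)
  \<comment> \<open>The radial factor is 1 at time 0 and the reciprocal norm at time 1; on the
    boundary sphere it is constantly 1, so boundary points do not move.\<close>
  let ?s = "\<lambda>t z. (1 - t) + t * (1 / enorm n z)"
  let ?hK = "\<lambda>p. \<phi> (\<lambda>i. ?s (fst p) (\<psi> (snd p)) * \<psi> (snd p) i)"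
  let ?h = "\<lambda>p. if snd p \<in> K then ?hK p else snd p"
  let ?P = "prod_topology (top_of_set {0..1::real}) Y"
  \<comment> \<open>Two closed pieces, indexed by truth values: the punctured closed cell, and the
    complement of the open cell, on which the homotopy is constant. They overlap only in the
    boundary of the cell.\<close>
  let ?T = "\<lambda>b. {0..1::real} \<times> (if b then K - {c} else topspace X - e)"
  let ?f = "\<lambda>b p. if b then ?hK p else snd p"
  have s1: "\<phi> (\<lambda>i. ?s t (\<psi> y) * \<psi> y i) = y" if "y \<in> K" "y \<notin> e" for t y
    using sph[OF that] \<phi>\<psi>[OF that(1)] by simp
  have scaled: "(\<lambda>i. ?s t (\<psi> y) * \<psi> y i) \<in> unit_cball n - {\<lambda>_. 0}"
    and scaled1: "t = 1 \<Longrightarrow> (\<lambda>i. ?s t (\<psi> y) * \<psi> y i) \<in> unit_sphere n"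
    if "0 \<le> t" "t \<le> 1" "y \<in> K" "y \<noteq> c" for t y
  proof -
    have pos: "0 < enorm n (\<psi> y)" "enorm n (\<psi> y) \<le> 1" "\<psi> y \<in> topspace (Euclidean_space n)"
      using nz[OF that(3,4)] enorm_nonneg[of n "\<psi> y"] \<psi>in[OF that(3)] by (auto simp: unit_cball_iff less_le)
    have sp: "0 \<le> ?s t (\<psi> y)"
      using that(1,2) pos by simp
    have hz: "enorm n (\<lambda>i. ?s t (\<psi> y) * \<psi> y i) = (1 - t) * enorm n (\<psi> y) + t"
      unfolding enorm_scale using sp pos by (simp add: field_simps)
    have "(1 - t) * enorm n (\<psi> y) \<le> (1 - t) * 1"
      using that(2) pos by (intro mult_left_mono) auto
    then have le: "(1 - t) * enorm n (\<psi> y) + t \<le> 1" by simp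
    have gt: "0 < (1 - t) * enorm n (\<psi> y) + t"
    proof (cases "t = 1")
      case False
      then have "0 < (1 - t) * enorm n (\<psi> y)" using that(2) pos by simp
      then show ?thesis using that(1) by linarith
    qed simp
    have E: "(\<lambda>i. ?s t (\<psi> y) * \<psi> y i) \<in> topspace (Euclidean_space n)"
      using pos(3) by (rule scale_in_Euclidean_space)
    have "(\<lambda>i. ?s t (\<psi> y) * \<psi> y i) \<noteq> (\<lambda>_. 0)"
    proof
      assume "(\<lambda>i. ?s t (\<psi> y) * \<psi> y i) = (\<lambda>_. 0)"
      then have "enorm n (\<lambda>i. ?s t (\<psi> y) * \<psi> y i) = 0" by (simp only: enorm_zero)
      then show False using hz gt by simp
    qed
    then show "(\<lambda>i. ?s t (\<psi> y) * \<psi> y i) \<in> unit_cball n - {\<lambda>_. 0}"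
      using hz le E by (simp add: unit_cball_iff)
    show "(\<lambda>i. ?s t (\<psi> y) * \<psi> y i) \<in> unit_sphere n" if "t = 1"
      using hz E that by (simp add: unit_sphere_iff)
  qed
  have \<phi>scaled: "\<phi> (\<lambda>i. ?s t (\<psi> y) * \<psi> y i) \<in> topspace X - {c}" if "0 \<le> t" "t \<le> 1" "y \<in> K" "y \<noteq> c" for t y
    using scaled[OF that] KX inj_onD[OF inj _ _ zero] by (auto simp: K_def c_def)
  have hcont: "continuous_map ?P Y ?h"
  proof (rule pasting_lemma_closed[where I = UNIV and T = ?T and f = ?f])
    show "closedin ?P (?T b)" for b
    proof -
      have "closedin Y (topspace X - e)"
        unfolding Y_def using op ce eX by (intro closedin_subset_topspace) (auto simp: e_def)
      moreover have "closedin Y (K - {c})"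
        unfolding Y_def closedin_subtopology using clK KX by (intro exI[of _ K]) auto
      ultimately show ?thesis
        by (cases b) (simp_all add: closedin_prod_Times_iff)
    qed
    show "continuous_map (subtopology ?P (?T b)) Y (?f b)" for b
    proof (cases b)
      case False
      then show ?thesis
        by (simp add: continuous_map_from_subtopology continuous_map_snd)
    next
      case True
      let ?Q = "subtopology ?P ({0..1} \<times> (K - {c}))"
      have topQ: "topspace ?Q = {0..1} \<times> (K - {c})"
        using KX topY by (auto simp: topspace_subtopology)
      have "continuous_map ?Q Y snd"
        by (simp add: continuous_map_from_subtopology continuous_map_snd)
      then have sndK: "continuous_map ?Q (subtopology X K) snd"
        unfolding Y_def using topQ by (auto simp: continuous_map_in_subtopology)
      have fst: "continuous_map ?Q euclideanreal fst"
        using continuous_map_into_fulltopology[OF continuous_map_fst] continuous_map_from_subtopology by blast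
      have psnd: "continuous_map ?Q (Euclidean_space n) (\<lambda>p. \<psi> (snd p))"
        using continuous_map_compose[OF sndK \<psi>E] by (simp add: o_def)
      have "continuous_map ?Q (Euclidean_space n) (\<lambda>p i. ?s (fst p) (\<psi> (snd p)) * \<psi> (snd p) i)"
        by (intro continuous_map_scale psnd continuous_intros fst continuous_map_enorm[OF psnd])
          (use nz topQ in auto)
      moreover have "(\<lambda>i. ?s (fst p) (\<psi> (snd p)) * \<psi> (snd p) i) \<in> unit_cball n"
        if "p \<in> {0..1} \<times> (K - {c})" for p
        using scaled[of "fst p" "snd p"] that by (simp add: mem_Times_iff)
      ultimately have "continuous_map ?Q ?D (\<lambda>p i. ?s (fst p) (\<psi> (snd p)) * \<psi> (snd p) i)"
        unfolding continuous_map_in_subtopology topQ by (intro conjI Pi_I)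
      then have "continuous_map ?Q X ?hK"
        using continuous_map_compose[OF _ cont, of ?Q] by (simp add: o_def)
      moreover have "?hK p \<in> topspace X - {c}" if "p \<in> {0..1} \<times> (K - {c})" for p
        using \<phi>scaled[of "fst p" "snd p"] that by (simp add: mem_Times_iff)
      ultimately have "continuous_map ?Q (subtopology X (topspace X - {c})) ?hK"
        unfolding continuous_map_in_subtopology topQ by (intro conjI Pi_I)
      then have "continuous_map ?Q Y ?hK"
        by (simp only: Y_def)
      then show ?thesis using True by simp
    qed
    show "?f i p = ?f j p" if "p \<in> topspace ?P \<inter> ?T i \<inter> ?T j" for i j p
      using that s1 by (cases i; cases j) (auto split: if_splits)
    show "\<exists>j. j \<in> UNIV \<and> p \<in> ?T j \<and> ?h p = ?f j p" if "p \<in> topspace ?P" for p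
      using that eK by (intro exI[of _ "snd p \<in> K"]) (auto simp: topY)
  qed auto
  have h0: "?h (0, y) = y" if "y \<in> topspace Y" for y
    using that \<phi>\<psi> by auto
  have h1: "?h (1, y) \<in> topspace X - e" if "y \<in> topspace Y" for y
  proof (cases "y \<in> K")
    case True
    then have "(\<lambda>i. ?s 1 (\<psi> y) * \<psi> y i) \<in> unit_sphere n"
      using that by (intro scaled1) (auto simp: topY)
    then have "?h (1, y) \<in> \<phi> ` unit_sphere n"
      using True by simp
    moreover have "\<phi> ` unit_sphere n \<inter> e = {}"
      using inj unit_ball_sphere_disjoint[of n] unit_cball_eq_Un[of n] unfolding e_def
      by (metis Int_commute image_empty inj_on_image_Int sup_ge1 sup_ge2)
    ultimately show ?thesis
      using KX by (auto simp: K_def unit_cball_eq_Un)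
  next
    case False
    then show ?thesis using that eK topY by auto
  qed
  define r where "r = (\<lambda>y. ?h (1, y))"
  have r: "r y \<in> topspace X - e" if "y \<in> topspace Y" for y
    unfolding r_def using h1 that .
  have r_id: "r y = y" if "y \<notin> e" for y
    unfolding r_def using s1[of y 1] that by simp
  have "homotopic_with (\<lambda>x. True) Y Y (\<lambda>y. ?h (0, y)) r"
    unfolding homotopic_with_def r_def using hcont by (intro exI[of _ ?h]) auto
  then have "homotopic_with (\<lambda>x. True) Y Y id r"
    by (rule homotopic_with_eq) (use h0 in auto)
  then have hom: "homotopic_with (\<lambda>x. True) Y Y r id"
    by (rule homotopic_with_symD)
  have "retraction_maps Y (subtopology X (topspace X - e)) r id"
    unfolding retraction_maps_def
  proof (intro conjI ballI)
    have "continuous_map Y Y r"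
      using homotopic_with_imp_continuous_maps[OF hom] by (rule conjunct1)
    then have "continuous_map Y X r"
      using continuous_map_into_fulltopology[of Y X "topspace X - {c}"] by (simp only: Y_def)
    then show "continuous_map Y (subtopology X (topspace X - e)) r"
      unfolding continuous_map_in_subtopology using r by (intro conjI Pi_I)
    show "continuous_map (subtopology X (topspace X - e)) Y id"
      using ce unfolding Y_def by (auto simp: continuous_map_in_subtopology continuous_map_from_subtopology)
    fix y assume "y \<in> topspace (subtopology X (topspace X - e))"
    then show "r (id y) = y"
      using r_id by simp
  qed
  then show ?thesis
    using deformation_retract_imp_homotopy_equivalent_space[OF hom] by (simp add: Y_def e_def c_def)
qed

lemma has_euler_attach_cell:
  assumes X: "Hausdorff_space X"
    and cont: "continuous_map (subtopology (Euclidean_space n) (unit_cball n)) X \<phi>"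
    and inj: "inj_on \<phi> (unit_cball n)"
    and op: "openin X (\<phi> ` unit_ball n)"
    and A: "has_euler (subtopology X (topspace X - \<phi> ` unit_ball n)) {} a"
  shows "has_euler X {} (a + (- 1) ^ n)"
proof -
  define c e where "c = \<phi> (\<lambda>_. 0)" and "e = \<phi> ` unit_ball n"
  let ?B = "subtopology (Euclidean_space n) (unit_ball n)"
  let ?D = "subtopology (Euclidean_space n) (unit_cball n)"
  have hq: "subtopology X (topspace X - e) homotopy_equivalent_space subtopology X (topspace X - {c})"
    unfolding e_def c_def
    by (subst homotopy_equivalent_space_sym) (rule punctured_cell_homotopy_equivalent[OF X cont inj op])
  have A': "has_euler (subtopology X (topspace X - {c})) {} a"
    using A[folded e_def] homotopy_equivalent_space_imp_isomorphic_homology_groups[OF hq]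
    by (rule has_euler_iso)
  have topB: "topspace ?B = unit_ball n" and topD: "topspace ?D = unit_cball n"
    using unit_ball_subset unit_cball_subset by (auto simp: topspace_subtopology)
  have sub: "unit_ball n \<subseteq> unit_cball n"
    by (simp add: unit_cball_eq_Un)
  have eX: "e \<subseteq> topspace X" and ce: "c \<in> e"
    using openin_subset[OF op] by (auto simp: e_def c_def)
  have "embedding_map ?D X \<phi>"
    by (rule closed_cell_embedding(1)[OF X cont inj])
  then have hD: "homeomorphic_map ?D (subtopology X (\<phi> ` unit_cball n)) \<phi>"
    unfolding embedding_map_def topD .
  have eK: "e \<subseteq> \<phi> ` unit_cball n"
    using sub by (auto simp: e_def)
  have "\<phi> ` (topspace ?D \<inter> unit_ball n) = topspace (subtopology X (\<phi> ` unit_cball n)) \<inter> e"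
    unfolding topD using sub eX eK by (simp add: e_def topspace_subtopology Int_absorb1)
  with hD have "homeomorphic_map (subtopology ?D (unit_ball n))
      (subtopology (subtopology X (\<phi> ` unit_cball n)) e) \<phi>"
    by (rule homeomorphic_map_subtopologies)
  then have hB: "homeomorphic_map ?B (subtopology X e) \<phi>"
    using sub eK by (simp add: subtopology_subtopology Int_absorb1)
  have im: "\<phi> ` (unit_ball n - {\<lambda>_. 0}) = e - {c}"
    using inj_on_image_set_diff[OF inj, of "unit_ball n" "{\<lambda>_. 0}"] sub subsetD[OF sub zero_in_unit_ball]
    by (simp add: e_def c_def subset_iff)
  have iso1: "relative_homology_group p ?B (unit_ball n - {\<lambda>_. 0})
      \<cong> relative_homology_group p (subtopology X e) (e - {c})" for p
    using homeomorphic_map_relative_homology_iso[OF hB _ im, of p] topB by (auto simp: is_iso_def)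
  \<comment> \<open>The complement of the open cell is already closed and the complement of the
    centre already open, so the condition reduces to the centre lying in the cell.\<close>
  have excise: "X closure_of (topspace X - e) \<subseteq> X interior_of (topspace X - {c})"
  proof -
    have "X closure_of (topspace X - e) = topspace X - e"
      using op by (simp add: closure_of_closedin closedin_def e_def Diff_Diff_Int Int_absorb1 eX[unfolded e_def])
    moreover have "openin X (topspace X - {c})"
      using Hausdorff_imp_t1_space[OF X] eX ce by (auto simp: t1_space_closedin_singleton)
    ultimately show ?thesis
      using ce by (auto simp: interior_of_openin)
  qed
  have iso2: "relative_homology_group p (subtopology X e) (e - {c}) \<cong> relative_homology_group p X (topspace X - {c})" for p
  proof -
    have "topspace X - (topspace X - e) = e" "topspace X - {c} - (topspace X - e) = e - {c}"
      using eX by auto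
    then show ?thesis
      using homology_excision_axiom[OF excise, of "topspace X" p]
      by (auto simp: is_iso_def)
  qed
  have "has_euler X (topspace X - {c}) ((- 1) ^ n)"
    using has_euler_ball_punctured[of n]
    by (rule has_euler_iso) (rule iso_trans[OF iso1 iso2])
  with A' show ?thesis
    by (rule has_euler_pair)
qed

text \<open>A cell of greatest dimension lies in the boundary of no other cell, so after its removal
  the boundary hypothesis still holds. Closedness of the union is part of the induction claim, since
  for the remaining cells it says that the removed cell is open in the whole.\<close>

lemma has_euler_cells:
  fixes dm :: "'a set \<Rightarrow> nat"
  assumes M: "Hausdorff_space M" and fin: "finite D" and disj: "pairwise disjnt D"
    and cont: "\<And>e. e \<in> D \<Longrightarrow> continuous_map (subtopology (Euclidean_space (dm e)) (unit_cball (dm e))) M (\<phi> e)"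
    and inj: "\<And>e. e \<in> D \<Longrightarrow> inj_on (\<phi> e) (unit_cball (dm e))"
    and ball: "\<And>e. e \<in> D \<Longrightarrow> \<phi> e ` unit_ball (dm e) = e"
    and sphere: "\<And>e. e \<in> D \<Longrightarrow> \<phi> e ` unit_sphere (dm e) \<subseteq> \<Union>{f \<in> D. dm f < dm e}"
  shows "closedin M (\<Union>D) \<and> has_euler (subtopology M (\<Union>D)) {} (\<Sum>e\<in>D. (- 1) ^ dm e)"
  using fin disj cont inj ball sphere
proof (induction D rule: finite_psubset_induct)
  case (psubset D)
  have cball: "\<phi> e ` unit_cball (dm e) \<subseteq> \<Union>D" "e \<subseteq> \<phi> e ` unit_cball (dm e)" if "e \<in> D" for e
    using psubset.prems(4,5)[OF that] that by (auto simp: unit_cball_eq_Un image_Un)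
  have "closedin M (\<Union>e\<in>D. \<phi> e ` unit_cball (dm e))"
    using psubset.hyps psubset.prems(2,3) by (intro closedin_Union) (auto intro: closed_cell_embedding(2)[OF M])
  moreover have "(\<Union>e\<in>D. \<phi> e ` unit_cball (dm e)) = \<Union>D"
    using cball by fast
  ultimately have clD: "closedin M (\<Union>D)"
    by simp
  show ?case
  proof (cases "D = {}")
    case True
    then show ?thesis
      using clD by (auto intro!: has_euler_empty)
  next
    case False
    have "Max (dm ` D) \<in> dm ` D"
      using False psubset.hyps by (intro Max_in) auto
    then obtain e where e1: "e \<in> D" "dm e = Max (dm ` D)"
      by (metis imageE)
    have e: "e \<in> D" "\<And>f. f \<in> D \<Longrightarrow> dm f \<le> dm e"
      using e1 psubset.hyps by auto
    define D' where "D' = D - {e}"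
    have D': "D' \<subset> D" "D' \<subseteq> D"
      using e(1) by (auto simp: D'_def)
    have IH: "closedin M (\<Union>D') \<and> has_euler (subtopology M (\<Union>D')) {} (\<Sum>e\<in>D'. (- 1) ^ dm e)"
    proof (rule psubset.IH[OF D'(1)])
      show "pairwise disjnt D'"
        using psubset.prems(1) D'(2) by (rule pairwise_subset)
      show "\<phi> f ` unit_sphere (dm f) \<subseteq> \<Union>{g \<in> D'. dm g < dm f}" if "f \<in> D'" for f
      proof -
        have "{g \<in> D. dm g < dm f} = {g \<in> D'. dm g < dm f}"
          using e(2)[of f] that D' by (auto simp: D'_def)
        then show ?thesis using psubset.prems(5)[of f] that D' by auto
      qed
    qed (use psubset.prems(2-4) D'(2) in \<open>simp_all add: subset_iff\<close>)
    have De: "\<Union>D - e = \<Union>D'"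
    proof -
      have "f \<inter> e = {}" if "f \<in> D'" for f
        using psubset.prems(1) that e(1) by (auto simp: D'_def pairwise_def disjnt_def)
      then show ?thesis
        unfolding D'_def by fast
    qed
    let ?X = "subtopology M (\<Union>D)"
    have topX: "topspace ?X = \<Union>D"
      using clD closedin_subset by (auto simp: topspace_subtopology)
    have "closedin ?X (\<Union>D')"
      using IH D' by (intro closedin_subset_topspace) auto
    then have "openin ?X (topspace ?X - \<Union>D')"
      by (rule openin_diff[OF openin_topspace])
    moreover have "topspace ?X - \<Union>D' = \<phi> e ` unit_ball (dm e)"
      using psubset.prems(4)[OF e(1)] e(1) unfolding topX De[symmetric] by auto
    ultimately have op: "openin ?X (\<phi> e ` unit_ball (dm e))"
      by simp
    have "has_euler ?X {} ((\<Sum>e\<in>D'. (- 1) ^ dm e) + (- 1) ^ dm e)"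
    proof (rule has_euler_attach_cell[OF _ _ _ op])
      show "Hausdorff_space ?X"
        using M by (rule Hausdorff_space_subtopology)
      show "continuous_map (subtopology (Euclidean_space (dm e)) (unit_cball (dm e))) ?X (\<phi> e)"
        using psubset.prems(2)[OF e(1)] cball(1)[OF e(1)]
        by (auto simp: continuous_map_in_subtopology)
      show "inj_on (\<phi> e) (unit_cball (dm e))"
        using psubset.prems(3) e(1) .
      have "\<Union>D \<inter> \<Union>D' = \<Union>D'" using D' by auto
      then show "has_euler (subtopology ?X (topspace ?X - \<phi> e ` unit_ball (dm e))) {} (\<Sum>e\<in>D'. (- 1) ^ dm e)"
        using IH unfolding topX psubset.prems(4)[OF e(1)] De by (simp add: subtopology_subtopology)
    qed
    moreover have "(\<Sum>e\<in>D. (- 1) ^ dm e) = (\<Sum>e\<in>D'. (- 1) ^ dm e) + (- 1 :: int) ^ dm e"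
      unfolding D'_def using psubset.hyps e(1) by (simp add: sum.remove[of D e])
    ultimately show ?thesis
      using clD by simp
  qed
qed

subsection \<open>Invariance of domain in surfaces\<close>

lemma topspace_unit_ball: "topspace (subtopology (Euclidean_space n) (unit_ball n)) = unit_ball n"
  and topspace_unit_cball: "topspace (subtopology (Euclidean_space n) (unit_cball n)) = unit_cball n"
  by (auto simp: topspace_subtopology unit_ball_iff unit_cball_iff)

text \<open>\<open>Euclidean_space n\<close> is literally a subset of
  \<open>Euclidean_space m\<close>, so invariance of domain would make the image open in the larger
  space, although it has no thickness in coordinate \<open>n\<close>.\<close>

lemma not_injective_to_lower_dimension:
  assumes "n < m" and W: "openin (Euclidean_space m) W" "W \<noteq> {}"
    and cont: "continuous_map (subtopology (Euclidean_space m) W) (Euclidean_space n) f" and inj: "inj_on f W"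
  shows False
proof -
  have WE: "W \<subseteq> topspace (Euclidean_space m)"
    using W(1) openin_subset by blast
  have fim: "f x \<in> topspace (Euclidean_space n)" if "x \<in> W" for x
    using continuous_map_funspace[OF cont] WE that by (auto simp: topspace_subtopology)
  have "continuous_map (subtopology (Euclidean_space m) W) (Euclidean_space m) f"
    using cont \<open>n < m\<close> unfolding continuous_map_Euclidean_space_componentwise
    by (force simp: topspace_Euclidean_space Pi_iff)
  then have op: "openin (Euclidean_space m) (f ` W)"
    using invariance_of_domain_Euclidean_space W(1) inj by blast
  obtain x where x: "x \<in> W" using W(2) by blast
  \<comment> \<open>The line through \<open>f x\<close> in the direction of coordinate
    \<open>n\<close> meets the image at parameter 0 only, so a single real number would form an open
    set.\<close>
  define g where "g = (\<lambda>t::real. (f x)(n := t))"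
  have "continuous_map euclideanreal euclideanreal (\<lambda>t. g t i)" for i
    by (cases "i = n") (auto simp: g_def)
  moreover have "g t \<in> topspace (Euclidean_space m)" for t
    using fim[OF x] \<open>n < m\<close> by (auto simp: g_def topspace_Euclidean_space)
  ultimately have "continuous_map euclideanreal (Euclidean_space m) g"
    unfolding continuous_map_Euclidean_space_componentwise by auto
  then have "openin euclideanreal {t \<in> topspace euclideanreal. g t \<in> f ` W}"
    using op openin_continuous_map_preimage by blast
  moreover have "g t \<in> f ` W \<longleftrightarrow> t = 0" for t
  proof
    assume "g t \<in> f ` W"
    then obtain w where "w \<in> W" "g t = f w" by (elim imageE)
    then have "g t \<in> topspace (Euclidean_space n)" using fim by simp
    then have "g t n = 0" by (simp add: topspace_Euclidean_space)
    then show "t = 0" by (simp add: g_def)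
  next
    assume "t = 0"
    then have "g t = f x"
      using fim[OF x] by (auto simp: g_def topspace_Euclidean_space fun_eq_iff)
    then show "g t \<in> f ` W" using x by blast
  qed
  ultimately have "open {0::real}"
    by simp
  then show False
    using not_open_singleton by blast
qed

text \<open>Makes the dimension of a cell well defined: the homeomorphism type used in
  \<open>cells\<close> agrees with the dimension of any characteristic map.\<close>

lemma unit_ball_dimension_unique:
  assumes "subtopology (Euclidean_space m) (unit_ball m) homeomorphic_space X"
    and "subtopology (Euclidean_space n) (unit_ball n) homeomorphic_space X"
  shows "m = n"
proof -
  have less: False if "n < m" and h: "subtopology (Euclidean_space m) (unit_ball m) homeomorphic_space
      subtopology (Euclidean_space n) (unit_ball n)" for m n
  proof -
    obtain f where f: "homeomorphic_map (subtopology (Euclidean_space m) (unit_ball m))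
        (subtopology (Euclidean_space n) (unit_ball n)) f"
      using h homeomorphic_space by blast
    have "continuous_map (subtopology (Euclidean_space m) (unit_ball m)) (Euclidean_space n) f"
      using f homeomorphic_imp_continuous_map continuous_map_into_fulltopology by blast
    moreover have "inj_on f (unit_ball m)"
      using homeomorphic_imp_injective_map[OF f] by (simp only: topspace_unit_ball)
    moreover have "unit_ball m \<noteq> {}"
      using zero_in_unit_ball by blast
    ultimately show False
      using not_injective_to_lower_dimension[OF \<open>n < m\<close> openin_unit_ball] by blast
  qed
  have "subtopology (Euclidean_space m) (unit_ball m) homeomorphic_space
      subtopology (Euclidean_space n) (unit_ball n)"
    using assms homeomorphic_space_sym homeomorphic_space_trans by blast
  then show ?thesis
    using less[of n m] less[of m n] homeomorphic_space_sym nat_neq_iff by blast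
qed

lemma surface_chart:
  assumes "closed_surface M" "x \<in> topspace M"
  obtains U h where "openin M U" "x \<in> U" "homeomorphic_map (subtopology M U) (Euclidean_space 2) h"
  using assms unfolding closed_surface_def homeomorphic_space by metis

text \<open>Reads a map into the surface through a chart, so that Euclidean invariance of domain
  becomes applicable.\<close>

lemma chart_restrict:
  assumes h: "homeomorphic_map (subtopology M U) (Euclidean_space 2) h" and U: "openin M U"
    and W: "openin (Euclidean_space n) W"
    and cont: "continuous_map (subtopology (Euclidean_space n) W) M f" and inj: "inj_on f W"
  defines "W' \<equiv> {w \<in> W. f w \<in> U}"
  shows "openin (Euclidean_space n) W'"
    and "continuous_map (subtopology (Euclidean_space n) W') (Euclidean_space 2) (\<lambda>w. h (f w))"
    and "inj_on (\<lambda>w. h (f w)) W'"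
proof -
  have top: "topspace (subtopology (Euclidean_space n) W) = W"
    using openin_subset[OF W] by (auto simp: topspace_subtopology)
  have UM: "U \<subseteq> topspace M" using U openin_subset by blast
  have "openin (subtopology (Euclidean_space n) W) W'"
    using openin_continuous_map_preimage[OF cont U] by (simp only: W'_def top)
  then show "openin (Euclidean_space n) W'"
    using W openin_trans_full by blast
  have sub: "W' \<subseteq> W" by (auto simp: W'_def)
  have "continuous_map (subtopology (Euclidean_space n) W') M f"
    using continuous_map_from_subtopology_mono[OF cont sub] .
  then have "continuous_map (subtopology (Euclidean_space n) W') (subtopology M U) f"
    by (auto simp: continuous_map_in_subtopology W'_def)
  from continuous_map_compose[OF this homeomorphic_imp_continuous_map[OF h]]
  show "continuous_map (subtopology (Euclidean_space n) W') (Euclidean_space 2) (\<lambda>w. h (f w))"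
    by (simp add: o_def)
  show "inj_on (\<lambda>w. h (f w)) W'"
  proof (rule inj_onI)
    fix v w assume v: "v \<in> W'" and w: "w \<in> W'" and eq: "h (f v) = h (f w)"
    have "f v \<in> topspace (subtopology M U)" "f w \<in> topspace (subtopology M U)"
      using v w UM by (auto simp: W'_def)
    then have "f v = f w"
      using homeomorphic_imp_injective_map[OF h] eq by (simp add: inj_on_def)
    then show "v = w"
      using inj v w by (auto simp: W'_def dest: inj_onD)
  qed
qed

lemma surface_dimension_le_2:
  assumes M: "closed_surface M" and W: "openin (Euclidean_space n) W" "W \<noteq> {}"
    and cont: "continuous_map (subtopology (Euclidean_space n) W) M f" and inj: "inj_on f W"
  shows "n \<le> 2"
proof (rule ccontr)
  assume "\<not> n \<le> 2"
  then have n: "2 < n" by simp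
  obtain w where w: "w \<in> W" using W(2) by blast
  have "f w \<in> topspace M"
    using continuous_map_funspace[OF cont] openin_subset[OF W(1)] w by (auto simp: topspace_subtopology)
  then obtain U h where U: "openin M U" "f w \<in> U" and h: "homeomorphic_map (subtopology M U) (Euclidean_space 2) h"
    using surface_chart[OF M] by metis
  show False
    using not_injective_to_lower_dimension[OF n chart_restrict(1)[OF h U(1) W(1) cont inj]
        _ chart_restrict(2,3)[OF h U(1) W(1) cont inj]] w U(2) by blast
qed

text \<open>Openness of the image is tested at each of its points, inside a chart around that
  point.\<close>

lemma surface_invariance_of_domain:
  assumes M: "closed_surface M" and W: "openin (Euclidean_space 2) W"
    and cont: "continuous_map (subtopology (Euclidean_space 2) W) M f" and inj: "inj_on f W"
  shows "openin M (f ` W)"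
proof (subst openin_subopen, intro ballI)
  fix y assume "y \<in> f ` W"
  then obtain w where w: "w \<in> W" "y = f w" by blast
  have "f w \<in> topspace M"
    using continuous_map_funspace[OF cont] openin_subset[OF W] w by (auto simp: topspace_subtopology)
  then obtain U h where U: "openin M U" "f w \<in> U" and h: "homeomorphic_map (subtopology M U) (Euclidean_space 2) h"
    using surface_chart[OF M] by metis
  define W' where "W' = {w \<in> W. f w \<in> U}"
  note W' = chart_restrict[OF h U(1) W cont inj, folded W'_def]
  have topU: "topspace (subtopology M U) = U"
    using openin_subset[OF U(1)] by (auto simp: topspace_subtopology)
  have "openin (Euclidean_space 2) ((\<lambda>w. h (f w)) ` W')"
    by (rule invariance_of_domain_Euclidean_space[OF W'])
  then have "openin (subtopology M U) {x \<in> topspace (subtopology M U). h x \<in> (\<lambda>w. h (f w)) ` W'}"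
    using homeomorphic_imp_continuous_map[OF h] openin_continuous_map_preimage by blast
  moreover have "{x \<in> topspace (subtopology M U). h x \<in> (\<lambda>w. h (f w)) ` W'} = f ` W'"
  proof -
    have "inj_on h U" using homeomorphic_imp_injective_map[OF h] by (simp only: topU)
    moreover have "f ` W' \<subseteq> U" by (auto simp: W'_def)
    ultimately show ?thesis
      unfolding topU by (fastforce dest: inj_onD)
  qed
  ultimately have "openin M (f ` W')"
    using U(1) openin_trans_full by metis
  then show "\<exists>T. openin M T \<and> y \<in> T \<and> T \<subseteq> f ` W"
    using w U(2) by (intro exI[of _ "f ` W'"]) (auto simp: W'_def)
qed

text \<open>A small round disc in a chart stays connected without its centre. This two-dimensional
  fact later prevents foreign edges from meeting at a vertex encircled by digons.\<close>

lemma punctured_neighbourhood_connected: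
  assumes M: "closed_surface M" and A: "openin M A" "x \<in> A"
  obtains B where "openin M B" "x \<in> B" "B \<subseteq> A" "connectedin M (B - {x})"
proof -
  have xM: "x \<in> topspace M" using A openin_subset by blast
  obtain U h where U: "openin M U" "x \<in> U" and h: "homeomorphic_map (subtopology M U) (Euclidean_space 2) h"
    using surface_chart[OF M xM] .
  \<comment> \<open>The chart is continued to the complex plane, a two-dimensional metric space in
    which punctured balls are known to be connected.\<close>
  obtain k :: "(nat \<Rightarrow> real) \<Rightarrow> complex" and k' where "homeomorphic_maps (Euclidean_space (DIM(complex))) euclidean k k'"
    using homeomorphic_maps_Euclidean_space_euclidean .
  then have "homeomorphic_map (Euclidean_space 2) (euclidean :: complex topology) k"
    using homeomorphic_maps_map by fastforce
  with h have "homeomorphic_map (subtopology M U) (euclidean :: complex topology) (k \<circ> h)"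
    by (rule homeomorphic_map_compose)
  then obtain g where g: "homeomorphic_maps (subtopology M U) (euclidean :: complex topology) (k \<circ> h) g"
    using homeomorphic_map_maps by blast
  define c where "c = k \<circ> h"
  have topU: "topspace (subtopology M U) = U"
    using openin_subset[OF U(1)] by (auto simp: topspace_subtopology)
  have gc: "continuous_map euclidean (subtopology M U) g" and cg: "\<And>z. c (g z) = z" "\<And>y. y \<in> U \<Longrightarrow> g (c y) = y"
    using g topU by (auto simp: homeomorphic_maps_def c_def)
  have gU: "g z \<in> U" for z
    using continuous_map_funspace[OF gc] topU by auto
  have gM: "continuous_map euclidean M g"
    using gc continuous_map_into_fulltopology by blast
  have "openin euclidean {z \<in> topspace euclidean. g z \<in> A}"
    using gM A(1) openin_continuous_map_preimage by blast
  then have "open {z. g z \<in> A}" by simp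
  moreover have "c x \<in> {z. g z \<in> A}" using cg(2) U(2) A(2) by simp
  ultimately obtain r where r: "0 < r" "ball (c x) r \<subseteq> {z. g z \<in> A}"
    using openE by blast
  define B where "B = {y \<in> topspace (subtopology M U). c y \<in> ball (c x) r}"
  have "continuous_map (subtopology M U) euclidean c"
    using g by (auto simp: homeomorphic_maps_def c_def)
  then have "openin (subtopology M U) B"
    unfolding B_def by (rule openin_continuous_map_preimage) auto
  then have opB: "openin M B"
    using U(1) openin_trans_full by blast
  have Bx: "B - {x} = g ` (ball (c x) r - {c x})"
  proof
    show "B - {x} \<subseteq> g ` (ball (c x) r - {c x})"
    proof
      fix y assume y: "y \<in> B - {x}"
      then have "c y \<in> ball (c x) r - {c x}" "g (c y) = y"
        using cg(2)[of y] cg(2)[OF U(2)] topU by (auto simp: B_def)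
      then show "y \<in> g ` (ball (c x) r - {c x})" by force
    qed
    show "g ` (ball (c x) r - {c x}) \<subseteq> B - {x}"
      using cg(1) gU topU unfolding B_def by auto
  qed
  have "connected (ball (c x) r - {c x})"
    by (rule connected_punctured_ball) simp
  then have "connectedin M (B - {x})"
    unfolding Bx by (intro connectedin_continuous_map_image[OF gM]) simp
  moreover have "B \<subseteq> A"
  proof
    fix y assume y: "y \<in> B"
    then have "g (c y) \<in> A" "g (c y) = y" using r cg(2)[of y] topU by (auto simp: B_def)
    then show "y \<in> A" by simp
  qed
  moreover have "x \<in> B"
    unfolding B_def topU using U(2) r(1) by simp
  ultimately show thesis
    using opB by (intro that[of B])
qed

subsection \<open>The circle\<close>

definition circ :: "real \<Rightarrow> nat \<Rightarrow> real" where
  "circ t = (\<lambda>i. if i = 0 then cos t else if i = 1 then sin t else 0)"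

lemma continuous_map_circ: "continuous_map euclideanreal (Euclidean_space 2) circ"
  unfolding continuous_map_Euclidean_space_componentwise
proof (intro conjI allI)
  show "continuous_map euclideanreal euclideanreal (\<lambda>t. circ t i)" for i
    by (cases "i = 0"; cases "i = 1") (auto simp: circ_def intro!: continuous_intros)
qed (auto simp: circ_def topspace_Euclidean_space)

lemma unit_sphere_2_eq: "unit_sphere 2 = range circ"
proof
  show "range circ \<subseteq> unit_sphere 2"
    by (auto simp: circ_def unit_sphere_def topspace_Euclidean_space numeral_2_eq_2)
  show "unit_sphere 2 \<subseteq> range circ"
  proof
    fix z assume z: "z \<in> unit_sphere 2"
    then have "(z 0)\<^sup>2 + (z 1)\<^sup>2 = 1"
      by (simp add: unit_sphere_def numeral_2_eq_2)
    then obtain t where "z 0 = cos t" "z 1 = sin t"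
      using sincos_total_2pi by metis
    then have "z = circ t"
      using z by (auto simp: circ_def unit_sphere_def topspace_Euclidean_space fun_eq_iff)
    then show "z \<in> range circ" by blast
  qed
qed

lemma circ_eq_iff: "circ a = circ b \<longleftrightarrow> (\<exists>n::int. a = b + 2 * pi * n)"
proof -
  have "circ a = circ b \<longleftrightarrow> sin a = sin b \<and> cos a = cos b"
    by (auto simp: circ_def fun_eq_iff)
  then show ?thesis
    using sin_cos_eq_iff by metis
qed

lemma circ_inj:
  assumes "circ a = circ b" "\<bar>a - b\<bar> < 2 * pi"
  shows "a = b"
proof -
  obtain n :: int where n: "a = b + 2 * pi * n"
    using assms(1) circ_eq_iff by blast
  then have "2 * pi * \<bar>real_of_int n\<bar> < 2 * pi * 1"
    using assms(2) by (simp add: abs_mult)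
  then have "n = 0"
    by (simp add: mult_less_cancel_left_pos)
  then show ?thesis using n by simp
qed

lemma infinite_unit_sphere_2: "infinite (unit_sphere 2)"
proof
  assume "finite (unit_sphere 2)"
  moreover have "inj_on circ {0..1}"
  proof (rule inj_onI)
    fix a b :: real assume "a \<in> {0..1}" "b \<in> {0..1}" "circ a = circ b"
    then show "a = b"
      using pi_ge_two by (intro circ_inj) auto
  qed
  ultimately have "finite {0..1::real}"
    using unit_sphere_2_eq by (metis finite_imageD finite_subset image_mono subset_UNIV)
  then show False
    using infinite_Icc[of 0 "1::real"] by simp
qed

lemma connectedin_punctured_circle:
  assumes "z \<in> unit_sphere 2"
  shows "connectedin (Euclidean_space 2) (unit_sphere 2 - {z})"
proof -
  obtain \<theta> where \<theta>: "z = circ \<theta>" using assms unit_sphere_2_eq by blast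
  have "unit_sphere 2 - {z} = circ ` {\<theta><..<\<theta> + 2 * pi}"
  proof
    show "circ ` {\<theta><..<\<theta> + 2 * pi} \<subseteq> unit_sphere 2 - {z}"
    proof
      fix w assume "w \<in> circ ` {\<theta><..<\<theta> + 2 * pi}"
      then obtain t where t: "\<theta> < t" "t < \<theta> + 2 * pi" "w = circ t" by auto
      then have "w \<noteq> z" using circ_inj[of t \<theta>] \<theta> by auto
      then show "w \<in> unit_sphere 2 - {z}" using t unit_sphere_2_eq by auto
    qed
    show "unit_sphere 2 - {z} \<subseteq> circ ` {\<theta><..<\<theta> + 2 * pi}"
    proof
      fix w assume w: "w \<in> unit_sphere 2 - {z}"
      then obtain t where t: "w = circ t" using unit_sphere_2_eq by blast
      \<comment> \<open>The number of full turns that brings the angle into the half-open interval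
        of length \<open>2 * pi\<close> starting at \<theta>; its left end is excluded afterwards,
        because it gives the removed point.\<close>
      define n where "n = \<lfloor>(t - \<theta>) / (2 * pi)\<rfloor>"
      define s where "s = t - 2 * pi * n"
      have "w = circ s"
        unfolding t circ_eq_iff s_def by (intro exI[of _ n]) simp
      have "real_of_int n \<le> (t - \<theta>) / (2 * pi)" "(t - \<theta>) / (2 * pi) < real_of_int n + 1"
        unfolding n_def by linarith+
      then have "\<theta> \<le> s" "s < \<theta> + 2 * pi"
        by (simp_all add: s_def field_simps)
      moreover have "s \<noteq> \<theta>" using w \<open>w = circ s\<close> \<theta> by auto
      ultimately show "w \<in> circ ` {\<theta><..<\<theta> + 2 * pi}"
        using \<open>w = circ s\<close> by auto
    qed
  qed
  moreover have "connectedin (Euclidean_space 2) (circ ` {\<theta><..<\<theta> + 2 * pi})"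
    by (rule connectedin_continuous_map_image[OF continuous_map_circ]) simp
  ultimately show ?thesis by simp
qed

definition line :: "real \<Rightarrow> nat \<Rightarrow> real" where
  "line s = (\<lambda>i. if i = 0 then s else 0)"

lemma line: "unit_cball 1 = line ` {- 1..1}" "unit_ball 1 = line ` {- 1<..<1}"
  "unit_sphere 1 = {line 1, line (- 1)}" "inj line"
proof -
  have E: "topspace (Euclidean_space 1) = range line"
  proof
    show "topspace (Euclidean_space 1) \<subseteq> range line"
    proof
      fix x assume "x \<in> topspace (Euclidean_space 1)"
      then have "x = line (x 0)" by (auto simp: topspace_Euclidean_space line_def fun_eq_iff)
      then show "x \<in> range line" by blast
    qed
  qed (auto simp: topspace_Euclidean_space line_def)
  have n: "enorm 1 (line s) = \<bar>s\<bar>" for s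
    by (simp add: enorm_def line_def)
  show "unit_cball 1 = line ` {- 1..1}" "unit_ball 1 = line ` {- 1<..<1}"
    by (auto simp: unit_cball_iff unit_ball_iff E n abs_le_iff abs_less_iff simp del: One_nat_def)
  show "unit_sphere 1 = {line 1, line (- 1)}"
    by (auto simp: unit_sphere_iff E n abs_if split: if_splits simp del: One_nat_def)
  show "inj line"
    by (auto simp: inj_on_def line_def fun_eq_iff split: if_splits)
qed

lemma continuous_map_line: "continuous_map euclideanreal (Euclidean_space 1) line"
  unfolding continuous_map_Euclidean_space_componentwise
  by (auto simp: line_def topspace_Euclidean_space)

subsection \<open>Regular cell decompositions of surfaces\<close>

text \<open>The dimension and the characteristic map of each cell, which a regular decomposition
  only asserts to exist, are chosen once and for all. Injectivity is already stated for the whole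
  closed ball.\<close>

locale surface_cells =
  fixes M :: "'a topology" and C :: "'a set set"
    and dm :: "'a set \<Rightarrow> nat" and cm :: "'a set \<Rightarrow> (nat \<Rightarrow> real) \<Rightarrow> 'a"
  assumes surface: "closed_surface M" and finite_C: "finite C" and partition: "partition_on (topspace M) C"
    and cm_cont: "e \<in> C \<Longrightarrow> continuous_map (subtopology (Euclidean_space (dm e)) (unit_cball (dm e))) M (cm e)"
    and cm_inj: "e \<in> C \<Longrightarrow> inj_on (cm e) (unit_cball (dm e))"
    and cm_ball: "e \<in> C \<Longrightarrow> cm e ` unit_ball (dm e) = e"
    and cm_sphere: "e \<in> C \<Longrightarrow> cm e ` unit_sphere (dm e) \<subseteq> \<Union>{f \<in> C. dm f < dm e}"
begin

declare One_nat_def [simp del]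

definition skel :: "nat \<Rightarrow> 'a set set" where
  "skel n = {e \<in> C. dm e = n}"

text \<open>The closure of the cell minus the cell, by \<open>closure_of_cell\<close> and
  \<open>rim_disjoint\<close>; hence independent of the chosen map.\<close>

definition rim :: "'a set \<Rightarrow> 'a set" where
  "rim e = cm e ` unit_sphere (dm e)"

text \<open>Vertices are singleton sets of points, so lying on the rim is inclusion.\<close>

definition ends :: "'a set \<Rightarrow> 'a set set" where
  "ends e = {u \<in> skel 0. u \<subseteq> rim e}"

text \<open>Inclusion loses nothing for a face: by \<open>edge_subset_rim\<close> an edge that meets
  its rim lies entirely on it.\<close>

definition sides :: "'a set \<Rightarrow> 'a set set" where
  "sides f = {e \<in> skel 1. e \<subseteq> rim f}"

section \<open>Disjointness, closures and openness of cells\<close>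

lemma Hausdorff: "Hausdorff_space M"
  using surface by (simp add: closed_surface_def)

lemma cell_disjoint: "e \<in> C \<Longrightarrow> f \<in> C \<Longrightarrow> e \<noteq> f \<Longrightarrow> e \<inter> f = {}"
  using partition by (auto simp: partition_on_def pairwise_def disjnt_def)

lemma cell_eqI: "e \<in> C \<Longrightarrow> f \<in> C \<Longrightarrow> x \<in> e \<Longrightarrow> x \<in> f \<Longrightarrow> e = f"
  using cell_disjoint by blast

lemma Union_C: "\<Union>C = topspace M"
  using partition by (simp add: partition_on_def)

lemma skel_C: "e \<in> skel n \<Longrightarrow> e \<in> C" and dm_skel: "e \<in> skel n \<Longrightarrow> dm e = n"
  by (simp_all add: skel_def)

lemma finite_skel: "finite (skel n)"
  using finite_C by (simp add: skel_def)

lemma cell_nonempty: "e \<in> C \<Longrightarrow> e \<noteq> {}"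
  using partition by (auto simp: partition_on_def)

lemma closed_cell: "e \<in> C \<Longrightarrow> cm e ` unit_cball (dm e) = e \<union> rim e"
  using cm_ball by (simp add: unit_cball_eq_Un image_Un rim_def)

lemma closedin_closed_cell: "e \<in> C \<Longrightarrow> closedin M (e \<union> rim e)"
  using closed_cell_embedding(2)[OF Hausdorff cm_cont cm_inj] closed_cell by metis

lemma closedin_rim: "e \<in> C \<Longrightarrow> closedin M (rim e)"
proof -
  assume e: "e \<in> C"
  let ?D = "subtopology (Euclidean_space (dm e)) (unit_cball (dm e))"
  have "closedin ?D (unit_sphere (dm e))"
    by (rule closedin_subset_topspace[OF closedin_unit_sphere]) (simp add: unit_cball_eq_Un)
  moreover have "closed_map ?D M (cm e)"
    using closed_cell_embedding[OF Hausdorff cm_cont[OF e] cm_inj[OF e]] embedding_imp_closed_map_eq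
    by (metis topspace_unit_cball)
  ultimately show ?thesis
    by (simp add: closed_map_def rim_def)
qed

lemma rim_disjoint: "e \<in> C \<Longrightarrow> e \<inter> rim e = {}"
  using inj_on_image_Int[OF cm_inj, of e "unit_ball (dm e)" "unit_sphere (dm e)"] cm_ball[of e]
    unit_ball_sphere_disjoint[of "dm e"] by (auto simp: rim_def unit_cball_eq_Un)

lemma rim_lower: "e \<in> C \<Longrightarrow> rim e \<subseteq> \<Union>{f \<in> C. dm f < dm e}"
  using cm_sphere by (simp add: rim_def)

text \<open>The closed cell is compact, hence closed; conversely each of its points is the end of a
  radius whose earlier points belong to the open cell.\<close>

lemma closure_of_cell:
  assumes e: "e \<in> C"
  shows "M closure_of e = e \<union> rim e"
proof
  show "M closure_of e \<subseteq> e \<union> rim e"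
    using closedin_closed_cell[OF e] by (intro closure_of_minimal) auto
  show "e \<union> rim e \<subseteq> M closure_of e"
  proof
    fix y assume "y \<in> e \<union> rim e"
    then obtain z where z: "z \<in> unit_cball (dm e)" "y = cm e z"
      using closed_cell[OF e] by blast
    let ?D = "subtopology (Euclidean_space (dm e)) (unit_cball (dm e))"
    let ?g = "\<lambda>t i. t * z i"
    have sc: "?g t \<in> unit_cball (dm e)" "t < 1 \<Longrightarrow> ?g t \<in> unit_ball (dm e)" if t: "t \<in> {0..1}" for t
    proof -
      have "t * enorm (dm e) z \<le> t * 1"
        using t z(1) by (intro mult_left_mono) (auto simp: unit_cball_iff)
      then show "?g t \<in> unit_cball (dm e)" "t < 1 \<Longrightarrow> ?g t \<in> unit_ball (dm e)"
        using t z(1) scale_in_Euclidean_space[of z "dm e" t]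
        by (auto simp: unit_cball_iff unit_ball_iff enorm_scale)
    qed
    have "continuous_map (top_of_set {0..1}) (Euclidean_space (dm e)) ?g"
      using z(1) by (intro continuous_map_scale) (auto simp: unit_cball_iff)
    then have "continuous_map (top_of_set {0..1}) ?D ?g"
      using sc(1) by (simp add: continuous_map_in_subtopology Pi_iff)
    then have "continuous_map (top_of_set {0..1}) M (cm e \<circ> ?g)"
      using cm_cont[OF e] by (rule continuous_map_compose)
    then have img: "(cm e \<circ> ?g) ` (top_of_set {0..1} closure_of {0..<1}) \<subseteq> M closure_of ((cm e \<circ> ?g) ` {0..<1})"
      by (rule continuous_map_image_closure_subset)
    have "(1::real) \<in> top_of_set {0..1} closure_of {0..<1}"
      by (simp add: closure_of_subtopology Int_absorb1 subset_iff)
    then have "y \<in> M closure_of ((cm e \<circ> ?g) ` {0..<1})"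
      using img z(2) by (force simp: o_def)
    moreover have "(cm e \<circ> ?g) ` {0..<1} \<subseteq> e"
      using sc(2) cm_ball[OF e] by force
    ultimately show "y \<in> M closure_of e"
      using closure_of_mono by blast
  qed
qed

lemma open_meets_cell:
  assumes "e \<in> C" "openin M A" "x \<in> A" "x \<in> e \<union> rim e"
  shows "A \<inter> e \<noteq> {}"
  using assms closure_of_cell[of e] in_closure_of[of x M e] by auto

lemma openin_2_cell:
  assumes "f \<in> skel 2"
  shows "openin M f"
proof -
  have f: "f \<in> C" "dm f = 2"
    using assms by (auto simp: skel_def)
  have "continuous_map (subtopology (Euclidean_space 2) (unit_ball 2)) M (cm f)"
    using continuous_map_from_subtopology_mono[OF cm_cont[OF f(1)]] f(2) by (simp add: unit_cball_eq_Un)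
  moreover have "inj_on (cm f) (unit_ball 2)"
    using inj_on_subset[OF cm_inj[OF f(1)]] f(2) by (simp add: unit_cball_eq_Un)
  ultimately have "openin M (cm f ` unit_ball 2)"
    by (rule surface_invariance_of_domain[OF surface openin_unit_ball])
  then show ?thesis
    using cm_ball[OF f(1)] f(2) by simp
qed

lemma dm_le_2:
  assumes "e \<in> C"
  shows "dm e \<le> 2"
proof (rule surface_dimension_le_2[OF surface openin_unit_ball])
  show "unit_ball (dm e) \<noteq> {}"
    using zero_in_unit_ball by blast
  show "continuous_map (subtopology (Euclidean_space (dm e)) (unit_ball (dm e))) M (cm e)"
    using continuous_map_from_subtopology_mono[OF cm_cont[OF assms]] by (simp add: unit_cball_eq_Un)
  show "inj_on (cm e) (unit_ball (dm e))"
    using inj_on_subset[OF cm_inj[OF assms]] by (simp add: unit_cball_eq_Un)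
qed

lemma C_eq: "C = skel 0 \<union> skel 1 \<union> skel 2"
  using dm_le_2 by (force simp: skel_def)

lemma skel_disjoint: "m \<noteq> n \<Longrightarrow> skel m \<inter> skel n = {}"
  by (auto simp: skel_def)

lemma skel_Int: "e \<in> skel m \<Longrightarrow> f \<in> skel n \<Longrightarrow> m \<noteq> n \<Longrightarrow> e \<inter> f = {}"
  using cell_disjoint[of e f] by (cases "e = f") (auto simp: skel_def)

lemma euler_characteristic_eq:
  "euler_characteristic M = int (card (skel 0)) - int (card (skel 1)) + int (card (skel 2))"
proof -
  have "has_euler (subtopology M (\<Union>C)) {} (\<Sum>e\<in>C. (- 1) ^ dm e)"
    using partition by (intro conjunct2[OF has_euler_cells[OF Hausdorff finite_C _ cm_cont cm_inj cm_ball cm_sphere]])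
      (simp_all add: partition_on_def)
  then have "euler_characteristic M = (\<Sum>e\<in>C. (- 1) ^ dm e)"
    by (intro euler_characteristic_eqI) (simp add: Union_C)
  also have "\<dots> = (\<Sum>e\<in>skel 0. (- 1) ^ dm e) + (\<Sum>e\<in>skel 1. (- 1) ^ dm e) + (\<Sum>e\<in>skel 2. (- 1) ^ dm e)"
    using skel_disjoint[of 0 1] skel_disjoint[of 0 2] skel_disjoint[of 1 2] finite_skel
    by (subst C_eq, subst sum.union_disjoint, simp_all add: Int_Un_distrib2)
       (subst sum.union_disjoint, simp_all)
  also have "\<dots> = int (card (skel 0)) - int (card (skel 1)) + int (card (skel 2))"
    by (simp add: dm_skel)
  finally show ?thesis .
qed

section \<open>Vertices, edges and the Euler formula's 1-skeleton\<close>

lemma vertex_singleton: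
  assumes "u \<in> skel 0"
  obtains x where "u = {x}" "x \<in> topspace M"
proof -
  have u: "u \<in> C" "dm u = 0" using assms by (auto simp: skel_def)
  have "unit_ball 0 = {\<lambda>_. 0}"
    by (auto simp: unit_ball_def topspace_Euclidean_space)
  then have "u = {cm u (\<lambda>_. 0)}"
    using cm_ball[OF u(1)] u(2) by simp
  then show thesis
    using that[of "cm u (\<lambda>_. 0)"] u(1) Union_C by auto
qed

lemma rim_vertex: "u \<in> skel 0 \<Longrightarrow> rim u = {}"
  by (auto simp: rim_def dm_skel unit_sphere_def)

lemma closedin_vertex: "u \<in> skel 0 \<Longrightarrow> closedin M u"
  using closedin_closed_cell[of u] rim_vertex skel_C by fastforce

lemma edge_param:
  assumes "e \<in> skel 1"
  obtains \<eta> :: "real \<Rightarrow> 'a" where "continuous_map (top_of_set {- 1..1}) M \<eta>" "inj_on \<eta> {- 1..1}" "\<eta> ` {- 1<..<1} = e"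
    "rim e = {\<eta> 1, \<eta> (- 1)}" "ends e = {{\<eta> 1}, {\<eta> (- 1)}}"
proof -
  have e: "e \<in> C" "dm e = 1" using assms by (auto simp: skel_def)
  let ?D = "subtopology (Euclidean_space 1) (unit_cball 1)"
  define \<eta> where "\<eta> = cm e \<circ> line"
  have "continuous_map (top_of_set {- 1..1}) ?D line"
    using continuous_map_line by (auto simp: continuous_map_in_subtopology continuous_map_from_subtopology line)
  then have c: "continuous_map (top_of_set {- 1..1}) M \<eta>"
    unfolding \<eta>_def using cm_cont[OF e(1)] e(2) by (auto intro: continuous_map_compose)
  have i: "inj_on \<eta> {- 1..1}"
    unfolding \<eta>_def using cm_inj[OF e(1)] e(2) line(1,4)
    by (intro comp_inj_on) (auto intro: inj_on_subset)
  have b: "\<eta> ` {- 1<..<1} = e"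
    unfolding \<eta>_def using cm_ball[OF e(1)] e(2) line(2) by (simp add: image_comp)
  have r: "rim e = {\<eta> 1, \<eta> (- 1)}"
    unfolding rim_def e(2) line(3) \<eta>_def by simp
  have v: "{x} \<in> skel 0" if x: "x \<in> rim e" for x
  proof -
    obtain u where u: "u \<in> C" "dm u < 1" "x \<in> u"
      using subsetD[OF rim_lower[OF e(1)] x] e(2) by auto
    then have "u \<in> skel 0" by (simp add: skel_def)
    then show ?thesis
      using u(3) by (auto elim: vertex_singleton)
  qed
  have n: "ends e = {{\<eta> 1}, {\<eta> (- 1)}}"
  proof
    show "ends e \<subseteq> {{\<eta> 1}, {\<eta> (- 1)}}"
      unfolding ends_def r by (auto elim!: vertex_singleton)
    show "{{\<eta> 1}, {\<eta> (- 1)}} \<subseteq> ends e"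
      unfolding ends_def using v r by auto
  qed
  show thesis
    by (rule that[OF c i b r n])
qed

text \<open>Reversing the interval if necessary places the prescribed end at parameter 1.\<close>

lemma edge_param_end:
  assumes "e \<in> skel 1" "u \<in> ends e"
  obtains \<eta> :: "real \<Rightarrow> 'a" where "continuous_map (top_of_set {- 1..1}) M \<eta>" "inj_on \<eta> {- 1..1}" "\<eta> ` {- 1<..<1} = e"
    "rim e = {\<eta> 1, \<eta> (- 1)}" "u = {\<eta> 1}"
proof -
  obtain \<eta> :: "real \<Rightarrow> 'a" where \<eta>: "continuous_map (top_of_set {- 1..1}) M \<eta>" "inj_on \<eta> {- 1..1}" "\<eta> ` {- 1<..<1} = e"
    "rim e = {\<eta> 1, \<eta> (- 1)}" "ends e = {{\<eta> 1}, {\<eta> (- 1)}}"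
    using edge_param[OF assms(1)] .
  consider "u = {\<eta> 1}" | "u = {\<eta> (- 1)}" using assms(2) \<eta>(5) by blast
  then show thesis
  proof cases
    case 1
    show thesis by (rule that[OF \<eta>(1-4) 1])
  next
    case 2
    have im: "uminus ` {- 1..1::real} = {- 1..1}" "uminus ` {- 1<..<1::real} = {- 1<..<1}"
      by auto
    have "continuous_map (top_of_set {- 1..1::real}) (top_of_set {- 1..1}) uminus"
      by (auto simp: continuous_map_in_subtopology intro!: continuous_intros)
    then have "continuous_map (top_of_set {- 1..1}) M (\<eta> \<circ> uminus)"
      using \<eta>(1) by (rule continuous_map_compose)
    moreover have "inj_on (\<eta> \<circ> uminus) {- 1..1}"
      using \<eta>(2) im(1) by (intro comp_inj_on) (auto simp: inj_on_def)
    moreover have "(\<eta> \<circ> uminus) ` {- 1<..<1} = e"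
      unfolding image_comp[symmetric] im(2) by (rule \<eta>(3))
    ultimately show thesis
      using 2 \<eta>(4) by (intro that[of "\<eta> \<circ> uminus"]) auto
  qed
qed

lemma ends_props:
  assumes "e \<in> skel 1"
  shows "ends e \<subseteq> skel 0" "card (ends e) = 2" "rim e = \<Union>(ends e)"
proof -
  obtain \<eta> :: "real \<Rightarrow> 'a" where "continuous_map (top_of_set {- 1..1}) M \<eta>" "\<eta> ` {- 1<..<1} = e"
    and \<eta>: "inj_on \<eta> {- 1..1}" "rim e = {\<eta> 1, \<eta> (- 1)}" "ends e = {{\<eta> 1}, {\<eta> (- 1 :: real)}}"
    by (rule edge_param[OF assms])
  show "ends e \<subseteq> skel 0" by (auto simp: ends_def)
  \<comment> \<open>Regularity excludes loops: the two boundary points have distinct images.\<close>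
  have "\<eta> 1 \<noteq> \<eta> (- 1)"
    using inj_onD[OF \<eta>(1), of 1 "- 1"] by auto
  then show "card (ends e) = 2" by (simp add: \<eta>(3))
  show "rim e = \<Union>(ends e)" using \<eta>(2,3) by auto
qed

lemma connectedin_edge:
  assumes "e \<in> skel 1"
  shows "connectedin M e"
proof -
  obtain \<eta> :: "real \<Rightarrow> 'a" where \<eta>: "continuous_map (top_of_set {- 1..1}) M \<eta>" "\<eta> ` {- 1<..<1} = e"
    by (rule edge_param[OF assms])
  have "connectedin (top_of_set {- 1..1}) {- 1<..<1::real}"
    by (simp add: connectedin_subtopology subset_iff)
  then show ?thesis
    using connectedin_continuous_map_image[OF \<eta>(1)] \<eta>(2) by metis
qed

text \<open>An injective real coordinate on the open edge, through which invariance of domain on the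
  line applies to maps into it.\<close>

lemma edge_coordinate:
  assumes "e \<in> skel 1"
  obtains \<kappa> :: "'a \<Rightarrow> real" where "continuous_map (subtopology M e) euclideanreal \<kappa>" "inj_on \<kappa> e"
proof -
  have e: "e \<in> C" "dm e = 1" using assms by (auto simp: skel_def)
  let ?D = "subtopology (Euclidean_space 1) (unit_cball 1)"
  have "homeomorphic_map ?D (subtopology M (e \<union> rim e)) (cm e)"
    using closed_cell_embedding(1)[OF Hausdorff cm_cont[OF e(1)] cm_inj[OF e(1)]] closed_cell[OF e(1)]
    unfolding embedding_map_def e(2) topspace_unit_cball by simp
  then obtain \<psi> where \<psi>: "homeomorphic_maps ?D (subtopology M (e \<union> rim e)) (cm e) \<psi>"
    using homeomorphic_map_maps by blast
  have eM: "e \<subseteq> topspace M" using e(1) Union_C by blast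
  have "continuous_map (subtopology M (e \<union> rim e)) ?D \<psi>"
    using \<psi> by (simp add: homeomorphic_maps_def)
  then have "continuous_map (subtopology M e) (Euclidean_space 1) \<psi>"
    using continuous_map_into_fulltopology continuous_map_from_subtopology_mono by blast
  then have "continuous_map (subtopology M e) euclideanreal (\<lambda>y. \<psi> y 0)"
    by (rule continuous_map_Euclidean_space_proj)
  moreover have "inj_on (\<lambda>y. \<psi> y 0) e"
  proof (rule inj_onI)
    fix x y assume xy: "x \<in> e" "y \<in> e" "\<psi> x 0 = \<psi> y 0"
    have cm: "z \<in> e \<Longrightarrow> cm e (\<psi> z) = z \<and> \<psi> z \<in> unit_cball 1" for z
      using \<psi> eM unfolding homeomorphic_maps_def continuous_map_def
      by (auto simp: topspace_unit_cball[simplified])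
    then obtain s t where st: "\<psi> x = line s" "\<psi> y = line t"
      using xy line(1) by (metis imageE)
    then have "s = t" using xy(3) by (simp add: line_def)
    then have "\<psi> x = \<psi> y" using st by simp
    then show "x = y" using cm xy by metis
  qed
  ultimately show thesis using that by blast
qed

section \<open>Edges along the rim of a face\<close>

lemma rim_2_cell: "f \<in> skel 2 \<Longrightarrow> rim f \<subseteq> \<Union>(skel 0) \<union> \<Union>(skel 1)"
  using rim_lower[of f] by (fastforce simp: skel_def less_2_cases_iff)

text \<open>The vertices together with the other closed edges form a finite union of closed sets,
  and its complement cuts exactly \<open>e\<close> out of the 1-skeleton.\<close>

lemma openin_1_skeleton_edge:
  assumes "e \<in> skel 1"
  shows "openin (subtopology M (\<Union>(skel 0) \<union> \<Union>(skel 1))) e"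
proof -
  let ?M1 = "\<Union>(skel 0) \<union> \<Union>(skel 1)"
  define T where "T = \<Union>(skel 0) \<union> (\<Union>f\<in>skel 1 - {e}. f \<union> rim f)"
  have "closedin M T"
    unfolding T_def using finite_skel closedin_vertex closedin_closed_cell skel_C
    by (intro closedin_Un closedin_Union) auto
  then have "openin M (topspace M - T)"
    by blast
  moreover have "(topspace M - T) \<inter> ?M1 = e"
  proof
    show "(topspace M - T) \<inter> ?M1 \<subseteq> e"
      by (auto simp: T_def)
    have nv: "x \<notin> \<Union>(skel 0)" if "x \<in> e" for x
      using skel_Int[OF assms, of _ 0] that by auto
    moreover have "x \<notin> f \<union> rim f" if x: "x \<in> e" and f: "f \<in> skel 1 - {e}" for x f
    proof -
      have "e \<inter> f = {}"
        using cell_disjoint[of e f] assms f by (auto simp: skel_def)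
      moreover have "rim f \<subseteq> \<Union>(skel 0)"
        using ends_props(1,3)[of f] f by auto
      ultimately show ?thesis
        using x nv[OF x] by blast
    qed
    ultimately have "e \<inter> T = {}"
      unfolding T_def by auto
    then show "e \<subseteq> (topspace M - T) \<inter> ?M1"
      using assms skel_C[OF assms] Union_C by auto
  qed
  ultimately show ?thesis
    by (metis openin_subtopology)
qed

text \<open>The edge is connected and its intersection with the rim is closed in it. The
  intersection is also open: near any of its points the rim is an injective image of an interval
  inside a one-dimensional edge, so invariance of domain on the line applies.\<close>

lemma edge_subset_rim:
  assumes f: "f \<in> skel 2" and e: "e \<in> skel 1" and ne: "e \<inter> rim f \<noteq> {}"
  shows "e \<subseteq> rim f"
proof -
  have fC: "f \<in> C" "dm f = 2" and eC: "e \<in> C" using f e by (auto simp: skel_def)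
  have eM: "e \<subseteq> topspace M" using eC Union_C by blast
  then have tope: "topspace (subtopology M e) = e" by auto
  let ?D = "subtopology (Euclidean_space 2) (unit_cball 2)"
  define h where "h = cm f \<circ> circ"
  have hrim: "h t \<in> rim f" for t
    using unit_sphere_2_eq by (auto simp: h_def rim_def fC)
  have "continuous_map euclideanreal ?D circ"
    using continuous_map_circ unit_sphere_2_eq by (auto simp: continuous_map_in_subtopology unit_cball_eq_Un)
  then have hM: "continuous_map euclideanreal M h"
    unfolding h_def using cm_cont[OF fC(1)] fC(2) by (auto intro: continuous_map_compose)
  have "h t \<in> \<Union>(skel 0) \<union> \<Union>(skel 1)" for t
    using subsetD[OF rim_2_cell[OF f] hrim] .
  with hM have "continuous_map euclideanreal (subtopology M (\<Union>(skel 0) \<union> \<Union>(skel 1))) h"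
    unfolding continuous_map_in_subtopology by (intro conjI Pi_I)
  from openin_continuous_map_preimage[OF this openin_1_skeleton_edge[OF e]]
  have P: "open {t. h t \<in> e}" by simp
  obtain \<kappa> :: "'a \<Rightarrow> real" where \<kappa>: "continuous_map (subtopology M e) euclideanreal \<kappa>" "inj_on \<kappa> e"
    using edge_coordinate[OF e] .
  have "openin (subtopology M e) (e \<inter> rim f)"
  proof (subst openin_subopen, intro ballI)
    fix y assume y: "y \<in> e \<inter> rim f"
    then obtain t0 where t0: "y = h t0"
      unfolding rim_def fC unit_sphere_2_eq by (auto simp: h_def)
    \<comment> \<open>The window has length 2, less than a full turn, so \<open>circ\<close> is
      injective on it.\<close>
    define J where "J = {t. h t \<in> e} \<inter> {t0 - 1<..<t0 + 1}"
    have opJ: "open J" using P by (auto simp: J_def)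
    have "continuous_map (top_of_set J) M h"
      using hM continuous_map_from_subtopology by blast
    then have "continuous_map (top_of_set J) (subtopology M e) h"
      by (auto simp: continuous_map_in_subtopology J_def)
    from continuous_map_compose[OF this \<kappa>(1)]
    have "continuous_on J (\<kappa> \<circ> h)" by simp
    moreover have "inj_on (\<kappa> \<circ> h) J"
    proof (rule inj_onI)
      fix a b assume ab: "a \<in> J" "b \<in> J" "(\<kappa> \<circ> h) a = (\<kappa> \<circ> h) b"
      then have "h a = h b"
        using inj_onD[OF \<kappa>(2)] by (auto simp: J_def)
      moreover have "circ t \<in> unit_cball 2" for t
        using unit_sphere_2_eq by (auto simp: unit_cball_eq_Un)
      ultimately have "circ a = circ b"
        using inj_onD[OF cm_inj[OF fC(1)]] fC(2) by (auto simp: h_def)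
      moreover have "\<bar>a - b\<bar> < 2 * pi"
        using ab(1,2) pi_ge_two by (auto simp: J_def)
      ultimately show "a = b" by (rule circ_inj)
    qed
    ultimately have "open ((\<kappa> \<circ> h) ` J)"
      using opJ by (intro invariance_of_domain)
    then have "openin (subtopology M e) {x \<in> topspace (subtopology M e). \<kappa> x \<in> (\<kappa> \<circ> h) ` J}"
      by (intro openin_continuous_map_preimage[OF \<kappa>(1)]) simp
    moreover have "{x \<in> e. \<kappa> x \<in> (\<kappa> \<circ> h) ` J} \<subseteq> e \<inter> rim f"
    proof
      fix x assume "x \<in> {x \<in> e. \<kappa> x \<in> (\<kappa> \<circ> h) ` J}"
      then obtain t where "x \<in> e" "t \<in> J" "\<kappa> x = \<kappa> (h t)" by auto
      then have "x = h t" using inj_onD[OF \<kappa>(2)] by (auto simp: J_def)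
      then show "x \<in> e \<inter> rim f" using \<open>x \<in> e\<close> hrim by simp
    qed
    moreover have "y \<in> {x \<in> e. \<kappa> x \<in> (\<kappa> \<circ> h) ` J}"
      using y t0 by (auto simp: J_def)
    ultimately show "\<exists>T. openin (subtopology M e) T \<and> y \<in> T \<and> T \<subseteq> e \<inter> rim f"
      unfolding tope by blast
  qed
  moreover have "closedin (subtopology M e) (e \<inter> rim f)"
    using closedin_rim[OF fC(1)] by (auto simp: closedin_subtopology)
  moreover have "connected_space (subtopology M e)"
    using connectedin_edge[OF e] by (simp add: connectedin_def)
  ultimately have "e \<inter> rim f = topspace (subtopology M e)"
    using ne unfolding connected_space_clopen_in by blast
  then show ?thesis using tope by blast
qed

lemma rim_subset:
  assumes "f \<in> skel 2"
  shows "rim f \<subseteq> \<Union>(skel 0) \<union> \<Union>(sides f)"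
proof
  fix x assume x: "x \<in> rim f"
  then consider "x \<in> \<Union>(skel 0)" | e where "e \<in> skel 1" "x \<in> e"
    using rim_2_cell[OF assms] by blast
  then show "x \<in> \<Union>(skel 0) \<union> \<Union>(sides f)"
  proof cases
    case (2 e)
    then have "e \<subseteq> rim f"
      using edge_subset_rim[OF assms] x by blast
    then show ?thesis using 2 by (auto simp: sides_def)
  qed simp
qed


lemma finite_sides: "finite (sides f)"
  using finite_skel by (simp add: sides_def)

lemma sides_skel: "e \<in> sides f \<Longrightarrow> e \<in> skel 1"
  by (simp add: sides_def)

lemma rim_subset_topspace: "e \<in> C \<Longrightarrow> rim e \<subseteq> topspace M"
  using closedin_rim closedin_subset by blast

lemma connectedin_punctured_rim:
  assumes "f \<in> skel 2" "x \<in> rim f"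
  shows "connectedin M (rim f - {x})"
proof -
  have f: "f \<in> C" "dm f = 2" using assms by (auto simp: skel_def)
  obtain z where z: "z \<in> unit_sphere 2" "x = cm f z"
    using assms(2) f by (auto simp: rim_def)
  have sub: "unit_sphere 2 \<subseteq> unit_cball 2" by (simp add: unit_cball_eq_Un)
  have "rim f - {x} = cm f ` (unit_sphere 2 - {z})"
    using inj_on_image_set_diff[OF cm_inj[OF f(1)], of "unit_sphere 2" "{z}"] f(2) sub z
    by (auto simp: rim_def)
  moreover have "connectedin (subtopology (Euclidean_space 2) (unit_cball 2)) (unit_sphere 2 - {z})"
    using connectedin_punctured_circle[OF z(1)] sub by (auto simp: connectedin_subtopology)
  ultimately show ?thesis
    using connectedin_continuous_map_image cm_cont[OF f(1)] f(2) by metis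
qed

lemma infinite_rim:
  assumes "f \<in> skel 2"
  shows "infinite (rim f)"
proof -
  have f: "f \<in> C" "dm f = 2" using assms by (auto simp: skel_def)
  have "inj_on (cm f) (unit_sphere 2)"
    using inj_on_subset[OF cm_inj[OF f(1)]] f(2) by (simp add: unit_cball_eq_Un)
  then show ?thesis
    using infinite_unit_sphere_2 f(2) by (auto simp: rim_def dest: finite_imageD)
qed

lemma finite_vertices: "finite (\<Union>(skel 0))"
  using finite_skel by (auto elim!: vertex_singleton)

lemma closedin_vertices: "U \<subseteq> skel 0 \<Longrightarrow> closedin M (\<Union>U)"
  using finite_skel[of 0] closedin_vertex by (intro closedin_Union) (auto intro: finite_subset)

text \<open>The rim is an infinite set, as an embedded circle, and the finitely many vertices cannot
  fill it.\<close>

lemma sides_nonempty: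
  assumes "f \<in> skel 2"
  shows "sides f \<noteq> {}"
  using rim_subset[OF assms] infinite_rim[OF assms] finite_vertices finite_subset by fastforce

text \<open>Otherwise an interior point of the edge would separate the circle \<open>rim f\<close>.\<close>

lemma other_side_at_end:
  assumes f: "f \<in> skel 2" and e: "e \<in> sides f" and u: "u \<in> ends e"
  shows "\<exists>e'\<in>sides f. e' \<noteq> e \<and> u \<in> ends e'"
proof (rule ccontr)
  assume "\<not> ?thesis"
  then have no: "u \<notin> ends e'" if "e' \<in> sides f" "e' \<noteq> e" for e'
    using that by blast
  have e1: "e \<in> skel 1" and erim: "e \<subseteq> rim f"
    using e by (auto simp: sides_def)
  obtain \<eta> :: "real \<Rightarrow> 'a" where \<eta>: "continuous_map (top_of_set {- 1..1}) M \<eta>" "inj_on \<eta> {- 1..1}"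
    "\<eta> ` {- 1<..<1} = e" "rim e = {\<eta> 1, \<eta> (- 1)}" "u = {\<eta> 1}"
    by (rule edge_param_end[OF e1 u])
  have fC: "f \<in> C" and eC: "e \<in> C" using f e1 skel_C by auto
  have u0: "u \<in> skel 0" using u by (simp add: ends_def)
  have \<eta>e: "\<eta> t \<in> e" if "t \<in> {- 1<..<1}" for t
    using that \<eta>(3) by blast
  have inj: "\<eta> s = \<eta> t \<longleftrightarrow> s = t" if "s \<in> {- 1..1}" "t \<in> {- 1..1}" for s t
    using inj_on_eq_iff[OF \<eta>(2) that] .
  have cl: "closedin M (\<eta> ` {a..b})" if "{a..b} \<subseteq> {- 1..1}" for a b :: real
  proof -
    have "compactin (top_of_set {- 1..1}) {a..b}"
      using that by (simp add: compactin_subtopology)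
    then have "compactin M (\<eta> ` {a..b})"
      using \<eta>(1) by (rule image_compactin)
    then show ?thesis using Hausdorff by (simp add: compactin_imp_closedin)
  qed
  \<comment> \<open>The circle is cut at the midpoint of \<open>e\<close>. \<open>A\<close> is the
    half of the edge ending at \<open>u\<close>, and \<open>B\<close> covers the rest of the rim; if
    no other side ended at \<open>u\<close>, these closed sets would share only the midpoint and so
    disconnect the punctured circle.\<close>
  let ?x = "\<eta> 0"
  define A where "A = \<eta> ` {0..1}"
  define B where "B = \<eta> ` {- 1..0} \<union> \<Union>(skel 0 - {u}) \<union> (\<Union>e'\<in>sides f - {e}. e' \<union> rim e')"
  have cA: "closedin M A"
    unfolding A_def by (rule cl) auto
  have "closedin M (\<Union>e'\<in>sides f - {e}. e' \<union> rim e')"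
    using finite_sides closedin_closed_cell[OF skel_C[OF sides_skel]] by (intro closedin_Union) auto
  moreover have "closedin M (\<eta> ` {- 1..0})" by (rule cl) auto
  moreover have "closedin M (\<Union>(skel 0 - {u}))" by (rule closedin_vertices) auto
  ultimately have cB: "closedin M B"
    unfolding B_def by (intro closedin_Un)
  have cover: "rim f - {?x} \<subseteq> A \<union> B"
  proof
    fix y assume y: "y \<in> rim f - {?x}"
    then consider v where "v \<in> skel 0" "y \<in> v" | e' where "e' \<in> sides f" "y \<in> e'"
      using rim_subset[OF f] by blast
    then show "y \<in> A \<union> B"
    proof cases
      case (1 v)
      show ?thesis
      proof (cases "v = u")
        case True
        then have "y = \<eta> 1" using 1 \<eta>(5) by simp
        then show ?thesis unfolding A_def by auto
      next
        case False
        then show ?thesis using 1 by (auto simp: B_def)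
      qed
    next
      case (2 e')
      show ?thesis
      proof (cases "e' = e")
        case True
        then obtain t where "t \<in> {- 1<..<1}" "y = \<eta> t" using 2 \<eta>(3) by blast
        then show ?thesis unfolding A_def B_def by (cases "0 \<le> t") auto
      next
        case False
        then show ?thesis using 2 by (auto simp: B_def)
      qed
    qed
  qed
  have disj: "y \<notin> B" if y: "y \<in> A" "y \<noteq> ?x" for y
  proof -
    obtain t where t: "t \<in> {0..1}" "y = \<eta> t" using y(1) by (auto simp: A_def)
    then have t0: "0 < t" using y(2) by (cases "t = 0") auto
    have "y \<notin> \<eta> ` {- 1..0}"
    proof
      assume "y \<in> \<eta> ` {- 1..0}"
      then obtain s where s: "y = \<eta> s" "s \<in> {- 1..0}" by (rule imageE)
      have "\<eta> t = \<eta> s" using t(2) s(1) by (rule subst)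
      then have "t = s" using inj[of t s] t(1) s(2) by simp
      then show False using t0 s(2) by simp
    qed
    moreover have "y \<notin> v" if v: "v \<in> skel 0" "v \<noteq> u" for v
    proof (cases "t = 1")
      case True
      then have "y \<in> u" using t \<eta>(5) by simp
      then show ?thesis using cell_disjoint[of u v] u0 v skel_C by blast
    next
      case False
      then have "y \<in> e" using \<eta>e[of t] t t0 by simp
      then show ?thesis using skel_Int[OF e1 v(1)] by auto
    qed
    note nv = this
    moreover have "y \<notin> e' \<union> rim e'" if e': "e' \<in> sides f - {e}" for e'
    proof -
      have e'1: "e' \<in> skel 1" using e' sides_skel by blast
      have ue: "u \<notin> ends e'" using no e' by blast
      have r: "y \<notin> rim e'"
      proof
        assume "y \<in> rim e'"
        then obtain v where "v \<in> ends e'" "y \<in> v" using ends_props(3)[OF e'1] by auto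
        then show False using nv[of v] ue ends_props(1)[OF e'1] by blast
      qed
      have "y \<notin> e'"
      proof (cases "t = 1")
        case True
        then have "y \<in> u" using t \<eta>(5) by simp
        then show ?thesis using skel_Int[OF u0 e'1] by auto
      next
        case False
        then have "y \<in> e" using \<eta>e[of t] t t0 by simp
        then show ?thesis using cell_disjoint[OF eC skel_C[OF e'1]] e' by blast
      qed
      then show ?thesis using r by simp
    qed
    ultimately show ?thesis unfolding B_def by auto
  qed
  have mem: "\<eta> t \<in> rim f - {?x}" if "t \<in> {- 1<..<1}" "t \<noteq> 0" for t
    using \<eta>e[OF that(1)] erim inj[of t 0] that by auto
  have "\<eta> (1/2) \<in> A \<inter> (rim f - {?x})" "\<eta> (- 1/2) \<in> B \<inter> (rim f - {?x})"
    using mem[of "1/2"] mem[of "- 1/2"] by (auto simp: A_def B_def)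
  then have ne: "A \<inter> (rim f - {?x}) \<noteq> {}" "B \<inter> (rim f - {?x}) \<noteq> {}"
    by blast+
  have int: "A \<inter> B \<inter> (rim f - {?x}) = {}"
    using disj by blast
  have "?x \<in> rim f" using \<eta>e[of 0] erim by auto
  from connectedin_punctured_rim[OF f this] show False
    unfolding connectedin_closedin using cA cB cover int ne by blast
qed

lemma card_sides_ge_2:
  assumes f: "f \<in> skel 2"
  shows "2 \<le> card (sides f)"
proof -
  obtain e where e: "e \<in> sides f" using sides_nonempty[OF f] by blast
  have "ends e \<noteq> {}" using ends_props(2)[OF sides_skel[OF e]] by auto
  then obtain u where u: "u \<in> ends e" by blast
  obtain e' where "e' \<in> sides f" "e' \<noteq> e" using other_side_at_end[OF f e u] by blast
  then have "card {e, e'} \<le> card (sides f)"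
    using e finite_sides by (intro card_mono) auto
  then show ?thesis using \<open>e' \<noteq> e\<close> by simp
qed

text \<open>At each end of one side another side must arrive, and a digon has only one other side to
  offer.\<close>

lemma digon_ends_eq:
  assumes f: "f \<in> skel 2" and card: "card (sides f) = 2" and e: "e \<in> sides f" "e' \<in> sides f"
  shows "ends e = ends e'"
proof -
  obtain a b where ab: "sides f = {a, b}" "a \<noteq> b"
    using card by (auto simp: card_2_iff)
  have sub: "ends x \<subseteq> ends y" if "sides f = {x, y}" for x y
  proof
    fix u assume u: "u \<in> ends x"
    have x: "x \<in> sides f" using that by simp
    obtain e' where "e' \<in> sides f" "e' \<noteq> x" "u \<in> ends e'" using other_side_at_end[OF f x u] by blast
    then show "u \<in> ends y" using that by auto
  qed
  have "ends a = ends b"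
    using sub[of a b] sub[of b a] ab by (auto simp: insert_commute)
  then show ?thesis using e ab by auto
qed

text \<open>Two discs with a common boundary arc are glued along it, the second one after inversion in the
  unit circle; the result is an open planar set to which invariance of domain applies.\<close>

lemma openin_edge_star:
  assumes e: "e \<in> skel 1" and f: "f \<in> skel 2" "e \<in> sides f" and g: "g \<in> skel 2" "e \<in> sides g" and "f \<noteq> g"
  shows "openin M (f \<union> e \<union> g)"
proof -
  have C: "e \<in> C" "f \<in> C" "g \<in> C" and dm: "dm f = 2" "dm g = 2"
    using e f g by (auto simp: skel_def)
  have er: "e \<subseteq> rim f" "e \<subseteq> rim g" using f g by (auto simp: sides_def)
  let ?E = "Euclidean_space 2" and ?D = "subtopology (Euclidean_space 2) (unit_cball 2)"
  have fc: "continuous_map ?D M (cm f)" and gc: "continuous_map ?D M (cm g)"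
    using cm_cont[OF C(2)] cm_cont[OF C(3)] dm by simp_all
  have fi: "inj_on (cm f) (unit_cball 2)" and gi: "inj_on (cm g) (unit_cball 2)"
    using cm_inj[OF C(2)] cm_inj[OF C(3)] dm by simp_all
  have fb: "cm f ` unit_ball 2 = f" and gb: "cm g ` unit_ball 2 = g"
    using cm_ball[OF C(2)] cm_ball[OF C(3)] dm by simp_all
  have fr: "cm f ` unit_sphere 2 = rim f" and gr: "cm g ` unit_sphere 2 = rim g"
    using dm by (simp_all add: rim_def)
  have gcl: "cm g ` unit_cball 2 = g \<union> rim g" using closed_cell[OF C(3)] dm by simp
  have "homeomorphic_map ?D (subtopology M (g \<union> rim g)) (cm g)"
    using closed_cell_embedding(1)[OF Hausdorff gc gi] unfolding embedding_map_def topspace_unit_cball gcl .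
  then obtain \<psi> where \<psi>: "homeomorphic_maps ?D (subtopology M (g \<union> rim g)) (cm g) \<psi>"
    using homeomorphic_map_maps by blast
  have topg: "topspace (subtopology M (g \<union> rim g)) = g \<union> rim g"
    using C(3) Union_C rim_subset_topspace[OF C(3)] by auto
  have \<psi>c: "continuous_map (subtopology M (g \<union> rim g)) ?E \<psi>"
    using \<psi> continuous_map_into_fulltopology unfolding homeomorphic_maps_def by blast
  have \<psi>z: "\<psi> (cm g z) = z" if "z \<in> unit_cball 2" for z
    using \<psi> that unfolding homeomorphic_maps_def topspace_unit_cball by blast
  have \<psi>s: "\<psi> y \<in> unit_sphere 2 \<and> cm g (\<psi> y) = y" if y: "y \<in> rim g" for y
  proof -
    obtain z where "y = cm g z" "z \<in> unit_sphere 2"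
      using y unfolding gr[symmetric] by (rule imageE)
    then show ?thesis using \<psi>z[of z] by (simp add: unit_cball_eq_Un)
  qed
  \<comment> \<open>Radial projection of the punctured plane onto the unit circle.\<close>
  define \<nu> where "\<nu> = (\<lambda>z::nat \<Rightarrow> real. \<lambda>i. (1 / enorm 2 z) * z i)"
  define E0 where "E0 = subtopology ?E (topspace ?E - {\<lambda>_. 0})"
  have topE0: "topspace E0 = topspace ?E - {\<lambda>_. 0}" by (auto simp: E0_def)
  have pos: "0 < enorm 2 z" if "z \<in> topspace E0" for z
    using that enorm_eq_0[of z 2] enorm_nonneg[of 2 z] unfolding topE0 by (auto simp: less_le)
  have idE0: "continuous_map E0 ?E (\<lambda>z. z)"
    unfolding E0_def by (simp add: continuous_map_from_subtopology)
  have \<nu>s: "\<nu> z \<in> unit_sphere 2" if "z \<in> topspace E0" for z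
    using pos[OF that] that scale_in_Euclidean_space[of z 2 "1 / enorm 2 z"] enorm_scale[of 2 "1 / enorm 2 z" z]
    unfolding topE0 by (auto simp: unit_sphere_iff \<nu>_def)
  have \<nu>id: "\<nu> z = z" if "enorm 2 z = 1" for z
    using that by (simp add: \<nu>_def)
  have \<nu>E: "continuous_map E0 ?E \<nu>"
    unfolding \<nu>_def by (intro continuous_map_scale idE0 continuous_intros continuous_map_enorm[OF idE0])
      (use pos in force)+
  then have "continuous_map E0 ?D \<nu>"
    unfolding continuous_map_in_subtopology using \<nu>s by (auto simp: unit_cball_eq_Un)
  then have f\<nu>: "continuous_map E0 M (\<lambda>z. cm f (\<nu> z))"
    using continuous_map_compose[OF _ fc] by (force simp: o_def)
  have f\<nu>r: "cm f (\<nu> z) \<in> rim f" if "z \<in> topspace E0" for z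
    unfolding fr[symmetric] using \<nu>s[OF that] by (rule imageI)
  have "cm f (\<nu> z) \<in> \<Union>(skel 0) \<union> \<Union>(skel 1)" if "z \<in> topspace E0" for z
    using subsetD[OF rim_2_cell[OF f(1)] f\<nu>r[OF that]] .
  with f\<nu> have f\<nu>1: "continuous_map E0 (subtopology M (\<Union>(skel 0) \<union> \<Union>(skel 1))) (\<lambda>z. cm f (\<nu> z))"
    unfolding continuous_map_in_subtopology by (intro conjI Pi_I)
  \<comment> \<open>The open sector of directions in which the rim of \<open>f\<close> runs through
    \<open>e\<close>; it extends across the unit circle.\<close>
  define W where "W = {z \<in> topspace E0. cm f (\<nu> z) \<in> e}"
  have "openin E0 W"
    unfolding W_def by (rule openin_continuous_map_preimage[OF f\<nu>1 openin_1_skeleton_edge[OF e]])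
  moreover have "openin ?E (topspace ?E - {\<lambda>_. 0})"
    using Hausdorff_imp_t1_space[OF Hausdorff_Euclidean_space[of 2]]
    by (auto simp: t1_space_closedin_singleton)
  ultimately have opW: "openin ?E W"
    unfolding E0_def by (rule openin_trans_full)
  have WE0: "W \<subseteq> topspace E0" by (auto simp: W_def)
  have WE: "W \<subseteq> topspace ?E" using WE0 topE0 by blast
  let ?W = "subtopology ?E W"
  have topW: "topspace ?W = W" using WE by (auto simp: topspace_subtopology)
  have W_E0: "continuous_map ?W E0 (\<lambda>z. z)"
    unfolding E0_def using WE0 topE0 by (auto simp: continuous_map_in_subtopology continuous_map_from_subtopology topW)
  \<comment> \<open>\<open>q\<close> converts a boundary direction of the disc of \<open>f\<close>
    into the boundary parameter of the same point for \<open>g\<close>. \<open>p\<close> takes this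
    direction with the reciprocal radius, so the part of the sector beyond the circle enters the
    disc of \<open>g\<close>. On the circle both branches of \<Psi> give the same point of
    \<open>e\<close>.\<close>
  define q where "q = (\<lambda>z. \<psi> (cm f (\<nu> z)))"
  define p where "p = (\<lambda>z::nat \<Rightarrow> real. \<lambda>i. (1 / enorm 2 z) * q z i)"
  define \<Psi> where "\<Psi> = (\<lambda>z. if enorm 2 z \<le> 1 then cm f z else cm g (p z))"
  have qs: "q z \<in> unit_sphere 2" "cm g (q z) = cm f (\<nu> z)" if "z \<in> W" for z
    using \<psi>s[of "cm f (\<nu> z)"] er(2) that by (auto simp: q_def W_def)
  have pn: "enorm 2 (p z) = 1 / enorm 2 z" "p z \<in> topspace ?E" if "z \<in> W" for z
    using qs(1)[OF that] enorm_scale[of 2 "1 / enorm 2 z" "q z"] scale_in_Euclidean_space[of "q z" 2 "1 / enorm 2 z"]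
    by (simp_all add: p_def unit_sphere_iff)
  have posW: "0 < enorm 2 z" if "z \<in> W" for z
    using pos WE0 that by blast
  have nW: "continuous_map ?W euclideanreal (enorm 2)"
    using continuous_map_enorm[of ?W 2 "\<lambda>z. z" 2] by (simp add: continuous_map_from_subtopology)
  have "continuous_map ?W (subtopology M (g \<union> rim g)) (\<lambda>z. cm f (\<nu> z))"
    unfolding continuous_map_in_subtopology
  proof
    show "continuous_map ?W M (\<lambda>z. cm f (\<nu> z))"
      using continuous_map_compose[OF W_E0 f\<nu>] by (simp add: o_def)
    show "(\<lambda>z. cm f (\<nu> z)) \<in> topspace ?W \<rightarrow> g \<union> rim g"
      unfolding topW using er(2) by (auto simp: W_def)
  qed
  then have "continuous_map ?W ?E q"
    unfolding q_def using continuous_map_compose[OF _ \<psi>c] by (force simp: o_def)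
  then have pc: "continuous_map ?W ?E p"
    unfolding p_def using posW by (intro continuous_map_scale continuous_intros nW) (force simp: topW)+
  have \<Psi>c: "continuous_map ?W M \<Psi>"
    unfolding \<Psi>_def
  proof (rule continuous_map_cases_le[OF nW])
    show "continuous_map (subtopology ?W {z. z \<in> topspace ?W \<and> enorm 2 z \<le> 1}) M (cm f)"
    proof -
      have "W \<inter> {z. z \<in> topspace ?W \<and> enorm 2 z \<le> 1} \<subseteq> unit_cball 2"
        using WE by (auto simp: unit_cball_iff)
      then show ?thesis
        unfolding subtopology_subtopology by (rule continuous_map_from_subtopology_mono[OF fc])
    qed
    let ?X = "subtopology ?W {z. z \<in> topspace ?W \<and> 1 \<le> enorm 2 z}"
    have "continuous_map ?X ?E p" using pc by (rule continuous_map_from_subtopology)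
    moreover have "p z \<in> unit_cball 2" if "z \<in> topspace ?X" for z
    proof -
      have "z \<in> W" "1 \<le> enorm 2 z" using that topW by auto
      then show ?thesis using pn[of z] by (simp add: unit_cball_iff)
    qed
    ultimately have "continuous_map ?X ?D p"
      unfolding continuous_map_in_subtopology by (intro conjI Pi_I)
    from continuous_map_compose[OF this gc]
    show "continuous_map ?X M (\<lambda>z. cm g (p z))" by (simp add: o_def)
    show "cm f z = cm g (p z)" if "z \<in> topspace ?W" "enorm 2 z = 1" for z
      using that qs(2)[of z] \<nu>id[of z] unfolding topW by (simp add: p_def)
  qed simp
  have inner: "\<Psi> z \<in> f \<union> e" "z \<in> unit_cball 2" if "z \<in> W" "enorm 2 z \<le> 1" for z
  proof -
    show "z \<in> unit_cball 2" using that WE by (auto simp: unit_cball_iff)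
    show "\<Psi> z \<in> f \<union> e"
    proof (cases "enorm 2 z = 1")
      case True
      then show ?thesis using that(1) \<nu>id[OF True] by (simp add: \<Psi>_def W_def)
    next
      case False
      then have "z \<in> unit_ball 2" using that WE by (auto simp: unit_ball_iff)
      then show ?thesis using that(2) fb by (auto simp: \<Psi>_def)
    qed
  qed
  have outer: "\<Psi> z \<in> g" "p z \<in> unit_cball 2" if "z \<in> W" "\<not> enorm 2 z \<le> 1" for z
  proof -
    have "p z \<in> unit_ball 2" using pn[OF that(1)] that(2) by (simp add: unit_ball_iff)
    then show "\<Psi> z \<in> g" "p z \<in> unit_cball 2"
      using that(2) gb by (auto simp: \<Psi>_def unit_cball_eq_Un)
  qed
  have disj: "(f \<union> e) \<inter> g = {}"
    using cell_disjoint[OF C(2,3) \<open>f \<noteq> g\<close>] skel_Int[OF e g(1)] by auto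
  \<comment> \<open>The inner part goes to \<open>f \<union> e\<close> and the outer part to
    \<open>g\<close>, so two points with the same image lie on the same part. On the outer part
    equal values of \<open>p\<close> give equal norms, then equal boundary points, then equal
    directions.\<close>
  have "inj_on \<Psi> W"
  proof (rule inj_onI)
    fix z w assume zw: "z \<in> W" "w \<in> W" "\<Psi> z = \<Psi> w"
    consider "enorm 2 z \<le> 1" "enorm 2 w \<le> 1" | "\<not> enorm 2 z \<le> 1" "\<not> enorm 2 w \<le> 1"
      using inner(1)[of z] inner(1)[of w] outer(1)[of z] outer(1)[of w] zw disj by fastforce
    then show "z = w"
    proof cases
      case 1
      then show ?thesis
        using zw inj_onD[OF fi] inner(2) by (simp add: \<Psi>_def)
    next
      case 2
      then have pp: "p z = p w"
        using zw inj_onD[OF gi] outer(2) by (simp add: \<Psi>_def)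
      then have n: "enorm 2 z = enorm 2 w"
        using pn(1)[OF zw(1)] pn(1)[OF zw(2)] by simp
      have "q z i = q w i" for i
        using fun_cong[OF pp, of i] n posW[OF zw(2)] by (simp add: p_def)
      then have "cm f (\<nu> z) = cm f (\<nu> w)"
        using qs(2)[OF zw(1)] qs(2)[OF zw(2)] by (metis ext)
      moreover have "\<nu> z \<in> unit_cball 2" "\<nu> w \<in> unit_cball 2"
        using \<nu>s zw WE0 by (auto simp: unit_cball_eq_Un)
      ultimately have \<nu>\<nu>: "\<nu> z = \<nu> w"
        using inj_onD[OF fi] by blast
      have "z i = w i" for i
        using fun_cong[OF \<nu>\<nu>, of i] n posW[OF zw(2)] by (simp add: \<nu>_def)
      then show ?thesis by blast
    qed
  qed
  then have "openin M (\<Psi> ` W)"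
    by (rule surface_invariance_of_domain[OF surface opW \<Psi>c])
  \<comment> \<open>The sector covers all of \<open>e\<close> but only pieces of the two faces; the
    faces, open by themselves, supply the remainder.\<close>
  moreover have "f \<union> e \<union> g = f \<union> g \<union> \<Psi> ` W"
  proof -
    have "\<Psi> ` W \<subseteq> f \<union> e \<union> g"
      using inner(1) outer(1) by blast
    moreover have "y \<in> \<Psi> ` W" if y: "y \<in> e" for y
    proof -
      obtain z where z: "y = cm f z" "z \<in> unit_sphere 2"
        using subsetD[OF er(1) y] unfolding fr[symmetric] by (rule imageE)
      then have "enorm 2 z = 1" "z \<in> topspace ?E" by (auto simp: unit_sphere_iff)
      then have "z \<in> W" "\<Psi> z = y"
        using z(1) y \<nu>id[of z] enorm_zero[of 2] unfolding W_def topE0 by (auto simp: \<Psi>_def)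
      then show ?thesis by blast
    qed
    ultimately show ?thesis by blast
  qed
  ultimately show ?thesis
    using openin_2_cell[OF f(1)] openin_2_cell[OF g(1)] by (simp add: openin_Un)
qed

text \<open>Two faces along \<open>e\<close> already form an open set with it, and a third face
  having points of \<open>e\<close> in its closure would have to meet that set, against disjointness
  of cells.\<close>

lemma card_faces_at_edge:
  assumes e: "e \<in> skel 1"
  shows "card {f \<in> skel 2. e \<in> sides f} \<le> 2"
proof (rule ccontr)
  assume "\<not> card {f \<in> skel 2. e \<in> sides f} \<le> 2"
  then have "3 \<le> card {f \<in> skel 2. e \<in> sides f}" by simp
  then obtain T where T: "T \<subseteq> {f \<in> skel 2. e \<in> sides f}" "card T = 3"
    by (rule obtain_subset_with_card_n)
  then obtain f g h where fgh: "T = {f, g, h}" "f \<noteq> g" "g \<noteq> h" "f \<noteq> h"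
    by (auto simp: card_3_iff)
  then have 1: "f \<in> skel 2" "e \<in> sides f" "g \<in> skel 2" "e \<in> sides g" "h \<in> skel 2" "e \<in> sides h"
    using T(1) by auto
  have op: "openin M (f \<union> e \<union> g)"
    using openin_edge_star[OF e 1(1-4)] fgh by simp
  obtain x where x: "x \<in> e" using cell_nonempty[OF skel_C[OF e]] by blast
  then have "x \<in> h \<union> rim h" using 1(6) by (auto simp: sides_def)
  then have "(f \<union> e \<union> g) \<inter> h \<noteq> {}"
    using open_meets_cell[OF skel_C[OF 1(5)] op, of x] x by simp
  moreover have "f \<inter> h = {}" "g \<inter> h = {}"
    using cell_disjoint 1 fgh skel_C by metis+
  moreover have "e \<inter> h = {}"
    using skel_Int[OF e 1(5)] by simp
  ultimately show False by blast
qed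

section \<open>Digons between two vertices\<close>

definition digons :: "'a set set \<Rightarrow> 'a set set" where
  "digons s = {f \<in> skel 2. card (sides f) = 2 \<and> (\<exists>e\<in>sides f. ends e = s)}"

definition parallels :: "'a set set \<Rightarrow> 'a set set" where
  "parallels s = {e \<in> skel 1. ends e = s}"

text \<open>Both sides of a digon have the same ends, so asking for one side in
  \<open>digons\<close> determines the parallel class of both.\<close>

lemma sides_digon:
  assumes "f \<in> digons s"
  shows "sides f \<subseteq> parallels s"
proof
  fix x assume x: "x \<in> sides f"
  obtain e where e: "f \<in> skel 2" "card (sides f) = 2" "e \<in> sides f" "ends e = s"
    using assms by (auto simp: digons_def)
  have "ends x = s"
    using digon_ends_eq[OF e(1,2) x e(3)] e(4) by simp
  then show "x \<in> parallels s"
    using sides_skel[OF x] by (simp add: parallels_def)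
qed

text \<open>The edges and digons between two vertices form an open set that is closed up to vertices, so near
  \<open>u\<close> they fill a punctured disc.\<close>

lemma parallels_surrounded_by_digons:
  assumes full: "\<And>e. e \<in> parallels s \<Longrightarrow> card {f \<in> digons s. e \<in> sides f} = 2"
    and e: "e \<in> parallels s" and u: "u \<in> s" and e': "e' \<in> skel 1" "u \<in> ends e'"
  shows "ends e' = s"
proof -
  define S where "S = \<Union>(parallels s) \<union> \<Union>(digons s)"
  have e1: "e \<in> skel 1" and ue: "u \<in> ends e" using e u by (auto simp: parallels_def)
  have u0: "u \<in> skel 0" using ue by (simp add: ends_def)
  obtain x where x: "u = {x}" "x \<in> topspace M" by (rule vertex_singleton[OF u0])
  have dig2: "f \<in> skel 2" if "f \<in> digons s" for f using that by (simp add: digons_def)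
  have par1: "c \<in> skel 1" if "c \<in> parallels s" for c using that by (simp add: parallels_def)
  have opS: "openin M S"
  proof (subst openin_subopen, intro ballI)
    fix y assume "y \<in> S"
    then consider f where "f \<in> digons s" "y \<in> f" | c where "c \<in> parallels s" "y \<in> c"
      by (auto simp: S_def)
    then show "\<exists>T. openin M T \<and> y \<in> T \<and> T \<subseteq> S"
    proof cases
      case (1 f)
      then show ?thesis
        using openin_2_cell[OF dig2[OF 1(1)]] by (intro exI[of _ f]) (auto simp: S_def)
    next
      case (2 c)
      \<comment> \<open>At a point of an edge \<open>c\<close>, the star formed with the two digons
        along \<open>c\<close> is an open neighbourhood inside \<open>S\<close>.\<close>
      obtain f g where fg: "{f \<in> digons s. c \<in> sides f} = {f, g}" "f \<noteq> g"
        using full[OF 2(1)] by (auto simp: card_2_iff)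
      then have m: "f \<in> digons s" "c \<in> sides f" "g \<in> digons s" "c \<in> sides g" by auto
      have "openin M (f \<union> c \<union> g)"
        by (rule openin_edge_star[OF par1[OF 2(1)] dig2[OF m(1)] m(2) dig2[OF m(3)] m(4) fg(2)])
      then show ?thesis
        using 2 m by (intro exI[of _ "f \<union> c \<union> g"]) (auto simp: S_def)
    qed
  qed
  have fin: "finite (parallels s)" "finite (digons s)"
    using finite_skel by (simp_all add: parallels_def digons_def)
  \<comment> \<open>Adjoining the vertices makes \<open>S\<close> closed: the rims of its edges and
    digons consist of vertices and of edges of the same class.\<close>
  define T where "T = \<Union>(skel 0) \<union> S"
  have "T = \<Union>(skel 0) \<union> (\<Union>c\<in>parallels s. c \<union> rim c) \<union> (\<Union>f\<in>digons s. f \<union> rim f)"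
  proof -
    have 1: "c \<union> rim c \<subseteq> T" if c: "c \<in> parallels s" for c
    proof -
      have "rim c \<subseteq> \<Union>(skel 0)"
        unfolding ends_props(3)[OF par1[OF c]] by (rule Union_mono[OF ends_props(1)[OF par1[OF c]]])
      then show ?thesis using c unfolding T_def S_def by blast
    qed
    have 2: "f \<union> rim f \<subseteq> T" if f: "f \<in> digons s" for f
    proof -
      have "rim f \<subseteq> \<Union>(skel 0) \<union> \<Union>(parallels s)"
        using rim_subset[OF dig2[OF f]] Union_mono[OF sides_digon[OF f]] by (rule subset_trans[OF _ Un_mono[OF subset_refl]])
      then show ?thesis using f unfolding T_def S_def by blast
    qed
    have "\<Union>(skel 0) \<subseteq> T" unfolding T_def by blast
    then have "\<Union>(skel 0) \<union> (\<Union>c\<in>parallels s. c \<union> rim c) \<union> (\<Union>f\<in>digons s. f \<union> rim f) \<subseteq> T"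
      using UN_least[of "parallels s" "\<lambda>c. c \<union> rim c" T, OF 1] UN_least[of "digons s" "\<lambda>f. f \<union> rim f" T, OF 2]
      by (simp only: Un_subset_iff)
    moreover have "T \<subseteq> \<Union>(skel 0) \<union> (\<Union>c\<in>parallels s. c \<union> rim c) \<union> (\<Union>f\<in>digons s. f \<union> rim f)"
      unfolding T_def S_def by blast
    ultimately show ?thesis by (intro equalityI)
  qed
  moreover have "closedin M (\<Union>c\<in>parallels s. c \<union> rim c)" "closedin M (\<Union>f\<in>digons s. f \<union> rim f)"
    using fin closedin_closed_cell[OF skel_C[OF par1]] closedin_closed_cell[OF skel_C[OF dig2]]
    by (auto intro!: closedin_Union)
  ultimately have clT: "closedin M T"
    using closedin_vertices[OF subset_refl] by (simp only: closedin_Un)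
  \<comment> \<open>With all other vertices removed, a neighbourhood of \<open>x\<close> inside
    \<open>A\<close> contains no vertex point except \<open>x\<close>.\<close>
  define A where "A = topspace M - \<Union>(skel 0 - {u})"
  have "openin M A"
    unfolding A_def by (intro openin_diff openin_topspace closedin_vertices) auto
  moreover have "x \<in> A"
  proof -
    have "x \<notin> v" if "v \<in> skel 0 - {u}" for v
      using cell_disjoint[of u v] x(1) that u0 skel_C by fastforce
    then show ?thesis using x(2) by (auto simp: A_def)
  qed
  ultimately obtain B where B: "openin M B" "x \<in> B" "B \<subseteq> A" "connectedin M (B - {x})"
    by (rule punctured_neighbourhood_connected[OF surface])
  have noV: "y \<notin> \<Union>(skel 0)" if "y \<in> B - {x}" for y
    using that B(3) x(1) by (auto simp: A_def)
  have meets: "(B - {x}) \<inter> c \<noteq> {}" if c: "c \<in> skel 1" "u \<in> ends c" for c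
  proof -
    have "x \<in> rim c" using c(2) x(1) by (auto simp: ends_def)
    then have "B \<inter> c \<noteq> {}" using open_meets_cell[OF skel_C[OF c(1)] B(1,2)] by blast
    moreover have "x \<notin> c" using skel_Int[OF c(1) u0] x(1) by auto
    ultimately show ?thesis by blast
  qed
  have opT: "openin M (topspace M - T)"
    using clT by blast
  \<comment> \<open>Free of vertices, the punctured neighbourhood is covered by the disjoint open
    sets \<open>S\<close> and the complement of \<open>T\<close>. It is connected and meets
    \<open>S\<close> along \<open>e\<close>, so it lies in \<open>S\<close>.\<close>
  have "B - {x} \<subseteq> S"
  proof (rule ccontr)
    assume "\<not> B - {x} \<subseteq> S"
    then have "(topspace M - T) \<inter> (B - {x}) \<noteq> {}"
      using noV openin_subset[OF B(1)] unfolding T_def by blast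
    moreover have "S \<inter> (B - {x}) \<noteq> {}"
      using meets[OF e1 ue] e unfolding S_def by blast
    moreover have "B - {x} \<subseteq> S \<union> (topspace M - T)"
      using noV openin_subset[OF B(1)] unfolding T_def by blast
    moreover have "S \<inter> (topspace M - T) \<inter> (B - {x}) = {}"
      unfolding T_def by blast
    ultimately show False
      using B(4) opS opT unfolding connectedin by blast
  qed
  then obtain y where y: "y \<in> e'" "y \<in> S"
    using meets[OF e'] by blast
  then consider c where "c \<in> parallels s" "y \<in> c" | f where "f \<in> digons s" "y \<in> f"
    by (auto simp: S_def)
  then show ?thesis
  proof cases
    case (1 c)
    then have "c = e'"
      using cell_eqI[OF skel_C[OF par1] skel_C[OF e'(1)]] y(1) by blast
    then show ?thesis using 1 by (simp add: parallels_def)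
  next
    case (2 f)
    then show ?thesis using skel_Int[OF e'(1) dig2[OF 2(1)]] y(1) by auto
  qed
qed

subsection \<open>Counting\<close>

definition edges :: "'a set set set" where
  "edges = ends ` skel 1"

lemma finite_edges: "finite edges"
  using finite_skel by (simp add: edges_def)

lemma finite_parallels: "finite (parallels s)" and finite_digons: "finite (digons s)"
  using finite_skel by (simp_all add: parallels_def digons_def)

lemma edges_props: "s \<in> edges \<Longrightarrow> s \<subseteq> skel 0 \<and> card s = 2"
  using ends_props by (auto simp: edges_def)

text \<open>Ensures that the minimum in \<open>min_degree\<close> is taken over a nonempty
  set.\<close>

lemma vertices_nonempty: "skel 0 \<noteq> {}"
proof -
  have "C \<noteq> {}"
    using surface unfolding closed_surface_def Union_C[symmetric] by blast
  then consider "skel 0 \<noteq> {}" | e where "e \<in> skel 1" | f where "f \<in> skel 2"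
    using C_eq by blast
  then show ?thesis
  proof cases
    case (2 e)
    then show ?thesis using ends_props[OF 2] by auto
  next
    case (3 f)
    then obtain e where "e \<in> skel 1" using sides_nonempty sides_skel by blast
    then show ?thesis using ends_props by fastforce
  qed
qed

text \<open>Incidences between digons and edges of one class are counted twice: a digon contributes
  exactly two, an edge at most two. Equal numbers therefore force every edge to attain two, which is
  the hypothesis of \<open>parallels_surrounded_by_digons\<close>.\<close>

lemma card_digons_le:
  "card (digons s) \<le> card (parallels s)"
  "card (digons s) = card (parallels s) \<Longrightarrow> e \<in> parallels s \<Longrightarrow> card {f \<in> digons s. e \<in> sides f} = 2"
proof -
  have "(\<Sum>f\<in>digons s. card {e \<in> parallels s. e \<in> sides f})
      = (\<Sum>e\<in>parallels s. card {f \<in> digons s. e \<in> sides f})"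
    by (rule sum_multicount_gen) (simp_all add: finite_parallels finite_digons)
  moreover have "card {e \<in> parallels s. e \<in> sides f} = 2" if "f \<in> digons s" for f
  proof -
    have "{e \<in> parallels s. e \<in> sides f} = sides f" using sides_digon[OF that] by blast
    then show ?thesis using that by (simp add: digons_def)
  qed
  ultimately have eq: "2 * card (digons s) = (\<Sum>e\<in>parallels s. card {f \<in> digons s. e \<in> sides f})"
    by simp
  have le: "card {f \<in> digons s. e \<in> sides f} \<le> 2" if "e \<in> parallels s" for e
  proof -
    have "card {f \<in> digons s. e \<in> sides f} \<le> card {f \<in> skel 2. e \<in> sides f}"
      using finite_skel by (intro card_mono) (auto simp: digons_def)
    also have "\<dots> \<le> 2" using card_faces_at_edge that by (simp add: parallels_def)
    finally show ?thesis .
  qed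
  have "(\<Sum>e\<in>parallels s. card {f \<in> digons s. e \<in> sides f}) \<le> (\<Sum>e\<in>parallels s. 2)"
    using le by (rule sum_mono)
  then show "card (digons s) \<le> card (parallels s)"
    using eq by simp
  show "card {f \<in> digons s. e \<in> sides f} = 2" if "card (digons s) = card (parallels s)" "e \<in> parallels s"
  proof (rule ccontr)
    assume "card {f \<in> digons s. e \<in> sides f} \<noteq> 2"
    then have "card {f \<in> digons s. e \<in> sides f} < 2" using le[OF that(2)] by simp
    then have "(\<Sum>e\<in>parallels s. card {f \<in> digons s. e \<in> sides f}) < (\<Sum>e\<in>parallels s. 2)"
      using le that(2) finite_parallels by (intro sum_strict_mono_ex1) auto
    then show False using eq that(1) by simp
  qed
qed

lemma card_edges_le:
  assumes less: "\<And>s. s \<in> edges \<Longrightarrow> card (digons s) < card (parallels s)"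
  shows "int (card edges) \<le> 3 * int (card (skel 0)) - 3 * euler_characteristic M"
proof -
  let ?D = "{f \<in> skel 2. card (sides f) = 2}"
  have "?D \<subseteq> (\<Union>s\<in>edges. digons s)"
  proof
    fix f assume f: "f \<in> ?D"
    then obtain e where e: "e \<in> sides f" using sides_nonempty by blast
    then have "f \<in> digons (ends e)" using f by (auto simp: digons_def)
    then show "f \<in> (\<Union>s\<in>edges. digons s)"
      using sides_skel[OF e] by (auto simp: edges_def)
  qed
  then have "card ?D \<le> card (\<Union>s\<in>edges. digons s)"
    using finite_edges finite_digons by (intro card_mono) auto
  also have "\<dots> \<le> (\<Sum>s\<in>edges. card (digons s))"
    by (rule card_UN_le[OF finite_edges])
  \<comment> \<open>The strict inequality in each class leaves room for a \<open>+ 1\<close>, and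
    these units add up to the number of edges of the simple graph.\<close>
  finally have "card ?D + card edges \<le> (\<Sum>s\<in>edges. card (digons s) + 1)"
    by (simp add: sum.distrib)
  also have "\<dots> \<le> (\<Sum>s\<in>edges. card (parallels s))"
  proof (rule sum_mono)
    show "card (digons s) + 1 \<le> card (parallels s)" if "s \<in> edges" for s
      using less[OF that] by linarith
  qed
  also have "\<dots> = card (skel 1)"
    using sum.image_gen[OF finite_skel, of "\<lambda>_. 1::nat" 1 ends] by (simp add: edges_def parallels_def)
  finally have D: "card ?D + card edges \<le> card (skel 1)" .
  have "(\<Sum>f\<in>skel 2. card {e \<in> skel 1. e \<in> sides f}) = (\<Sum>e\<in>skel 1. card {f \<in> skel 2. e \<in> sides f})"
    by (rule sum_multicount_gen) (simp_all add: finite_skel)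
  also have "\<dots> \<le> (\<Sum>e\<in>skel 1. 2)"
    using card_faces_at_edge by (intro sum_mono)
  finally have F: "(\<Sum>f\<in>skel 2. card {e \<in> skel 1. e \<in> sides f}) \<le> 2 * card (skel 1)"
    by simp
  \<comment> \<open>Every face accounts for three sides once a digon is credited with one
    extra.\<close>
  have "(\<Sum>f\<in>skel 2. 3) \<le> (\<Sum>f\<in>skel 2. card {e \<in> skel 1. e \<in> sides f} + (if card (sides f) = 2 then 1 else 0))"
  proof (rule sum_mono)
    fix f assume f: "f \<in> skel 2"
    have "{e \<in> skel 1. e \<in> sides f} = sides f" using sides_skel by blast
    then show "3 \<le> card {e \<in> skel 1. e \<in> sides f} + (if card (sides f) = 2 then 1 else 0)"
      using card_sides_ge_2[OF f] by auto
  qed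
  also have "\<dots> = (\<Sum>f\<in>skel 2. card {e \<in> skel 1. e \<in> sides f}) + card ?D"
    using finite_skel by (simp add: sum.distrib sum.If_cases Int_def)
  finally have "3 * card (skel 2) \<le> 2 * card (skel 1) + card ?D"
    using F by simp
  then show ?thesis
    using D by (simp add: euler_characteristic_eq)
qed

lemma degree_one_vertex:
  assumes s: "s \<in> edges" and eq: "card (digons s) = card (parallels s)"
  obtains v where "v \<in> skel 0" "card {t \<in> edges. v \<in> t} \<le> 1"
proof -
  obtain e where e: "e \<in> parallels s"
    using s by (auto simp: edges_def parallels_def)
  obtain u where u: "u \<in> s"
    using edges_props[OF s] by fastforce
  have "{t \<in> edges. u \<in> t} \<subseteq> {s}"
    using parallels_surrounded_by_digons[OF card_digons_le(2)[OF eq] e u] by (auto simp: edges_def)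
  then have "card {t \<in> edges. u \<in> t} \<le> card {s}"
    by (intro card_mono) auto
  then show thesis
    using that[of u] u edges_props[OF s] by auto
qed

lemma sum_degrees: "(\<Sum>v\<in>skel 0. card {t \<in> edges. v \<in> t}) = 2 * card edges"
proof -
  have "card {v \<in> skel 0. v \<in> t} = 2" if "t \<in> edges" for t
  proof -
    have "{v \<in> skel 0. v \<in> t} = t" using edges_props[OF that] by blast
    then show ?thesis using edges_props[OF that] by simp
  qed
  then have "(\<Sum>v\<in>skel 0. card {t \<in> edges. v \<in> t}) = (\<Sum>t\<in>edges. 2)"
    by (intro sum_multicount_gen) (simp_all add: finite_skel finite_edges)
  then show ?thesis by simp
qed

text \<open>In a simple graph an edge at \<open>v\<close> is determined by its other end, which is a
  vertex different from \<open>v\<close>.\<close>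

lemma degree_less:
  assumes v: "v \<in> skel 0"
  shows "card {t \<in> edges. v \<in> t} < card (skel 0)"
proof -
  have "{t \<in> edges. v \<in> t} \<subseteq> (\<lambda>w. {v, w}) ` (skel 0 - {v})"
  proof
    fix t assume t: "t \<in> {t \<in> edges. v \<in> t}"
    then have t2: "t \<subseteq> skel 0" "card t = 2" "v \<in> t"
      using edges_props[of t] by simp_all
    then obtain w where "t = {v, w}" "v \<noteq> w"
      unfolding card_2_iff by blast
    then show "t \<in> (\<lambda>w. {v, w}) ` (skel 0 - {v})"
      using t2(1) by (intro image_eqI[of _ _ w]) simp_all
  qed
  then have "card {t \<in> edges. v \<in> t} \<le> card (skel 0 - {v})"
    using finite_skel by (intro surj_card_le) auto
  also have "\<dots> < card (skel 0)"
    using v finite_skel by (intro psubset_card_mono) auto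
  finally show ?thesis .
qed

text \<open>The alternative \<open>\<delta> \<le> 1\<close> covers a class of parallel edges that
  closes up. It cannot be dropped: a sphere built from digons on two vertices has
  \<open>\<delta> = 1\<close>, while \<open>6 V - 6 \<chi>\<close> is 0.\<close>

lemma min_degree_bounds:
  defines "\<delta> \<equiv> min_degree (skel 0, edges)"
  shows "\<delta> \<le> 1 \<or> int \<delta> * int (card (skel 0)) \<le> 6 * int (card (skel 0)) - 6 * euler_characteristic M"
    and "\<delta> < card (skel 0)"
proof -
  have le: "\<delta> \<le> card {t \<in> edges. v \<in> t}" if "v \<in> skel 0" for v
    using that finite_skel[of 0] by (simp add: \<delta>_def min_degree_def vertex_degree_def)
  obtain v where v: "v \<in> skel 0" using vertices_nonempty by blast
  show "\<delta> < card (skel 0)"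
    using le[OF v] degree_less[OF v] by simp
  show "\<delta> \<le> 1 \<or> int \<delta> * int (card (skel 0)) \<le> 6 * int (card (skel 0)) - 6 * euler_characteristic M"
  proof (cases "\<exists>s\<in>edges. card (digons s) = card (parallels s)")
    case True
    then obtain s where "s \<in> edges" "card (digons s) = card (parallels s)" by blast
    then obtain v where "v \<in> skel 0" "card {t \<in> edges. v \<in> t} \<le> 1"
      by (rule degree_one_vertex)
    then show ?thesis using le[of v] by simp
  next
    case False
    then have "card (digons s) < card (parallels s)" if "s \<in> edges" for s
      using card_digons_le(1)[of s] that by (auto simp: less_le)
    then have P: "int (card edges) \<le> 3 * int (card (skel 0)) - 3 * euler_characteristic M"
      by (rule card_edges_le)
    have "(\<Sum>v\<in>skel 0. \<delta>) \<le> (\<Sum>v\<in>skel 0. card {t \<in> edges. v \<in> t})"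
      using le by (rule sum_mono)
    then have "card (skel 0) * \<delta> \<le> 2 * card edges"
      by (simp add: sum_degrees)
    then have "int (card (skel 0) * \<delta>) \<le> int (2 * card edges)"
      by (simp only: of_nat_le_iff)
    then show ?thesis
      using P by (simp add: mult.commute)
  qed
qed

section \<open>Comparison with the cells and the graph of the definitions\<close>

lemma Sk1_eq:
  assumes cells: "\<And>n. cells M C n = skel n"
  shows "Sk1 M C = (skel 0, edges)"
proof -
  have "{{u, v} | u v. u \<in> skel 0 \<and> v \<in> skel 0 \<and> u \<noteq> v \<and>
      (\<exists>e\<in>skel 1. M closure_of e = e \<union> u \<union> v)} = edges"
  proof (intro equalityI subsetI)
    fix t assume "t \<in> {{u, v} | u v. u \<in> skel 0 \<and> v \<in> skel 0 \<and> u \<noteq> v \<and>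
      (\<exists>e\<in>skel 1. M closure_of e = e \<union> u \<union> v)}"
    then obtain u v e where t: "t = {u, v}" and uv: "u \<in> skel 0" "v \<in> skel 0" "u \<noteq> v" and e: "e \<in> skel 1"
      and cl: "M closure_of e = e \<union> u \<union> v" by blast
    \<comment> \<open>All these sets are disjoint from \<open>e\<close>, so the closure condition
      can be cancelled down to \<open>rim e = u \<union> v\<close>.\<close>
    have "e \<inter> u = {}" "e \<inter> v = {}" "e \<inter> rim e = {}"
      using skel_Int[OF e uv(1)] skel_Int[OF e uv(2)] rim_disjoint[OF skel_C[OF e]] by auto
    then have "rim e = u \<union> v"
      using cl closure_of_cell[OF skel_C[OF e]] by blast
    then have sub: "{u, v} \<subseteq> ends e"
      using uv by (auto simp: ends_def)
    have "card (ends e) = 2" by (rule ends_props(2)[OF e])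
    then have "{u, v} = ends e"
      using sub uv(3) by (intro card_seteq) (auto intro: card_ge_0_finite)
    then show "t \<in> edges" using t e by (auto simp: edges_def)
  next
    fix t assume "t \<in> edges"
    then obtain e where e: "e \<in> skel 1" "t = ends e" by (auto simp: edges_def)
    obtain u v where uv: "ends e = {u, v}" "u \<noteq> v"
      using ends_props(2)[OF e(1)] by (auto simp: card_2_iff)
    have "M closure_of e = e \<union> u \<union> v"
      using closure_of_cell[OF skel_C[OF e(1)]] ends_props(3)[OF e(1)] uv(1) by auto
    moreover have "u \<in> skel 0" "v \<in> skel 0"
      using ends_props(1)[OF e(1)] uv(1) by auto
    ultimately show "t \<in> {{u, v} | u v. u \<in> skel 0 \<and> v \<in> skel 0 \<and> u \<noteq> v \<and>
      (\<exists>e\<in>skel 1. M closure_of e = e \<union> u \<union> v)}"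
      using e uv by blast
  qed
  then show ?thesis
    by (simp add: Sk1_def cells)
qed

end

text \<open>Injectivity on the closed ball is assembled from three facts: the map is a homeomorphism
  on the open ball, regularity handles the sphere, and the two images are disjoint because the
  sphere goes into cells of lower dimension.\<close>

lemma regular_cell_decomposition_surface_cells:
  fixes M :: "'a topology"
  assumes "closed_surface M" "regular_cell_decomposition M C"
  obtains dm :: "'a set \<Rightarrow> nat" and cm where "surface_cells M C dm cm" "\<forall>n. cells M C n = {e \<in> C. dm e = n}"
proof -
  have fin: "finite C" and part: "partition_on (topspace M) C"
    using assms(2) by (auto simp: regular_cell_decomposition_def cell_decomposition_def)
  have "\<forall>e\<in>C. \<exists>n \<phi>. characteristic_map M C n e \<phi> \<and> inj_on \<phi> (unit_sphere n)"
    using assms(2) by (simp add: regular_cell_decomposition_def)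
  then obtain dm :: "'a set \<Rightarrow> nat" and cm where cm: "\<And>e. e \<in> C \<Longrightarrow> characteristic_map M C (dm e) e (cm e)"
    "\<And>e. e \<in> C \<Longrightarrow> inj_on (cm e) (unit_sphere (dm e))"
    by metis
  have cont: "continuous_map (subtopology (Euclidean_space (dm e)) (unit_cball (dm e))) M (cm e)"
    and hom: "homeomorphic_map (subtopology (Euclidean_space (dm e)) (unit_ball (dm e))) (subtopology M e) (cm e)"
    and sph: "cm e ` unit_sphere (dm e) \<subseteq> (\<Union>k<dm e. \<Union>(cells M C k))" if "e \<in> C" for e
    using cm(1)[OF that] by (auto simp: characteristic_map_def)
  have cells: "cells M C n = {e \<in> C. dm e = n}" for n
  proof -
    have "subtopology (Euclidean_space n) (unit_ball n) homeomorphic_space subtopology M e \<longleftrightarrow> dm e = n" if "e \<in> C" for e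
      using unit_ball_dimension_unique homeomorphic_map_imp_homeomorphic_space[OF hom[OF that]] by metis
    then show ?thesis by (auto simp: cells_def)
  qed
  have ball: "cm e ` unit_ball (dm e) = e" if e: "e \<in> C" for e
  proof -
    have "e \<subseteq> topspace M" using part e by (auto simp: partition_on_def)
    then show ?thesis
      using homeomorphic_imp_surjective_map[OF hom[OF e]] unfolding topspace_unit_ball
      by (simp add: topspace_subtopology Int_absorb1)
  qed
  have sphere: "cm e ` unit_sphere (dm e) \<subseteq> \<Union>{f \<in> C. dm f < dm e}" if "e \<in> C" for e
    using sph[OF that] unfolding cells by blast
  have inj: "inj_on (cm e) (unit_cball (dm e))" if e: "e \<in> C" for e
  proof -
    have "inj_on (cm e) (unit_ball (dm e))"
      using homeomorphic_imp_injective_map[OF hom[OF e]] unfolding topspace_unit_ball .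
    moreover have "e \<inter> \<Union>{f \<in> C. dm f < dm e} = {}"
      using part e by (fastforce simp: partition_on_def pairwise_def disjnt_def)
    then have "e \<inter> cm e ` unit_sphere (dm e) = {}"
      using Int_mono[OF subset_refl[of e] sphere[OF e]] by simp
    then have "cm e ` unit_ball (dm e) \<inter> cm e ` unit_sphere (dm e) = {}"
      by (simp only: ball[OF e])
    moreover have "unit_ball (dm e) - unit_sphere (dm e) = unit_ball (dm e)"
      "unit_sphere (dm e) - unit_ball (dm e) = unit_sphere (dm e)"
      using unit_ball_sphere_disjoint[of "dm e"] by auto
    ultimately show ?thesis
      using cm(2)[OF e] by (simp only: unit_cball_eq_Un inj_on_Un simp_thms)
  qed
  have "surface_cells M C dm cm"
    by (rule surface_cells.intro) (fact assms(1) fin part cont inj ball sphere)+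
  moreover have "\<forall>n. cells M C n = {e \<in> C. dm e = n}"
    by (rule allI) (rule cells)
  ultimately show thesis
    by (rule that)
qed

theorem theorem4:
  fixes M :: "'a topology" and C :: "'a set set"
  assumes "closed_surface M"
    and "regular_cell_decomposition M C"
  shows "(euler_characteristic M > 0 \<longrightarrow> min_degree (Sk1 M C) \<le> 5) \<and>
         (euler_characteristic M \<le> 0 \<longrightarrow>
            int (min_degree (Sk1 M C)) \<le>
              \<lfloor>(1 / 2 :: real) * (5 + sqrt (49 - 24 * real_of_int (euler_characteristic M)))\<rfloor>)"
proof -
  obtain dm :: "'a set \<Rightarrow> nat" and cm where S: "surface_cells M C dm cm" and cells: "\<forall>n. cells M C n = {e \<in> C. dm e = n}"
    by (rule regular_cell_decomposition_surface_cells[OF assms])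
  interpret surface_cells M C dm cm by (rule S)
  define d v X where "d = int (min_degree (Sk1 M C))" and "v = int (card (skel 0))"
    and "X = euler_characteristic M"
  have Sk1: "Sk1 M C = (skel 0, edges)"
    by (rule Sk1_eq) (simp add: cells skel_def)
  have d: "0 \<le> d" "d \<le> 1 \<or> d * v \<le> 6 * v - 6 * X" "d < v"
    using min_degree_bounds unfolding d_def v_def X_def Sk1 by auto
  have a: "d \<le> 5" if "X > 0"
  proof (rule ccontr)
    assume "\<not> d \<le> 5"
    \<comment> \<open>A degree of at least 6 would give
      \<open>6 * v \<le> d * v \<le> 6 * v - 6 * X < 6 * v\<close>.\<close>
    then have "6 * v \<le> d * v" using d by (intro mult_right_mono) auto
    then show False using d that \<open>\<not> d \<le> 5\<close> by linarith
  qed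
  have b: "d \<le> \<lfloor>(1 / 2 :: real) * (5 + sqrt (49 - 24 * real_of_int X))\<rfloor>" if "X \<le> 0"
  proof -
    \<comment> \<open>For \<open>X \<le> 0\<close> the square root is at least 7, so
      \<open>d \<le> 6\<close> satisfies the bound at once. For larger \<open>d\<close> the factor
      \<open>d - 6\<close> is positive, which permits replacing \<open>v\<close> by
      \<open>d + 1\<close>; four times \<open>(d - 6) * (d + 1)\<close> is
      \<open>(2 * d - 5)^2 - 49\<close>.\<close>
    have "2 * d - 5 \<le> 7 \<or> (2 * d - 5)\<^sup>2 \<le> 49 - 24 * X"
    proof (cases "d \<le> 6")
      case False
      then have "(d - 6) * v \<le> - 6 * X" using d by (auto simp: algebra_simps)
      moreover have "(d - 6) * (d + 1) \<le> (d - 6) * v"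
        using False d by (intro mult_left_mono) auto
      ultimately have "(d - 6) * (d + 1) \<le> - 6 * X" by linarith
      then show ?thesis by (simp add: power2_eq_square algebra_simps)
    qed simp
    then have "real_of_int (2 * d - 5) \<le> sqrt (49 - 24 * real_of_int X)"
    proof
      assume "2 * d - 5 \<le> 7"
      then have "real_of_int (2 * d - 5) \<le> sqrt (7\<^sup>2)" by simp
      also have "\<dots> \<le> sqrt (49 - 24 * real_of_int X)"
        using that by (intro real_sqrt_le_mono) simp
      finally show ?thesis .
    next
      assume "(2 * d - 5)\<^sup>2 \<le> 49 - 24 * X"
      then have "real_of_int ((2 * d - 5)\<^sup>2) \<le> real_of_int (49 - 24 * X)"
        by (simp only: of_int_le_iff)
      then show ?thesis by (intro real_le_rsqrt) simp
    qed
    then show ?thesis by (simp add: le_floor_iff)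
  qed
  show ?thesis
    using a b unfolding d_def X_def by auto
qed

end
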